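(* Let $f:\mathbb{CP}^1\to\mathbb{CP}^1$ be a rational function, and let $\mathcal O$ be a good orbifold on $\mathbb{CP}^1$ such that $\chi(f^*(\mathcal O))>0$. Then $\chi(\mathcal O)>0$, and the following holds: (i) There exists a rational function $q$ such that $f\circ\theta_{f^*(\mathcal O)}=\theta_{\mathcal O}\circ q$. In particular, the product $\deg\theta_{f^*(\mathcal O)}\cdot\deg f$ is divisible by $\deg\theta_{\mathcal O}$. (ii) There exist rational functions $w$ and $t$ such that $f=w\circ t$ and $\theta_{\mathcal O}=w\circ\theta_{f^*(\mathcal O)}$. Moreover, $w:f^*(\mathcal O)\to\mathcal O$ is a covering map between orbifolds. In particular, $\deg w=\chi(f^*(\mathcal O))/\chi(\mathcal O)$.
   Context: Rational functions are non-constant, viewed as holomorphic maps $\mathbb{CP}^1\to\mathbb{CP}^1$; $\deg_z f$ denotes the local degree (multiplicity) of $f$ at $z$. An orbifold $\mathcal O=(R,\nu)$ is a (connected) Riemann surface $R$ with a ramification function $\nu:R\to\mathbb N=\{1,2,\dots\}$ equal to $1$ except at isolated points; it is non-ramified if $\nu\equiv1$. For compact $R$ its Euler characteristic is $\chi(\mathcal O)=\chi(R)+\sum_{z\in R}\left(\frac1{\nu(z)}-1\right)$. $\mathcal O$ is bad if $R=\mathbb{CP}^1$ and either exactly one point has $\nu>1$, or exactly two points $z_1,z_2$ have $\nu>1$ and $\nu(z_1)\ne\nu(z_2)$; otherwise it is good. For a holomorphic map $f:R'\to R$ between compact Riemann surfaces and an orbifold $\mathcal O=(R,\nu)$, the orbifold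 $f^*(\mathcal O)=(R',\nu')$ is defined by $\nu'(z)=\nu(f(z))/\gcd(\deg_z f,\nu(f(z)))$. If $f$ is a rational function and $\mathcal O$ is a good orbifold on $\mathbb{CP}^1$, then $f^*(\mathcal O)$ is good. For orbifolds $\mathcal O_1=(R_1,\nu_1)$, $\mathcal O_2=(R_2,\nu_2)$, a holomorphic branched covering map $f:R_1\to R_2$ is a covering map between orbifolds $f:\mathcal O_1\to\mathcal O_2$ if $\nu_2(f(z))=\nu_1(z)\deg_z f$ for all $z\in R_1$. A universal covering of $\mathcal O$ is a covering map between orbifolds $\theta_{\mathcal O}:\widetilde{\mathcal O}\to\mathcal O$ where $\widetilde{\mathcal O}$ is non-ramified with simply connected underlying surface $\widetilde R$. It exists and is unique up to a conformal isomorphism of $\widetilde R$ whenever $\mathcal O$ is good. If $\mathcal O$ is a good orbifold on $\mathbb{CP}^1$ with $\chi(\mathcal O)>0$, then $\widetilde R=\mathbb{CP}^1$ and $\theta_{\mathcal O}$ is a rational function, defined up to the change $\theta_{\mathcal O}\mapsto\theta_{\mathcal O}\circ\mu$ with $\mu$ a Möbius transformation; the equality $\theta_{\mathcal O}=w\circ\theta_{f^*(\mathcal O)}$ is understood up to this choice, i.e. for a suitable choice of the universal coverings. *)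

theory Defs
  imports "HOL-Complex_Analysis.Complex_Analysis"
begin

datatype riemann_sphere = Fin complex | Infty

text \<open>
  The map given by \<open>p / q\<close> for coprime \<open>p\<close> and \<open>q\<close>. The value at \<open>Infty\<close> is the limit, i.e. the
  value at \<open>0\<close> of the quotient of the two polynomials \<open>u ^ d * p (1 / u)\<close> and \<open>u ^ d * q (1 / u)\<close>.
\<close>

fun quotient_map_of :: "complex poly \<Rightarrow> complex poly \<Rightarrow> riemann_sphere \<Rightarrow> riemann_sphere" where
  "quotient_map_of p q (Fin z) =
     (if poly q z = 0 then Infty else Fin (poly p z / poly q z))"
| "quotient_map_of p q Infty =
     (let d = max (degree p) (degree q)
      in if coeff q d = 0 then Infty else Fin (coeff p d / coeff q d))"

text \<open>Non-constancy is part of the notion. The case \<open>q = 0\<close> is excluded, since \<open>coprime p 0\<close>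
  forces \<open>p\<close> to be constant.\<close>

definition rational_function :: "(riemann_sphere \<Rightarrow> riemann_sphere) \<Rightarrow> bool" where
  "rational_function f \<longleftrightarrow>
     (\<exists>p q. coprime p q \<and> max (degree p) (degree q) \<ge> 1 \<and> f = quotient_map_of p q)"

definition rat_degree :: "(riemann_sphere \<Rightarrow> riemann_sphere) \<Rightarrow> nat" where
  "rat_degree f =
     (THE n. \<exists>p q. coprime p q \<and> f = quotient_map_of p q \<and> n = max (degree p) (degree q))"

text \<open>
  Local coordinates centred at a point: \<open>param z\<close> is a local parametrisation sending \<open>0\<close> to \<open>z\<close>,
  and \<open>local_coord z\<close> is its inverse near \<open>z\<close>. The value \<open>0\<close> of \<open>local_coord z\<close> at the point outside
  the domain of the chart is a dummy; only the germ at \<open>z\<close> is used.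
\<close>

fun param :: "riemann_sphere \<Rightarrow> complex \<Rightarrow> riemann_sphere" where
  "param (Fin a) u = Fin (a + u)"
| "param Infty u = (if u = 0 then Infty else Fin (1 / u))"

fun local_coord :: "riemann_sphere \<Rightarrow> riemann_sphere \<Rightarrow> complex" where
  "local_coord (Fin a) (Fin w) = w - a"
| "local_coord (Fin a) Infty = 0"
| "local_coord Infty (Fin w) = 1 / w"
| "local_coord Infty Infty = 0"

definition local_degree :: "(riemann_sphere \<Rightarrow> riemann_sphere) \<Rightarrow> riemann_sphere \<Rightarrow> nat" where
  "local_degree f z = nat (zorder (\<lambda>u. local_coord (f z) (f (param z u))) 0)"

text \<open>
  An orbifold on the sphere is identified with its ramification function. By compactness, being
  equal to \<open>1\<close> except at isolated points means being equal to \<open>1\<close> except at finitely many points.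
\<close>

definition orbifold :: "(riemann_sphere \<Rightarrow> nat) \<Rightarrow> bool" where
  "orbifold \<nu> \<longleftrightarrow> (\<forall>z. \<nu> z \<ge> 1) \<and> finite {z. \<nu> z > 1}"

definition bad_orbifold :: "(riemann_sphere \<Rightarrow> nat) \<Rightarrow> bool" where
  "bad_orbifold \<nu> \<longleftrightarrow> orbifold \<nu> \<and>
     ((\<exists>z. {x. \<nu> x > 1} = {z}) \<or>
      (\<exists>z1 z2. z1 \<noteq> z2 \<and> {x. \<nu> x > 1} = {z1, z2} \<and> \<nu> z1 \<noteq> \<nu> z2))"

definition good_orbifold :: "(riemann_sphere \<Rightarrow> nat) \<Rightarrow> bool" where
  "good_orbifold \<nu> \<longleftrightarrow> orbifold \<nu> \<and> \<not> bad_orbifold \<nu>"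

text \<open>The summand \<open>2\<close> is the Euler characteristic of the sphere; the points with \<open>\<nu> z = 1\<close>
  contribute nothing to the sum.\<close>

definition orbifold_euler :: "(riemann_sphere \<Rightarrow> nat) \<Rightarrow> real" where
  "orbifold_euler \<nu> = 2 + (\<Sum>z\<in>{z. \<nu> z > 1}. (1 / real (\<nu> z) - 1))"

definition pullback_orbifold ::
    "(riemann_sphere \<Rightarrow> riemann_sphere) \<Rightarrow> (riemann_sphere \<Rightarrow> nat) \<Rightarrow> riemann_sphere \<Rightarrow> nat" where
  "pullback_orbifold f \<nu> z = \<nu> (f z) div gcd (local_degree f z) (\<nu> (f z))"

text \<open>The holomorphic branched coverings of the sphere by itself are the rational functions.\<close>

definition orbifold_covering ::
    "(riemann_sphere \<Rightarrow> nat) \<Rightarrow> (riemann_sphere \<Rightarrow> riemann_sphere) \<Rightarrow> (riemann_sphere \<Rightarrow> nat) \<Rightarrow> bool"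
  where
  "orbifold_covering \<nu>1 f \<nu>2 \<longleftrightarrow>
     rational_function f \<and> (\<forall>z. \<nu>2 (f z) = \<nu>1 z * local_degree f z)"

text \<open>
  Universal coverings whose total space is the sphere (which is simply connected), endowed with
  the non-ramified orbifold structure. For a good orbifold on the sphere with positive Euler
  characteristic these are, up to a conformal isomorphism of the total space, all its universal
  coverings.
\<close>

definition universal_covering ::
    "(riemann_sphere \<Rightarrow> nat) \<Rightarrow> (riemann_sphere \<Rightarrow> riemann_sphere) \<Rightarrow> bool" where
  "universal_covering \<nu> \<theta> \<longleftrightarrow> orbifold_covering (\<lambda>_. 1) \<theta> \<nu>"

end

theory Submission
  imports Defs
    "HOL-Computational_Algebra.Fundamental_Theorem_Algebra"
    "HOL-Computational_Algebra.Polynomial_Factorial"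
    "HOL-Computational_Algebra.Field_as_Ring"
begin

text \<open>
  The local degrees of \<open>f \<circ> \<theta>'\<close> are multiples of the ramification indices of \<open>\<nu>\<close>, so that
  \<open>f \<circ> \<theta>'\<close> lifts locally through \<open>\<theta>\<close>. A lift over a disc extends past the boundary circle, which
  yields a lift \<open>q\<close> over the plane; near infinity it keeps away from some value, hence it is rational.
  Lifting \<open>\<theta>\<close> through itself shows that the deck groups act transitively on fibres.

  The relation \<open>q \<circ> \<sigma> = \<tau> \<circ> q\<close> defines a homomorphism from the deck group of \<open>\<theta>'\<close> to that of \<open>\<theta>\<close>. It
  is injective: a Moebius transformation has a fixed point \<open>z\<close>, and the local degree of \<open>q\<close> at \<open>z\<close> is
  coprime to the ramification index of the pullback at \<open>\<theta>' z\<close>. If \<open>\<psi>\<close> is the quotient by its image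
  \<open>\<Gamma>\<close>, then \<open>\<theta> = w \<circ> \<psi>\<close> and \<open>\<psi> \<circ> q = t \<circ> \<theta>'\<close>, hence \<open>f = w \<circ> t\<close>. The quotient orbifold of \<open>\<Gamma>\<close> and
  the pullback have the same Euler characteristic and the same largest ramification index, which
  determine a spherical signature, so that a Moebius transformation identifies them.

  Universal coverings exist because every spherical signature is reached from the trivial one by
  a chain of coverings given by power maps and one quintic polynomial. The pullback is good because
  a rational map satisfying the divisibility condition over the plane lifts, and therefore
  satisfies it at infinity as well.
\<close>

section \<open>Germs of maps of the sphere\<close>

lemma param_0 [simp]: "param z 0 = z"
  by (cases z) auto

lemma local_coord_param [simp]: "local_coord z (param z u) = u"
  by (cases z) auto

lemma param_eq_iff [simp]: "param z u = param z v \<longleftrightarrow> u = v"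
  by (metis local_coord_param)

lemma param_transition:
  "\<exists>T. T analytic_on {0} \<and> T 0 = 0 \<and> (\<forall>\<^sub>F v in nhds 0. param c (s + v) = param (param c s) (T v))"
proof (cases "c = Infty \<and> s \<noteq> 0")
  case True
  have "\<forall>\<^sub>F v in nhds 0. s + v \<noteq> 0"
    using True tendsto_add[OF tendsto_const filterlim_ident, of s 0]
    by (intro tendsto_imp_eventually_ne[of _ s]) auto
  then show ?thesis using True
    by (intro exI[of _ "\<lambda>v. 1 / (s + v) - 1 / s"]) (auto intro!: analytic_intros elim!: eventually_mono)
next
  case False
  then show ?thesis
    by (intro exI[of _ "\<lambda>v. v"]) (cases c; auto intro!: always_eventually simp: add_ac)
qed

lemma param_transition':
  "\<exists>T. T analytic_on {0} \<and> T 0 = s \<and> (\<forall>\<^sub>F v in nhds 0. param (param c s) v = param c (T v))"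
proof (cases "c = Infty \<and> s \<noteq> 0")
  case True
  have "\<forall>\<^sub>F v in nhds 0. 1 / s + v \<noteq> 0"
    using True tendsto_add[OF tendsto_const filterlim_ident, of "1 / s" 0]
    by (intro tendsto_imp_eventually_ne[of _ "1 / s"]) auto
  then show ?thesis using True
    by (intro exI[of _ "\<lambda>v. 1 / (1 / s + v)"]) (auto intro!: analytic_intros elim!: eventually_mono)
next
  case False
  then show ?thesis
    by (intro exI[of _ "\<lambda>v. s + v"]) (cases c; auto intro!: analytic_intros always_eventually simp: add_ac)
qed

definition germ :: "(riemann_sphere \<Rightarrow> riemann_sphere) \<Rightarrow> riemann_sphere \<Rightarrow> (complex \<Rightarrow> complex) \<Rightarrow> bool"
  where "germ f z h \<longleftrightarrow> h analytic_on {0} \<and> h 0 = 0 \<and>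
           (\<forall>\<^sub>F u in nhds 0. f (param z u) = param (f z) (h u))"

definition hol_at :: "(riemann_sphere \<Rightarrow> riemann_sphere) \<Rightarrow> riemann_sphere \<Rightarrow> bool"
  where "hol_at f z \<longleftrightarrow> (\<exists>h. germ f z h)"

lemma analytic_tendsto_nhds:
  assumes "h analytic_on {x::complex}" shows "(h \<longlongrightarrow> h x) (nhds x)"
  using analytic_at_imp_isCont[OF assms] by (simp add: isCont_def tendsto_at_iff_tendsto_nhds)

lemma analytic_nearby:
  assumes "h analytic_on {x :: complex}" shows "\<forall>\<^sub>F y in nhds x. h analytic_on {y}"
proof -
  obtain r where r: "r > 0" "h holomorphic_on ball x r" using assms by (auto simp: analytic_on_def)
  have "\<forall>\<^sub>F s in nhds x. s \<in> ball x r" using r by (intro eventually_nhds_in_open) auto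
  then show ?thesis by eventually_elim (use r in \<open>meson analytic_at open_ball\<close>)
qed

lemma at_le_nhds: "at x \<le> nhds x"
  by (simp add: at_within_def)

lemma germ_tendsto: "germ f z h \<Longrightarrow> (h \<longlongrightarrow> 0) (nhds 0)"
  using analytic_tendsto_nhds[of h 0] by (simp add: germ_def)

lemma germ_id: "germ (\<lambda>x. x) z (\<lambda>u. u)"
  by (auto simp: germ_def intro!: analytic_intros)

lemma germ_compose:
  assumes "germ g z k" "germ f (g z) h"
  shows "germ (f \<circ> g) z (h \<circ> k)"
proof -
  have "\<forall>\<^sub>F u in nhds 0. f (param (g z) (k u)) = param (f (g z)) (h (k u))"
    using assms germ_tendsto[OF assms(1)] by (auto simp: germ_def filterlim_iff)
  moreover have "\<forall>\<^sub>F u in nhds 0. g (param z u) = param (g z) (k u)"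
    using assms by (auto simp: germ_def)
  ultimately have "\<forall>\<^sub>F u in nhds 0. (f \<circ> g) (param z u) = param ((f \<circ> g) z) ((h \<circ> k) u)"
    by eventually_elim auto
  then show ?thesis using assms
    unfolding germ_def by (auto intro!: analytic_on_compose)
qed

lemma hol_at_id: "hol_at (\<lambda>x. x) z"
  using germ_id by (auto simp: hol_at_def)

lemma hol_at_compose: "hol_at g z \<Longrightarrow> hol_at f (g z) \<Longrightarrow> hol_at (f \<circ> g) z"
  by (meson germ_compose hol_at_def)

lemma hol_at_const: "hol_at (\<lambda>_. c) z"
  unfolding hol_at_def germ_def by (intro exI[of _ "\<lambda>_. 0"]) auto

lemma hol_at_chartI:
  assumes W: "W analytic_on {s}" and ev: "\<forall>\<^sub>F v in nhds s. f (param c v) = param d (W v)"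
  shows "hol_at f (param c s)"
proof -
  obtain T where T: "T analytic_on {0}" "T 0 = s" "\<forall>\<^sub>F v in nhds 0. param (param c s) v = param c (T v)"
    using param_transition'[of s c] by blast
  obtain T2 where T2: "T2 analytic_on {0}" "T2 0 = 0"
    "\<forall>\<^sub>F v in nhds 0. param d (W s + v) = param (param d (W s)) (T2 v)"
    using param_transition[of d "W s"] by blast
  define h where "h = T2 \<circ> (\<lambda>v. W (T v) - W s)"
  have WT: "(W \<circ> T) analytic_on {0}" by (rule analytic_on_compose) (use T W in auto)
  have k: "(\<lambda>v. W (T v) - W s) analytic_on {0}"
    using WT by (auto simp: o_def intro!: analytic_intros)
  have kl: "((\<lambda>v. W (T v) - W s) \<longlongrightarrow> 0) (nhds 0)"
    using analytic_tendsto_nhds[OF k] T by simp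
  have Tl: "(T \<longlongrightarrow> s) (nhds 0)" using analytic_tendsto_nhds[OF T(1)] T by simp
  have fs: "f (param c s) = param d (W s)" using eventually_nhds_x_imp_x[OF ev] .
  have "h analytic_on {0}" unfolding h_def by (rule analytic_on_compose) (use T2 T k in auto)
  moreover have "h 0 = 0" by (simp add: h_def T T2)
  moreover have "\<forall>\<^sub>F v in nhds 0. f (param (param c s) v) = param (f (param c s)) (h v)"
  proof -
    have "\<forall>\<^sub>F v in nhds 0. f (param c (T v)) = param d (W (T v))"
      using Tl ev by (auto simp: filterlim_iff)
    moreover have "\<forall>\<^sub>F v in nhds 0. param d (W s + (W (T v) - W s)) = param (param d (W s)) (T2 (W (T v) - W s))"
      using kl T2(3) unfolding filterlim_iff by blast
    ultimately show ?thesis using T(3) by eventually_elim (simp add: h_def fs)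
  qed
  ultimately show ?thesis unfolding hol_at_def germ_def by blast
qed

lemma hol_at_chartE:
  assumes "hol_at f (param c s)" "f (param c s) = param d y"
  obtains W where "W analytic_on {s}" "W s = y" "\<forall>\<^sub>F v in nhds s. f (param c v) = param d (W v)"
proof -
  obtain h where h: "h analytic_on {0}" "h 0 = 0"
    "\<forall>\<^sub>F u in nhds 0. f (param (param c s) u) = param (param d y) (h u)"
    using assms by (auto simp: hol_at_def germ_def)
  obtain T where T: "T analytic_on {0}" "T 0 = 0" "\<forall>\<^sub>F v in nhds 0. param c (s + v) = param (param c s) (T v)"
    using param_transition[of c s] by blast
  obtain T2 where T2: "T2 analytic_on {0}" "T2 0 = y"
    "\<forall>\<^sub>F v in nhds 0. param (param d y) v = param d (T2 v)"
    using param_transition'[of y d] by blast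
  define W where "W = (T2 \<circ> (h \<circ> T)) \<circ> (\<lambda>v. v - s)"
  have hT: "(h \<circ> T) analytic_on {0}" by (rule analytic_on_compose) (use h T in auto)
  have 1: "(T2 \<circ> (h \<circ> T)) analytic_on {0}" by (rule analytic_on_compose[OF hT]) (use h T T2 in auto)
  have W: "W analytic_on {s}" unfolding W_def
    by (rule analytic_on_compose) (use 1 in \<open>auto intro!: analytic_intros\<close>)
  have Tl: "(T \<longlongrightarrow> 0) (nhds 0)" using analytic_tendsto_nhds[OF T(1)] T by simp
  have hTl: "((h \<circ> T) \<longlongrightarrow> 0) (nhds 0)" using analytic_tendsto_nhds[OF hT] T h by simp
  have "\<forall>\<^sub>F v in nhds 0. f (param (param c s) (T v)) = param (param d y) (h (T v))"
    using Tl h(3) by (auto simp: filterlim_iff)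
  moreover have "\<forall>\<^sub>F v in nhds 0. param (param d y) (h (T v)) = param d (T2 (h (T v)))"
    using hTl T2(3) by (auto simp: filterlim_iff)
  ultimately have ev: "\<forall>\<^sub>F v in nhds 0. f (param c (s + v)) = param d (T2 (h (T v)))"
    using T(3) by eventually_elim simp
  have "((\<lambda>v. v - s) \<longlongrightarrow> 0) (nhds s)"
    using tendsto_diff[of "\<lambda>x. x" s "nhds s" "\<lambda>_. s" s] by (simp add: filterlim_ident)
  then have "\<forall>\<^sub>F v in nhds s. f (param c (s + (v - s))) = param d (T2 (h (T (v - s))))"
    using ev by (auto simp: filterlim_iff)
  then have "\<forall>\<^sub>F v in nhds s. f (param c v) = param d (W v)"
    by (simp add: W_def)
  then show ?thesis using that W h T T2 by (auto simp: W_def)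
qed

definition ord_at :: "(complex \<Rightarrow> complex) \<Rightarrow> nat \<Rightarrow> bool" where
  "ord_at h n \<longleftrightarrow> (\<exists>k. k analytic_on {0} \<and> k 0 \<noteq> 0 \<and> (\<forall>\<^sub>F u in nhds 0. h u = u ^ n * k u))"

lemma ord_at_cong:
  assumes "\<forall>\<^sub>F u in nhds 0. h u = h' u" "ord_at h n" shows "ord_at h' n"
proof -
  obtain k where k: "k analytic_on {0}" "k 0 \<noteq> 0" "\<forall>\<^sub>F u in nhds 0. h u = u ^ n * k u"
    using assms by (auto simp: ord_at_def)
  have "\<forall>\<^sub>F u in nhds 0. h' u = u ^ n * k u" using assms(1) k(3) by eventually_elim simp
  with k show ?thesis unfolding ord_at_def by blast
qed

lemma ord_at_mult: "ord_at f n \<Longrightarrow> ord_at g m \<Longrightarrow> ord_at (\<lambda>u. f u * g u) (n + m)"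
  unfolding ord_at_def
proof safe
  fix k l assume *: "k analytic_on {0}" "k 0 \<noteq> (0::complex)" "l analytic_on {0}" "l 0 \<noteq> (0::complex)"
    "\<forall>\<^sub>F u in nhds 0. f u = u ^ n * k u" "\<forall>\<^sub>F u in nhds 0. g u = u ^ m * l u"
  have "\<forall>\<^sub>F u in nhds 0. f u * g u = u ^ (n + m) * (k u * l u)"
    using *(5,6) by eventually_elim (simp add: power_add)
  then show "\<exists>k. k analytic_on {0} \<and> k 0 \<noteq> 0 \<and> (\<forall>\<^sub>F u in nhds 0. f u * g u = u ^ (n + m) * k u)"
    using * by (intro exI[of _ "\<lambda>u. k u * l u"]) (auto intro!: analytic_intros)
qed

lemma ord_at_unit: "k analytic_on {0} \<Longrightarrow> k 0 \<noteq> 0 \<Longrightarrow> ord_at k 0"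
  unfolding ord_at_def by auto

lemma ord_at_compose:
  assumes "ord_at h n" "ord_at k m" "k analytic_on {0}" "k 0 = 0"
  shows "ord_at (h \<circ> k) (n * m)"
proof -
  obtain a where a: "a analytic_on {0}" "a 0 \<noteq> 0" "\<forall>\<^sub>F u in nhds 0. h u = u ^ n * a u"
    using assms by (auto simp: ord_at_def)
  obtain b where b: "b analytic_on {0}" "b 0 \<noteq> 0" "\<forall>\<^sub>F u in nhds 0. k u = u ^ m * b u"
    using assms by (auto simp: ord_at_def)
  have "(k \<longlongrightarrow> 0) (nhds 0)" using analytic_tendsto_nhds[of k 0] assms by simp
  then have "\<forall>\<^sub>F u in nhds 0. h (k u) = k u ^ n * a (k u)"
    using a by (auto simp: filterlim_iff)
  then have "\<forall>\<^sub>F u in nhds 0. (h \<circ> k) u = u ^ (n * m) * (b u ^ n * a (k u))"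
    using b(3) by eventually_elim (simp add: power_mult_distrib power_mult mult.commute)
  moreover have "(a \<circ> k) analytic_on {0}" by (rule analytic_on_compose) (use assms a in auto)
  then have "(\<lambda>u. b u ^ n * a (k u)) analytic_on {0}"
    using b by (auto intro!: analytic_intros simp: o_def)
  ultimately show ?thesis unfolding ord_at_def
    using a b assms by (intro exI[of _ "\<lambda>u. b u ^ n * a (k u)"]) auto
qed

lemma ord_at_nonzero:
  assumes "ord_at h n" shows "\<forall>\<^sub>F u in at 0. h u \<noteq> 0"
proof -
  obtain a where a: "a analytic_on {0}" "a 0 \<noteq> 0" "\<forall>\<^sub>F u in nhds 0. h u = u ^ n * a u"
    using assms by (auto simp: ord_at_def)
  have "\<forall>\<^sub>F u in nhds 0. a u \<noteq> 0"
    using analytic_tendsto_nhds[OF a(1)] a(2) by (rule tendsto_imp_eventually_ne)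
  with a(3) show ?thesis unfolding eventually_at_filter
    by eventually_elim auto
qed

lemma ord_at_pos: "ord_at h n \<Longrightarrow> h 0 = 0 \<Longrightarrow> 0 < n"
  unfolding ord_at_def by (auto dest!: eventually_nhds_x_imp_x intro!: gr0I)

lemma analytic_ord_cases:
  assumes "h analytic_on {0}"
  shows "(\<forall>\<^sub>F u in nhds 0. h u = 0) \<or> (\<exists>n. ord_at h n)"
proof (cases "h 0 = 0")
  case False then show ?thesis using assms ord_at_unit by blast
next
  case True
  obtain r where r: "r > 0" "h holomorphic_on ball 0 r"
    using assms by (auto simp: analytic_on_def)
  show ?thesis
  proof (cases "h constant_on ball 0 r")
    case True
    then have "\<forall>u\<in>ball 0 r. h u = 0" using \<open>h 0 = 0\<close> r
      by (metis centre_in_ball constant_on_def)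
    then show ?thesis using r by (auto simp: eventually_nhds intro!: exI[of _ "ball 0 r"])
  next
    case False
    have z0: "0 \<in> ball 0 r" using r by simp
    have "\<exists>g s n. 0 < s \<and> g holomorphic_on ball 0 s \<and>
        (\<forall>w\<in>ball 0 s. h w = w ^ n * g w) \<and> (\<forall>w\<in>ball 0 s. g w \<noteq> 0)"
      by (rule holomorphic_factor_zero_nonconstant[OF r(2) open_ball connected_ball z0 True False])
        (intro exI conjI ballI; (assumption | simp))
    then obtain g s n where g: "0 < s" "g holomorphic_on ball 0 s"
      "\<And>w. w \<in> ball 0 s \<Longrightarrow> h w = w ^ n * g w" "\<And>w. w \<in> ball 0 s \<Longrightarrow> g w \<noteq> 0" by blast
    have "g analytic_on {0}" "g 0 \<noteq> 0" "\<forall>\<^sub>F u in nhds 0. h u = u ^ n * g u"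
      using g by (auto simp: analytic_on_def eventually_nhds intro!: exI[of _ "ball 0 s"])
    then have "ord_at h n" unfolding ord_at_def by blast
    then show ?thesis by blast
  qed
qed

lemma local_degree_eqI:
  assumes "germ f z h" "ord_at h n"
  shows "local_degree f z = n"
proof -
  obtain a where a: "a analytic_on {0}" "a 0 \<noteq> 0" "\<forall>\<^sub>F u in nhds 0. h u = u ^ n * a u"
    using assms by (auto simp: ord_at_def)
  have "\<forall>\<^sub>F u in nhds 0. f (param z u) = param (f z) (h u)" using assms by (simp add: germ_def)
  with a(3) have "\<forall>\<^sub>F u in nhds 0. local_coord (f z) (f (param z u)) = a u * u ^ n"
    by eventually_elim simp
  then obtain S where S: "open S" "0 \<in> S" "\<forall>u\<in>S. local_coord (f z) (f (param z u)) = a u * u ^ n"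
    by (auto simp: eventually_nhds)
  obtain r where r: "r > 0" "a holomorphic_on ball 0 r" using a by (auto simp: analytic_on_def)
  have "zorder (\<lambda>u. local_coord (f z) (f (param z u))) 0 = int n"
    by (rule zorder_eqI[of "S \<inter> ball 0 r" _ a]) (use S r a in \<open>auto intro: holomorphic_on_subset\<close>)
  then show ?thesis by (simp add: local_degree_def)
qed

text \<open>The sphere is Hausdorff.\<close>

lemma param_separated:
  assumes "x \<noteq> y" "(h \<longlongrightarrow> 0) F" "(k \<longlongrightarrow> 0) F"
  shows "\<forall>\<^sub>F u in F. param x (h u) \<noteq> param y (k u)"
proof -
  have aux: "\<forall>\<^sub>F u in F. param (Fin a) (h u) \<noteq> param Infty (k u)"
    if "(h \<longlongrightarrow> 0) F" "(k \<longlongrightarrow> 0) F" for a h k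
  proof -
    have "((\<lambda>u. (a + h u) * k u) \<longlongrightarrow> (a + 0) * 0) F" by (intro tendsto_intros that)
    then have "\<forall>\<^sub>F u in F. (a + h u) * k u \<noteq> 1"
      by (rule tendsto_imp_eventually_ne) simp
    then show ?thesis by eventually_elim (auto simp: field_simps)
  qed
  show ?thesis
  proof (cases x; cases y)
    fix a b assume ab: "x = Fin a" "y = Fin b"
    have "((\<lambda>u. h u - k u) \<longlongrightarrow> 0 - 0) F" by (intro tendsto_intros assms)
    then have "\<forall>\<^sub>F u in F. h u - k u \<noteq> b - a"
      by (rule tendsto_imp_eventually_ne) (use ab assms in auto)
    then show ?thesis by eventually_elim (auto simp: ab algebra_simps)
  next
    fix a assume "x = Fin a" "y = Infty" then show ?thesis using aux[of h k a] assms by auto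
  next
    fix a assume "x = Infty" "y = Fin a" then show ?thesis using aux[of k h a] assms
      by (auto elim!: eventually_mono)
  qed (use assms in auto)
qed

lemma hol_at_dichotomy:
  assumes "hol_at f z" "hol_at g z"
  shows "(\<forall>\<^sub>F u in nhds 0. f (param z u) = g (param z u)) \<or> (\<forall>\<^sub>F u in at 0. f (param z u) \<noteq> g (param z u))"
proof -
  obtain h k where h: "germ f z h" and k: "germ g z k" using assms by (auto simp: hol_at_def)
  have e: "\<forall>\<^sub>F u in nhds 0. f (param z u) = param (f z) (h u) \<and> g (param z u) = param (g z) (k u)"
    using h k by (auto simp: germ_def intro: eventually_conj)
  show ?thesis
  proof (cases "f z = g z")
    case False
    from param_separated[OF this germ_tendsto[OF h] germ_tendsto[OF k]] e
    have "\<forall>\<^sub>F u in nhds 0. f (param z u) \<noteq> g (param z u)" by eventually_elim auto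
    then have "\<forall>\<^sub>F u in at 0. f (param z u) \<noteq> g (param z u)"
      unfolding eventually_at_filter by eventually_elim auto
    then show ?thesis ..
  next
    case True
    have "(\<lambda>u. h u - k u) analytic_on {0}" using h k by (auto simp: germ_def intro!: analytic_intros)
    from analytic_ord_cases[OF this] show ?thesis
    proof
      assume "\<forall>\<^sub>F u in nhds 0. h u - k u = 0"
      with e have "\<forall>\<^sub>F u in nhds 0. f (param z u) = g (param z u)" by eventually_elim (use True in auto)
      then show ?thesis ..
    next
      assume "\<exists>n. ord_at (\<lambda>u. h u - k u) n"
      then have "\<forall>\<^sub>F u in at 0. h u - k u \<noteq> 0" using ord_at_nonzero by blast
      moreover have "\<forall>\<^sub>F u in at 0. f (param z u) = param (f z) (h u) \<and> g (param z u) = param (g z) (k u)"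
        using e by (auto simp: eventually_at_filter elim: eventually_mono)
      ultimately have "\<forall>\<^sub>F u in at 0. f (param z u) \<noteq> g (param z u)" by eventually_elim (use True in auto)
      then show ?thesis ..
    qed
  qed
qed

lemma hol_at_eqI:
  assumes "hol_at f z" "hol_at g z" "\<forall>\<^sub>F u in at 0. f (param z u) = g (param z u)"
  shows "f z = g z"
proof -
  have "\<not> (\<forall>\<^sub>F u in at 0. f (param z u) \<noteq> g (param z u))"
    using assms(3) by (auto simp: not_eventually dest!: eventually_frequently[rotated])
  then have "\<forall>\<^sub>F u in nhds 0. f (param z u) = g (param z u)" using hol_at_dichotomy[OF assms(1,2)] by blast
  then show ?thesis using eventually_nhds_x_imp_x by fastforce
qed

definition agree :: "(riemann_sphere \<Rightarrow> riemann_sphere) \<Rightarrow> (riemann_sphere \<Rightarrow> riemann_sphere) \<Rightarrow> riemann_sphere \<Rightarrow> bool"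
  where "agree f g z \<longleftrightarrow> (\<forall>\<^sub>F u in nhds 0. f (param z u) = g (param z u))"

lemma agree_Fin: "agree f g (Fin a) \<longleftrightarrow> (\<forall>\<^sub>F v in nhds a. f (Fin v) = g (Fin v))"
proof -
  have "nhds a = filtermap (\<lambda>u. a + u) (nhds 0)"
    using filtermap_nhds_shift[of "-a" 0] by (simp add: add.commute)
  then show ?thesis by (simp add: agree_def eventually_filtermap)
qed

lemma at_Fin_shift: "(\<forall>\<^sub>F u in at 0. P (a + u)) \<longleftrightarrow> (\<forall>\<^sub>F v in at (a::complex). P v)"
  using filtermap_at_shift[of "-a" 0] by (simp add: add.commute eventually_filtermap flip: eventually_filtermap[of _ "\<lambda>u. u+a"])

lemma identity_connected:
  assumes V: "open V" "connected V" and hol: "\<And>z. z \<in> V \<Longrightarrow> hol_at f (Fin z) \<and> hol_at g (Fin z)"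
    and z: "z \<in> V" "agree f g (Fin z)" and w: "w \<in> V"
  shows "f (Fin w) = g (Fin w)" "agree f g (Fin w)"
proof -
  define E where "E = {v\<in>V. agree f g (Fin v)}"
  have "open E"
    unfolding open_contains_ball
  proof
    fix v assume "v \<in> E"
    then have "\<forall>\<^sub>F x in nhds v. \<forall>\<^sub>F x' in nhds x. f (Fin x') = g (Fin x')" "v \<in> V"
      by (auto simp: E_def agree_Fin eventually_eventually)
    then have "\<forall>\<^sub>F x in nhds v. x \<in> E"
      unfolding E_def agree_Fin using V by (auto elim!: eventually_mono[OF eventually_conj] intro: eventually_nhds_in_open)
    then show "\<exists>e>0. ball v e \<subseteq> E" by (auto simp: eventually_nhds_metric subset_eq dist_commute)
  qed
  moreover have "open (V - E)"
    unfolding open_contains_ball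
  proof
    fix v assume v: "v \<in> V - E"
    then have "\<forall>\<^sub>F x in at v. f (Fin x) \<noteq> g (Fin x)"
      using hol_at_dichotomy[of f "Fin v" g] hol at_Fin_shift[of "\<lambda>x. f (Fin x) \<noteq> g (Fin x)" v]
      by (auto simp: E_def agree_def)
    moreover have "\<forall>\<^sub>F x in at v. x \<in> V" using V v by (auto intro: eventually_at_in_open')
    ultimately have "\<forall>\<^sub>F x in at v. x \<in> V - E" unfolding E_def agree_Fin
      by eventually_elim (use eventually_nhds_x_imp_x in fastforce)
    then have "\<forall>\<^sub>F x in nhds v. x \<in> V - E"
      using v by (auto simp: eventually_at_filter elim: eventually_mono)
    then show "\<exists>e>0. ball v e \<subseteq> V - E" by (auto simp: eventually_nhds_metric subset_eq dist_commute)
  qed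
  moreover have "E \<union> (V - E) = V" "E \<inter> (V - E) = {}" "z \<in> E" using z by (auto simp: E_def)
  ultimately have "V - E = {}" using connectedD[OF V(2), of E "V - E"] z by auto
  then have "w \<in> E" using w by auto
  then show "agree f g (Fin w)" by (simp add: E_def)
  then show "f (Fin w) = g (Fin w)"
    unfolding agree_Fin by (rule eventually_nhds_x_imp_x)
qed

lemma identity_sphere:
  assumes hol: "\<And>z. hol_at f z" "\<And>z. hol_at g z" and a: "agree f g z"
  shows "f = g"
proof -
  have "\<exists>a. agree f g (Fin a)"
  proof (cases z)
    case Infty
    have "\<forall>\<^sub>F u in nhds 0. \<forall>\<^sub>F v in nhds u. f (param Infty v) = g (param Infty v)"
      using a Infty by (auto simp: eventually_eventually agree_def)
    then have "\<forall>\<^sub>F u in at 0. u \<noteq> 0 \<and> (\<forall>\<^sub>F v in nhds u. f (param Infty v) = g (param Infty v))"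
      unfolding eventually_at_filter by eventually_elim simp
    then have "\<exists>u. u \<noteq> 0 \<and> (\<forall>\<^sub>F v in nhds u. f (param Infty v) = g (param Infty v))"
      using eventually_happens'[OF trivial_limit_at] by blast
    then obtain u where u: "u \<noteq> 0" "\<forall>\<^sub>F v in nhds u. f (param Infty v) = g (param Infty v)" by blast
    have "((\<lambda>v. 1 / v) \<longlongrightarrow> 1 / (1/u)) (nhds (1/u))"
      using u(1) by (intro tendsto_divide tendsto_const filterlim_ident) auto
    then have "((\<lambda>v. 1 / v) \<longlongrightarrow> u) (nhds (1/u))" by simp
    then have "\<forall>\<^sub>F v in nhds (1/u). f (param Infty (1/v)) = g (param Infty (1/v))"
      by (rule eventually_compose_filterlim[OF u(2)])
    moreover have "\<forall>\<^sub>F v in nhds (1/u). v \<noteq> 0"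
      using u by (intro tendsto_imp_eventually_ne[of _ "1/u"] filterlim_ident) auto
    ultimately have "\<forall>\<^sub>F v in nhds (1/u). f (Fin v) = g (Fin v)"
      by eventually_elim auto
    then show ?thesis by (auto simp: agree_Fin)
  qed (use a in auto)
  then obtain a where a: "agree f g (Fin a)" ..
  have *: "f (Fin w) = g (Fin w)" for w
    by (rule identity_connected[of UNIV f g a]) (use hol a in auto)
  have "f Infty = g Infty"
    by (rule hol_at_eqI) (use hol * in \<open>auto simp: eventually_at_filter\<close>)
  with * show ?thesis by (intro ext) (metis riemann_sphere.exhaust)
qed

section \<open>Rational functions as quotients of polynomials\<close>

declare quotient_map_of.simps [simp del]

lemma sum_order_eq_degree:
  fixes p :: "complex poly"
  assumes "p \<noteq> 0"
  shows "(\<Sum>x | poly p x = 0. order x p) = degree p"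
proof -
  have "p = smult (lead_coeff p) (\<Prod>z|poly p z = 0. [:-z, 1:] ^ order z p)"
    by (rule complex_poly_decompose[symmetric])
  then have "degree p = degree (smult (lead_coeff p) (\<Prod>z|poly p z = 0. [:-z, 1:] ^ order z p))"
    by simp
  also have "\<dots> = degree (\<Prod>z|poly p z = 0. [:-z, 1:] ^ order z p)"
    using assms by simp
  also have "\<dots> = (\<Sum>z|poly p z = 0. degree ([:-z, 1:] ^ order z p))"
    by (rule degree_prod_eq_sum_degree) auto
  finally show ?thesis by (simp add: degree_power_eq)
qed

lemma analytic_on_poly [analytic_intros]:
  "g analytic_on S \<Longrightarrow> (\<lambda>u. poly p (g u)) analytic_on S" for p :: "complex poly"
  unfolding poly_altdef by (intro analytic_intros)

lemma analytic_on_poly' [analytic_intros]: "poly p analytic_on S" for p :: "complex poly"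
  using analytic_on_poly[of "\<lambda>u. u" S p] by (simp add: analytic_intros)

lemma ord_at_poly:
  assumes "p \<noteq> 0" shows "ord_at (\<lambda>u. poly p (a + u)) (order a p)"
proof -
  obtain q where q: "p = [:- a, 1:] ^ order a p * q" "\<not> [:- a, 1:] dvd q"
    using order_decomp[OF assms] by blast
  have "poly p (a + u) = u ^ order a p * poly q (a + u)" for u
    by (subst q(1)) (simp add: poly_power)
  moreover have "poly q a \<noteq> 0" using q(2) by (simp add: poly_eq_0_iff_dvd)
  moreover have "(\<lambda>u. poly q (a + u)) analytic_on {0}"
    by (intro analytic_intros)
  ultimately show ?thesis unfolding ord_at_def by (intro exI[of _ "\<lambda>u. poly q (a + u)"]) auto
qed

lemma ord_at_divide:
  assumes "ord_at f n" "g analytic_on {0}" "g 0 \<noteq> 0"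
  shows "ord_at (\<lambda>u. f u / g u) n"
proof -
  have "(\<lambda>u. inverse (g u)) analytic_on {0}" using assms by (intro analytic_intros) auto
  from ord_at_mult[OF assms(1) ord_at_unit[OF this]] assms show ?thesis
    by (simp add: divide_inverse)
qed

text \<open>The map \<open>p / q\<close> takes the value \<open>c\<close> exactly where the following numerator vanishes, and
  the quotient of numerator and denominator is its expression in the chart around \<open>c\<close>.\<close>

fun numer_at :: "complex poly \<Rightarrow> complex poly \<Rightarrow> riemann_sphere \<Rightarrow> complex poly" where
  "numer_at p q (Fin c) = p - smult c q"
| "numer_at p q Infty = q"

fun denom_at :: "complex poly \<Rightarrow> complex poly \<Rightarrow> riemann_sphere \<Rightarrow> complex poly" where
  "denom_at p q (Fin c) = q"
| "denom_at p q Infty = p"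

definition homog :: "nat \<Rightarrow> complex poly \<Rightarrow> complex poly" where
  "homog d p = monom 1 (d - degree p) * reflect_poly p"

lemma poly_homog:
  assumes "degree p \<le> d" "u \<noteq> 0" shows "poly (homog d p) u = u ^ d * poly p (1 / u)"
proof -
  have "u ^ (d - degree p) * u ^ degree p = u ^ d"
    using assms by (simp flip: power_add)
  then show ?thesis using assms
    by (simp add: homog_def poly_monom poly_reflect_poly_nz field_simps)
qed

lemma poly_homog_0:
  assumes "degree p \<le> d" shows "poly (homog d p) 0 = coeff p d"
  using assms by (cases "degree p = d") (auto simp: homog_def poly_monom coeff_eq_0)

lemma order_homog:
  assumes "p \<noteq> 0" shows "order 0 (homog d p) = d - degree p"
proof (rule order_unique_lemma)
  have e: "[:- 0, 1:] = (monom 1 1 :: complex poly)" by (simp add: monom_altdef)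
  show "[:- 0, 1:] ^ (d - degree p) dvd homog d p"
    unfolding e by (simp add: homog_def monom_power)
  define X where "X = (monom 1 1 :: complex poly)"
  have "\<not> X dvd reflect_poly p"
    using assms poly_eq_0_iff_dvd[of "reflect_poly p" 0] unfolding X_def e[symmetric] by simp
  moreover have "homog d p = X ^ (d - degree p) * reflect_poly p"
    by (simp add: homog_def X_def monom_power)
  moreover have "X \<noteq> 0" by (simp add: X_def)
  ultimately show "\<not> [:- 0, 1:] ^ Suc (d - degree p) dvd homog d p"
    unfolding e X_def[symmetric] by (simp add: mult.commute[of X])
qed

lemma coeff_mult_bound:
  assumes "degree A \<le> n" "degree B \<le> m"
  shows "coeff (A * B :: complex poly) (n + m) = coeff A n * coeff B m"
proof -
  have "coeff (A * B) (n + m) = (\<Sum>i\<le>n+m. coeff A i * coeff B (n + m - i))" by (simp add: coeff_mult)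
  also have "\<dots> = (\<Sum>i\<in>{n}. coeff A i * coeff B (n + m - i))"
  proof (rule sum.mono_neutral_right)
    show "\<forall>i\<in>{..n + m} - {n}. coeff A i * coeff B (n + m - i) = 0"
    proof
      fix i assume "i \<in> {..n + m} - {n}"
      then have "i > n \<or> n + m - i > m" by auto
      then show "coeff A i * coeff B (n + m - i) = 0" using assms by (auto simp: coeff_eq_0)
    qed
  qed auto
  finally show ?thesis by simp
qed

locale rational_pair =
  fixes p q :: "complex poly" and d :: nat
  assumes coprime: "coprime p q" and d_def: "d = max (degree p) (degree q)" and d_pos: "d \<ge> 1"
begin

abbreviation "f \<equiv> quotient_map_of p q"

lemma degree_le: "degree (numer_at p q c) \<le> d" "degree (denom_at p q c) \<le> d"
proof -
  show "degree (numer_at p q c) \<le> d"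
    by (cases c) (auto simp: d_def intro!: degree_diff_le order.trans[OF degree_smult_le])
  show "degree (denom_at p q c) \<le> d" by (cases c) (auto simp: d_def)
qed

lemma no_common_root: "poly p a = 0 \<Longrightarrow> poly q a \<noteq> 0"
  using coprime_poly_0[OF coprime] by auto

lemma num_nonzero: "numer_at p q c \<noteq> 0"
proof
  assume 0: "numer_at p q c = 0"
  show False
  proof (cases c)
    case (Fin a)
    then have p: "p = smult a q" using 0 by simp
    then have "q dvd p" by (simp add: smult_dvd_cancel dvd_smult)
    then have "degree q = 0" using coprime by (metis coprime_common_divisor dvd_refl is_unit_iff_degree degree_0)
    then show False using p d_pos d_def by (auto split: if_splits)
  next
    case Infty
    then have "q = 0" using 0 by simp
    then have "is_unit p" using coprime by simp
    then have "degree p = 0" by (auto simp: is_unit_poly_iff)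
    then show False using \<open>q = 0\<close> d_pos d_def by simp
  qed
qed

lemma value_Fin: "f (Fin a) = c \<longleftrightarrow> poly (numer_at p q c) a = 0"
  using no_common_root[of a] by (cases c) (auto simp: field_simps quotient_map_of.simps)

lemma lead_nonzero: "coeff p d \<noteq> 0 \<or> coeff q d \<noteq> 0"
proof -
  have "d = degree p \<or> d = degree q" by (auto simp: d_def max_def)
  then show ?thesis using d_pos by (metis degree_0 leading_coeff_0_iff not_one_le_zero)
qed

lemma value_Infty: "f Infty = c \<longleftrightarrow> coeff (numer_at p q c) d = 0"
  using lead_nonzero by (cases c) (auto simp: field_simps Let_def quotient_map_of.simps simp flip: d_def)

lemma value_Infty': "f Infty = c \<longleftrightarrow> degree (numer_at p q c) < d"
proof -
  have "coeff (numer_at p q c) d = 0 \<longleftrightarrow> degree (numer_at p q c) < d"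
    using degree_le(1)[of c] d_pos num_nonzero[of c]
    by (metis coeff_eq_0 leading_coeff_0_iff order_le_less)
  then show ?thesis by (simp add: value_Infty)
qed

lemma den_nonzero_Fin: "f (Fin a) = c \<Longrightarrow> poly (denom_at p q c) a \<noteq> 0"
  using no_common_root[of a] by (cases c) (auto simp: quotient_map_of.simps split: if_splits)

lemma den_nonzero_Infty: "f Infty = c \<Longrightarrow> coeff (denom_at p q c) d \<noteq> 0"
  using lead_nonzero by (cases c) (auto simp: Let_def quotient_map_of.simps split: if_splits simp flip: d_def)

lemma germ_Fin:
  "germ f (Fin a) (\<lambda>u. poly (numer_at p q (f (Fin a))) (a + u) / poly (denom_at p q (f (Fin a))) (a + u))"
proof -
  define c where "c = f (Fin a)"
  have D: "poly (denom_at p q c) a \<noteq> 0" and N: "poly (numer_at p q c) a = 0"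
    using den_nonzero_Fin[of a c] value_Fin[of a c] by (simp_all add: c_def)
  have "(\<lambda>u. poly (denom_at p q c) (a + u)) analytic_on {0}" by (intro analytic_intros)
  from tendsto_imp_eventually_ne[OF analytic_tendsto_nhds[OF this]] D
  have "\<forall>\<^sub>F u in nhds 0. poly (denom_at p q c) (a + u) \<noteq> 0" by simp
  then have "\<forall>\<^sub>F u in nhds 0. f (param (Fin a) u) = param c (poly (numer_at p q c) (a + u) / poly (denom_at p q c) (a + u))"
    by eventually_elim (cases c; auto simp: field_simps quotient_map_of.simps)
  moreover have "(\<lambda>u. poly (numer_at p q c) (a + u) / poly (denom_at p q c) (a + u)) analytic_on {0}"
    using D by (intro analytic_intros) auto
  ultimately show ?thesis unfolding germ_def using N
    by (auto simp flip: c_def)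
qed

lemma germ_Infty:
  "germ f Infty (\<lambda>u. poly (homog d (numer_at p q (f Infty))) u / poly (homog d (denom_at p q (f Infty))) u)"
proof -
  define c where "c = f Infty"
  have D: "poly (homog d (denom_at p q c)) 0 \<noteq> 0" and N: "poly (homog d (numer_at p q c)) 0 = 0"
    using den_nonzero_Infty[of c] value_Infty[of c] degree_le[of c] by (simp_all add: c_def poly_homog_0)
  have "(\<lambda>u. poly (homog d (denom_at p q c)) u) analytic_on {0}" by (intro analytic_intros)
  from tendsto_imp_eventually_ne[OF analytic_tendsto_nhds[OF this]] D
  have "\<forall>\<^sub>F u in nhds 0. poly (homog d (denom_at p q c)) u \<noteq> 0" by simp
  then have "\<forall>\<^sub>F u in nhds 0. f (param Infty u) = param c (poly (homog d (numer_at p q c)) u / poly (homog d (denom_at p q c)) u)"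
  proof eventually_elim
    case (elim u)
    show ?case
    proof (cases "u = 0")
      case True then show ?thesis using N by (simp add: c_def)
    next
      case False
      then show ?thesis using elim degree_le[of c]
        by (cases c; simp add: poly_homog quotient_map_of.simps) (auto simp: field_simps)
    qed
  qed
  moreover have "(\<lambda>u. poly (homog d (numer_at p q c)) u / poly (homog d (denom_at p q c)) u) analytic_on {0}"
    using D by (intro analytic_intros) auto
  ultimately show ?thesis unfolding germ_def using N
    by (auto simp flip: c_def)
qed

lemma ord_germ_Fin:
  "ord_at (\<lambda>u. poly (numer_at p q (f (Fin a))) (a + u) / poly (denom_at p q (f (Fin a))) (a + u))
     (order a (numer_at p q (f (Fin a))))"
  by (intro ord_at_divide ord_at_poly num_nonzero analytic_intros) (simp add: den_nonzero_Fin)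

lemma homog_nonzero: "A \<noteq> 0 \<Longrightarrow> homog d A \<noteq> 0"
  by (simp add: homog_def)

lemma ord_germ_Infty:
  "ord_at (\<lambda>u. poly (homog d (numer_at p q (f Infty))) u / poly (homog d (denom_at p q (f Infty))) u)
     (d - degree (numer_at p q (f Infty)))"
proof (intro ord_at_divide analytic_intros)
  show "ord_at (poly (homog d (numer_at p q (f Infty)))) (d - degree (numer_at p q (f Infty)))"
    using ord_at_poly[OF homog_nonzero[OF num_nonzero[of "f Infty"]], of 0] order_homog[OF num_nonzero[of "f Infty"]]
    by simp
  show "poly (homog d (denom_at p q (f Infty))) 0 \<noteq> 0"
    using den_nonzero_Infty[of "f Infty"] degree_le by (simp add: poly_homog_0)
qed

lemma local_degree_Fin: "local_degree f (Fin a) = order a (numer_at p q (f (Fin a)))"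
  by (rule local_degree_eqI[OF germ_Fin ord_germ_Fin])

lemma local_degree_Infty: "local_degree f Infty = d - degree (numer_at p q (f Infty))"
  by (rule local_degree_eqI[OF germ_Infty ord_germ_Infty])

lemma germ_ord: "\<exists>h n. germ f z h \<and> ord_at h n"
proof (cases z)
  case (Fin a)
  show ?thesis unfolding Fin using germ_Fin ord_germ_Fin by blast
next
  case Infty
  show ?thesis unfolding Infty
    by (rule exI[of _ "\<lambda>u. poly (homog d (numer_at p q (f Infty))) u / poly (homog d (denom_at p q (f Infty))) u"],
        rule exI) (rule conjI[OF germ_Infty ord_germ_Infty])
qed

lemma fiber_sum:
  shows "finite (f -` {c})" "(\<Sum>z\<in>f -` {c}. local_degree f z) = d"
proof -
  define N where "N = numer_at p q c"
  have fib: "f -` {c} = Fin ` {a. poly N a = 0} \<union> (if f Infty = c then {Infty} else {})"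
  proof (rule set_eqI)
    fix z show "z \<in> f -` {c} \<longleftrightarrow> z \<in> Fin ` {a. poly N a = 0} \<union> (if f Infty = c then {Infty} else {})"
      using value_Fin[of _ c] unfolding N_def by (cases z) (auto simp: image_iff)
  qed
  have fin: "finite {a. poly N a = 0}" using num_nonzero[of c] by (simp add: N_def poly_roots_finite)
  then show "finite (f -` {c})" by (simp add: fib)
  have "(\<Sum>z\<in>Fin ` {a. poly N a = 0}. local_degree f z) = (\<Sum>a | poly N a = 0. order a N)"
    by (subst sum.reindex) (auto simp: inj_on_def local_degree_Fin N_def value_Fin[symmetric])
  also have "\<dots> = degree N" using num_nonzero[of c] by (simp add: N_def sum_order_eq_degree)
  finally have 1: "(\<Sum>z\<in>Fin ` {a. poly N a = 0}. local_degree f z) = degree N" .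
  show "(\<Sum>z\<in>f -` {c}. local_degree f z) = d"
  proof (cases "f Infty = c")
    case True
    have "(\<Sum>z\<in>f -` {c}. local_degree f z) = degree N + local_degree f Infty"
      unfolding fib using True fin 1 by (subst sum.union_disjoint) auto
    also have "local_degree f Infty = d - degree N"
      using True by (simp only: local_degree_Infty N_def)
    finally show ?thesis using degree_le(1)[of c] by (simp add: N_def)
  next
    case False
    then have "degree N = d" using value_Infty'[of c] degree_le(1)[of c] by (simp add: N_def)
    then show ?thesis using False 1 by (simp add: fib)
  qed
qed

definition "wronskian = pderiv p * q - p * pderiv q"

lemma wronskian_order:
  "wronskian \<noteq> 0 \<Longrightarrow> order a wronskian = local_degree f (Fin a) - 1"
proof -
  assume nz: "wronskian \<noteq> 0"
  define c where "c = f (Fin a)"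
  define N where "N = numer_at p q c"
  define D where "D = denom_at p q c"
  define W where "W = pderiv N * D - N * pderiv D"
  have W: "W = wronskian \<or> W = - wronskian"
    by (cases c) (auto simp: W_def wronskian_def N_def D_def pderiv_diff pderiv_smult algebra_simps)
  define m where "m = order a N"
  have ld: "local_degree f (Fin a) = m" by (simp only: local_degree_Fin m_def N_def c_def)
  have N0: "N \<noteq> 0" "poly N a = 0" "poly D a \<noteq> 0"
    unfolding N_def D_def c_def by (rule num_nonzero, metis value_Fin, metis den_nonzero_Fin)
  have m: "m \<ge> 1" unfolding m_def using N0 order_root[of N a] by linarith
  obtain R where R: "N = [:- a, 1:] ^ m * R" "\<not> [:- a, 1:] dvd R"
    unfolding m_def using order_decomp[OF N0(1)] by blast
  define L where "L = [:- a, 1:]"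
  obtain k where k: "m = Suc k" using m by (cases m) auto
  have pd: "pderiv N = L ^ k * (smult (of_nat m) R + L * pderiv R)"
    unfolding R(1) k L_def[symmetric] pderiv_mult pderiv_power_Suc
    by (simp add: L_def pderiv_pCons algebra_simps)
  define V where "V = (smult (of_nat m) R + L * pderiv R) * D - L * R * pderiv D"
  have WV: "W = L ^ k * V"
    unfolding W_def V_def pd by (subst R(1)) (simp add: k L_def[symmetric] algebra_simps)
  have "poly V a = of_nat m * poly R a * poly D a" by (simp add: V_def L_def)
  then have V: "poly V a \<noteq> 0" using N0 R(2) m by (simp add: poly_eq_0_iff_dvd)
  have "order a W = k"
  proof (rule order_unique_lemma)
    show "[:- a, 1:] ^ k dvd W" by (simp add: WV L_def)
    have "\<not> L dvd V" using V by (simp add: L_def poly_eq_0_iff_dvd)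
    moreover have "L ^ k \<noteq> 0" by (simp add: L_def)
    ultimately show "\<not> [:- a, 1:] ^ Suc k dvd W"
      unfolding WV L_def[symmetric] power_Suc2 by (metis dvd_mult_cancel_left)
  qed
  then show ?thesis using W k ld by auto
qed

lemma wronskian_degree:
  "wronskian \<noteq> 0" "degree wronskian + local_degree f Infty + 1 = 2 * d"
proof -
  define c where "c = f Infty"
  define N where "N = numer_at p q c"
  define D where "D = denom_at p q c"
  define W where "W = pderiv N * D - N * pderiv D"
  have W: "W = wronskian \<or> W = - wronskian"
    by (cases c) (auto simp: W_def wronskian_def N_def D_def pderiv_diff pderiv_smult algebra_simps)
  define n where "n = degree N"
  have ld: "local_degree f Infty = d - n" by (simp only: local_degree_Infty n_def N_def c_def)
  have n: "n < d" unfolding n_def N_def c_def using value_Infty' by blast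
  have N0: "N \<noteq> 0" "coeff D d \<noteq> 0" "degree D \<le> d"
    unfolding N_def D_def c_def by (rule num_nonzero, metis den_nonzero_Infty, rule degree_le)
  define X where "X = (monom 1 1 :: complex poly)"
  have cX: "coeff (X * pderiv A) i = of_nat i * coeff A i" for A :: "complex poly" and i
    by (cases i) (auto simp: X_def coeff_monom_mult coeff_pderiv)
  have dX: "degree (X * pderiv A) \<le> degree A" for A :: "complex poly"
    by (rule Polynomial.degree_le) (auto simp: cX coeff_eq_0)
  have XW: "X * W = (X * pderiv N) * D - N * (X * pderiv D)" by (simp add: W_def algebra_simps)
  have "coeff (X * W) (n + d) = of_nat n * coeff N n * coeff D d - coeff N n * (of_nat d * coeff D d)"
    unfolding XW coeff_diff
    using coeff_mult_bound[of "X * pderiv N" n D d] coeff_mult_bound[of N n "X * pderiv D" d]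
      dX[of N] dX[of D] N0 by (simp add: cX n_def)
  also have "\<dots> = (of_nat n - of_nat d) * (coeff N n * coeff D d)" by (simp add: algebra_simps)
  also have "\<dots> \<noteq> 0" using n N0 by (simp add: n_def)
  finally have nz: "coeff (X * W) (n + d) \<noteq> 0" .
  have "degree (X * W) \<le> n + d"
  proof -
    have "degree ((X * pderiv N) * D) \<le> n + d"
      using degree_mult_le[of "X * pderiv N" D] dX[of N] N0 by (simp add: n_def)
    moreover have "degree (N * (X * pderiv D)) \<le> n + d"
      using degree_mult_le[of N "X * pderiv D"] dX[of D] N0 by (simp add: n_def)
    ultimately show ?thesis unfolding XW by (rule degree_diff_le)
  qed
  with nz have "degree (X * W) = n + d" by (metis le_degree order_antisym)
  moreover have "W \<noteq> 0" using nz by auto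
  ultimately have "degree W + 1 = n + d" by (simp add: X_def degree_mult_eq degree_monom_eq)
  then show "wronskian \<noteq> 0" "degree wronskian + local_degree f Infty + 1 = 2 * d"
    using W \<open>W \<noteq> 0\<close> ld n by auto
qed

lemma local_degree_pos: "local_degree f z \<ge> 1"
proof -
  obtain h n where "germ f z h" "ord_at h n" using germ_ord by blast
  then show ?thesis using local_degree_eqI[of f z h n] ord_at_pos[of h n] by (auto simp: germ_def)
qed

lemma riemann_hurwitz:
  "finite {z. local_degree f z > 1}" "(\<Sum>z | local_degree f z > 1. local_degree f z - 1) = 2 * d - 2"
proof -
  define Z where "Z = {a. poly wronskian a = 0}"
  have Z: "finite Z" using wronskian_degree(1) by (simp add: Z_def poly_roots_finite)
  have ord: "order a wronskian = local_degree f (Fin a) - 1" for a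
    using wronskian_order wronskian_degree(1) by blast
  have memZ: "a \<in> Z \<longleftrightarrow> local_degree f (Fin a) > 1" for a
    using order_root[of wronskian a] wronskian_degree(1) ord[of a] by (auto simp: Z_def)
  have sub: "{z. local_degree f z > 1} \<subseteq> insert Infty (Fin ` Z)"
    using memZ by (auto simp: image_iff) (metis riemann_sphere.exhaust)
  then show "finite {z. local_degree f z > 1}" using Z finite_subset by blast
  have "(\<Sum>z | local_degree f z > 1. local_degree f z - 1) = (\<Sum>z\<in>insert Infty (Fin ` Z). local_degree f z - 1)"
    by (rule sum.mono_neutral_left) (use sub Z in auto)
  also have "\<dots> = (local_degree f Infty - 1) + (\<Sum>a\<in>Z. order a wronskian)"
    using Z by (subst sum.insert) (auto simp: sum.reindex inj_on_def ord)
  also have "(\<Sum>a\<in>Z. order a wronskian) = degree wronskian"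
    unfolding Z_def by (rule sum_order_eq_degree[OF wronskian_degree(1)])
  finally show "(\<Sum>z | local_degree f z > 1. local_degree f z - 1) = 2 * d - 2"
    using wronskian_degree(2) local_degree_pos[of Infty] by simp
qed

lemma surj: "\<exists>z. f z = c"
proof (rule ccontr)
  assume "\<not> (\<exists>z. f z = c)"
  then have "f -` {c} = {}" by auto
  then show False using fiber_sum(2)[of c] d_pos by simp
qed

end

section \<open>Holomorphic maps of the sphere are rational\<close>

lemma sphere_cases:
  obtains a where "z = param (Fin 0) a" "a \<in> cball 0 1" | a where "z = param Infty a" "a \<in> cball 0 1"
proof (cases z)
  case Infty then show ?thesis using that(2)[of 0] by simp
next
  case (Fin a)
  show ?thesis
  proof (cases "norm a \<le> 1")
    case True then show ?thesis using that(1)[of a] Fin by simp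
  next
    case False
    then have "norm (1 / a) \<le> 1" "a \<noteq> 0" by (auto simp: norm_divide divide_le_eq_1)
    then show ?thesis using that(2)[of "1/a"] Fin by simp
  qed
qed

lemma param_in_chart:
  assumes "\<forall>\<^sub>F u in at 0. P (param (param c s) u)"
  shows "\<forall>\<^sub>F v in at s. P (param c v)"
proof -
  obtain T where T: "T analytic_on {0}" "T 0 = 0" "\<forall>\<^sub>F v in nhds 0. param c (s + v) = param (param c s) (T v)"
    using param_transition by blast
  have "\<forall>\<^sub>F u in nhds 0. u = 0 \<or> P (param (param c s) u)"
    using assms unfolding eventually_at_filter by eventually_elim auto
  moreover have "(T \<longlongrightarrow> 0) (nhds 0)" using analytic_tendsto_nhds[OF T(1)] T by simp
  ultimately have "\<forall>\<^sub>F v in nhds 0. T v = 0 \<or> P (param (param c s) (T v))"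
    by (rule eventually_compose_filterlim)
  with T(3) have "\<forall>\<^sub>F v in nhds 0. v \<noteq> 0 \<longrightarrow> P (param c (s + v))"
  proof eventually_elim
    case (elim v)
    have "T v \<noteq> 0" if "v \<noteq> 0"
      using elim that param_eq_iff[of c "s + v" s] by auto
    with elim show ?case by auto
  qed
  then have "\<forall>\<^sub>F v in at 0. P (param c (s + v))" by (simp add: eventually_at_filter)
  then show ?thesis using at_Fin_shift[of "\<lambda>v. P (param c v)" s] by simp
qed

lemma sphere_finite:
  assumes "\<And>z. \<forall>\<^sub>F u in at 0. \<not> P (param z u)"
  shows "finite {z. P z}"
proof -
  have fin: "finite (cball 0 1 \<inter> {v. P (param c v)})" for c
  proof (rule finite_not_islimpt_in_compact)
    fix s :: complex
    have "\<forall>\<^sub>F v in at s. \<not> P (param c v)" by (rule param_in_chart) (rule assms)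
    then show "\<not> s islimpt {v. P (param c v)}" by (simp add: islimpt_iff_eventually)
  qed simp
  have "{z. P z} \<subseteq> param (Fin 0) ` (cball 0 1 \<inter> {v. P (param (Fin 0) v)}) \<union> param Infty ` (cball 0 1 \<inter> {v. P (param Infty v)})"
  proof
    fix z assume "z \<in> {z. P z}"
    then show "z \<in> param (Fin 0) ` (cball 0 1 \<inter> {v. P (param (Fin 0) v)}) \<union> param Infty ` (cball 0 1 \<inter> {v. P (param Infty v)})"
      by (cases z rule: sphere_cases) (simp_all del: param.simps)
  qed
  then show ?thesis using fin finite_subset by (meson finite_Un finite_imageI)
qed

lemma finite_fiber:
  assumes hol: "\<And>z. hol_at f z" and nc: "\<And>c. f \<noteq> (\<lambda>_. c)"
  shows "finite {z. f z = c}"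
proof (rule sphere_finite)
  fix z
  have "\<not> agree f (\<lambda>_. c) z" using identity_sphere[of f "\<lambda>_. c" z] hol hol_at_const nc by blast
  then show "\<forall>\<^sub>F u in at 0. f (param z u) \<noteq> c"
    using hol_at_dichotomy[OF hol hol_at_const, of z c] by (simp add: agree_def)
qed

fun fin_part :: "riemann_sphere \<Rightarrow> complex" where
  "fin_part (Fin z) = z"
| "fin_part Infty = 0"

lemma fin_part_analytic:
  assumes "hol_at f (Fin a)" "f (Fin a) \<noteq> Infty"
  shows "(\<lambda>z. fin_part (f (Fin z))) analytic_on {a}"
proof -
  obtain y where y: "f (Fin a) = Fin y" using assms by (cases "f (Fin a)") auto
  obtain W where W: "W analytic_on {a}" "\<forall>\<^sub>F v in nhds a. f (param (Fin 0) v) = param (Fin 0) (W v)"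
    using hol_at_chartE[of f "Fin 0" a "Fin 0" y] assms(1) y by auto
  have "\<forall>\<^sub>F v in nhds a. fin_part (f (Fin v)) = W v" using W(2) by eventually_elim simp
  then show ?thesis using W(1) by (simp add: analytic_at_cong)
qed

lemma pole_factor:
  assumes "hol_at f a" "f a = Infty" "\<not> agree f (\<lambda>_. Infty) a"
  shows "\<exists>m L. ((\<lambda>u. u ^ m * fin_part (f (param a u))) \<longlongrightarrow> L) (at 0)"
proof -
  obtain h where h: "germ f a h" using assms by (auto simp: hol_at_def)
  have e: "\<forall>\<^sub>F u in nhds 0. f (param a u) = param Infty (h u)"
    using h assms by (simp add: germ_def)
  have "\<not> (\<forall>\<^sub>F u in nhds 0. h u = 0)"
  proof
    assume "\<forall>\<^sub>F u in nhds 0. h u = 0"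
    with e have "\<forall>\<^sub>F u in nhds 0. f (param a u) = Infty" by eventually_elim simp
    then show False using assms(3) by (simp add: agree_def)
  qed
  then obtain m where m: "ord_at h m" using analytic_ord_cases[of h] h by (auto simp: germ_def)
  then obtain k where k: "k analytic_on {0}" "k 0 \<noteq> 0" "\<forall>\<^sub>F u in nhds 0. h u = u ^ m * k u"
    by (auto simp: ord_at_def)
  have k0: "(k \<longlongrightarrow> k 0) (nhds 0)" by (rule analytic_tendsto_nhds[OF k(1)])
  have "\<forall>\<^sub>F u in nhds 0. k u \<noteq> 0" using k0 k(2) by (rule tendsto_imp_eventually_ne)
  with e k(3) have "\<forall>\<^sub>F u in at 0. 1 / k u = u ^ m * fin_part (f (param a u))"
    unfolding eventually_at_filter by eventually_elim auto
  moreover have "((\<lambda>u. 1 / k u) \<longlongrightarrow> 1 / k 0) (at 0)"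
    using tendsto_mono[OF at_le_nhds k0] k(2) by (intro tendsto_intros)
  ultimately have "((\<lambda>u. u ^ m * fin_part (f (param a u))) \<longlongrightarrow> 1 / k 0) (at 0)"
    by (rule Lim_transform_eventually[rotated])
  then show ?thesis by blast
qed

lemma Infty_bound:
  assumes "hol_at f Infty" "\<not> agree f (\<lambda>_. Infty) Infty"
  shows "\<exists>m L. ((\<lambda>u. u ^ m * fin_part (f (param Infty u))) \<longlongrightarrow> L) (at 0)"
proof (cases "f Infty")
  case Infty then show ?thesis using pole_factor assms by blast
next
  case (Fin y)
  obtain h where h: "germ f Infty h" using assms by (auto simp: hol_at_def)
  have "\<forall>\<^sub>F u in nhds 0. f (param Infty u) = param (Fin y) (h u)"
    using h Fin by (simp add: germ_def)
  then have "\<forall>\<^sub>F u in nhds 0. y + h u = u ^ 0 * fin_part (f (param Infty u))"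
    by eventually_elim (simp del: param.simps(2))
  then have "\<forall>\<^sub>F u in at 0. y + h u = u ^ 0 * fin_part (f (param Infty u))"
    by (rule filter_leD[OF at_le_nhds])
  moreover have "((\<lambda>u. y + h u) \<longlongrightarrow> y + 0) (at 0)"
    using tendsto_mono[OF at_le_nhds germ_tendsto[OF h]] by (intro tendsto_intros)
  ultimately have "((\<lambda>u. u ^ 0 * fin_part (f (param Infty u))) \<longlongrightarrow> y + 0) (at 0)"
    by (rule Lim_transform_eventually[rotated])
  then show ?thesis by blast
qed

lemma poly_of_entire:
  assumes "G holomorphic_on UNIV" "((\<lambda>u. u ^ n * G (1 / u)) \<longlongrightarrow> L) (at 0)"
  shows "\<exists>g. G = poly g"
proof -
  have "\<forall>\<^sub>F u in at 0. norm (u ^ n * G (1 / u)) < norm L + 1"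
    using order_tendstoD(2)[OF tendsto_norm[OF assms(2)], of "norm L + 1"] by simp
  then obtain r where r: "r > 0" "\<And>u. u \<noteq> 0 \<Longrightarrow> norm u < r \<Longrightarrow> norm (u ^ n * G (1 / u)) < norm L + 1"
    by (auto simp: eventually_at dist_norm)
  have b: "norm (G z) \<le> (norm L + 1) * norm z ^ n" if "2 / r \<le> norm z" for z
  proof -
    have "0 < 2 / r" using r by simp
    then have z: "z \<noteq> 0" using that by auto
    have "2 \<le> norm z * r" using that r(1) by (simp add: field_simps)
    then have z: "z \<noteq> 0" "norm (1 / z) < r" using z by (auto simp: norm_divide divide_less_eq mult.commute)
    then have "norm ((1 / z) ^ n * G (1 / (1 / z))) < norm L + 1" by (intro r) auto
    then show ?thesis using z by (simp add: norm_mult norm_divide norm_power field_simps)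
  qed
  define g where "g = (\<Sum>k\<le>n. monom ((deriv ^^ k) G 0 / fact k) k)"
  have "G z = poly g z" for z
    unfolding g_def poly_sum poly_monom
    by (rule Liouville_polynomial[OF assms(1) b])
  then show ?thesis by blast
qed

theorem rational_functionI:
  assumes hol: "\<And>z. hol_at f z" and nc: "\<And>c. f \<noteq> (\<lambda>_. c)"
  shows "rational_function f"
proof -
  define P where "P = {a. f (Fin a) = Infty}"
  have "Fin ` P \<subseteq> {z. f z = Infty}" by (auto simp: P_def)
  then have "finite (Fin ` P)" using finite_fiber[OF hol nc] finite_subset by blast
  then have finP: "finite P" by (rule finite_imageD) (simp add: inj_on_def)
  have nag: "\<not> agree f (\<lambda>_. c) z" for z c using identity_sphere[of f "\<lambda>_. c" z] hol hol_at_const nc by blast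
  define F where "F z = fin_part (f (Fin z))" for z
  have F: "f (Fin z) = Fin (F z)" if "z \<notin> P" for z using that by (cases "f (Fin z)") (auto simp: P_def F_def)
  have "\<exists>m L. ((\<lambda>u. u ^ m * fin_part (f (param (Fin a) u))) \<longlongrightarrow> L) (at 0)" if "a \<in> P" for a
    by (rule pole_factor) (use hol nag that in \<open>auto simp: P_def\<close>)
  then obtain m L where mL: "\<And>a. a \<in> P \<Longrightarrow> ((\<lambda>u. u ^ m a * fin_part (f (param (Fin a) u))) \<longlongrightarrow> L a) (at 0)"
    by metis
  define D where "D = (\<Prod>a\<in>P. [:-a, 1:] ^ m a)"
  define M where "M a = L a * (\<Prod>b\<in>P-{a}. (a - b) ^ m b)" for a
  have lim: "((\<lambda>z. poly D z * F z) \<longlongrightarrow> M a) (at a)" if "a \<in> P" for a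
  proof -
    have "((\<lambda>u. u ^ m a * F (a + u)) \<longlongrightarrow> L a) (at 0)" using mL[OF that] by (simp add: F_def)
    then have "((\<lambda>z. (z - a) ^ m a * F z) \<longlongrightarrow> L a) (at a)"
      by (subst LIM_offset_zero_iff) auto
    moreover have "((\<lambda>z. \<Prod>b\<in>P-{a}. (z - b) ^ m b) \<longlongrightarrow> (\<Prod>b\<in>P-{a}. (a - b) ^ m b)) (at a)"
      by (intro tendsto_intros)
    ultimately have "((\<lambda>z. ((z - a) ^ m a * F z) * (\<Prod>b\<in>P-{a}. (z - b) ^ m b)) \<longlongrightarrow> M a) (at a)"
      unfolding M_def by (rule tendsto_mult)
    moreover have "((z - a) ^ m a * F z) * (\<Prod>b\<in>P-{a}. (z - b) ^ m b) = poly D z * F z" for z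
      unfolding D_def poly_prod using that finP by (subst (2) prod.remove[of _ a]) (auto simp: poly_power mult_ac)
    ultimately show ?thesis by simp
  qed
  define G where "G z = (if z \<in> P then M z else poly D z * F z)" for z
  have evP: "\<forall>\<^sub>F z in at a. z \<notin> P" for a
    using finP by (metis eventually_at_topological finite_imp_closed open_Compl Compl_iff DiffI finite_Diff
        Diff_iff insertI1 open_contains_ball islimpt_finite islimpt_iff_eventually)
  have "G holomorphic_on UNIV"
  proof (rule no_isolated_singularity'[OF _ _ open_UNIV finP])
    fix a assume "a \<in> P"
    have "\<forall>\<^sub>F z in at a. poly D z * F z = G z" using evP by eventually_elim (simp add: G_def)
    then have "(G \<longlongrightarrow> M a) (at a)" using lim[OF \<open>a \<in> P\<close>]
      by (rule Lim_transform_eventually[rotated])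
    then show "(G \<longlongrightarrow> G a) (at a)" using \<open>a \<in> P\<close> by (simp add: G_def)
  next
    have "(\<lambda>z. poly D z * F z) holomorphic_on UNIV - P"
    proof (intro holomorphic_intros)
      show "F holomorphic_on UNIV - P"
        unfolding F_def
        by (rule analytic_imp_holomorphic, subst analytic_on_analytic_at)
          (use hol in \<open>auto intro!: fin_part_analytic simp: P_def\<close>)
    qed
    then show "G holomorphic_on UNIV - P" by (rule holomorphic_transform) (simp add: G_def)
  qed
  note entire = this
  obtain m' L' where mL': "((\<lambda>u. u ^ m' * fin_part (f (param Infty u))) \<longlongrightarrow> L') (at 0)"
    using Infty_bound hol nag by blast
  have "((\<lambda>u. poly (homog (degree D) D) u * (u ^ m' * fin_part (f (param Infty u)))) \<longlongrightarrow> poly (homog (degree D) D) 0 * L') (at 0)"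
    by (intro tendsto_mult mL' isContD poly_isCont)
  moreover have "\<forall>\<^sub>F u in at 0. poly (homog (degree D) D) u * (u ^ m' * fin_part (f (param Infty u))) = u ^ (degree D + m') * G (1 / u)"
  proof -
    have "\<forall>\<^sub>F u in at 0. f (param Infty u) \<noteq> Infty"
      using hol_at_dichotomy[OF hol hol_at_const, of Infty Infty] nag[of Infty Infty] unfolding agree_def by blast
    moreover have "\<forall>\<^sub>F u in at 0. (u::complex) \<noteq> 0" by (simp add: eventually_at_filter)
    ultimately show ?thesis
      by eventually_elim (auto simp: poly_homog power_add G_def P_def F_def)
  qed
  ultimately have "((\<lambda>u. u ^ (degree D + m') * G (1 / u)) \<longlongrightarrow> poly (homog (degree D) D) 0 * L') (at 0)"
    by (rule Lim_transform_eventually)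
  then obtain g where g: "G = poly g" using poly_of_entire[OF entire] by blast
  have Dz: "poly D z \<noteq> 0" if "z \<notin> P" for z
    using that finP by (auto simp: D_def poly_prod poly_power prod_zero_iff)
  have "D \<noteq> 0" using finP by (auto simp: D_def prod_zero_iff)
  define p where "p = g div gcd g D"
  define q where "q = D div gcd g D"
  have pq: "g = p * gcd g D" "D = q * gcd g D" by (simp_all add: p_def q_def)
  have cop: "coprime p q" unfolding p_def q_def using \<open>D \<noteq> 0\<close> by (intro div_gcd_coprime) auto
  have val: "f (Fin z) = Fin (poly p z / poly q z)" "poly q z \<noteq> 0" if "z \<notin> P" for z
  proof -
    have "poly g z = poly p z * poly (gcd g D) z" "poly D z = poly q z * poly (gcd g D) z"
      by (simp_all only: pq[symmetric] flip: poly_mult)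
    moreover have "poly g z = poly D z * F z" using that g by (metis G_def)
    ultimately show "f (Fin z) = Fin (poly p z / poly q z)" "poly q z \<noteq> 0"
      using Dz[OF that] F[OF that] by (auto simp: field_simps)
  qed
  obtain a where a: "a \<notin> P" using finP by (metis ex_new_if_finite infinite_UNIV_char_0)
  have "\<forall>\<^sub>F z in at a. z \<notin> P" by (rule evP)
  then have ev: "\<forall>\<^sub>F z in nhds a. z \<notin> P" using a by (auto simp: eventually_at_filter elim: eventually_mono)
  show ?thesis
  proof (cases "max (degree p) (degree q) \<ge> 1")
    case True
    then interpret R: rational_pair p q "max (degree p) (degree q)" by unfold_locales (use cop in auto)
    have "\<forall>\<^sub>F z in nhds a. f (Fin z) = R.f (Fin z)"
      using ev by eventually_elim (use val in \<open>auto simp: quotient_map_of.simps\<close>)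
    then have "f = R.f"
      by (intro identity_sphere[of _ _ "Fin a"]) (use hol R.germ_ord in \<open>auto simp: agree_Fin hol_at_def\<close>)
    then show ?thesis using True cop by (auto simp: rational_function_def)
  next
    case False
    then have "degree p = 0" "degree q = 0" by auto
    then obtain x y where xy: "p = [:x:]" "q = [:y:]" by (metis degree_eq_zeroE)
    have "\<forall>\<^sub>F z in nhds a. f (Fin z) = Fin (x / y)"
      using ev by eventually_elim (use val xy in auto)
    then show ?thesis using nag[of "Fin (x/y)" "Fin a"] by (simp add: agree_Fin)
  qed
qed

lemma (in rational_pair) rat_degree: "rat_degree f = d"
  unfolding rat_degree_def
proof (rule the_equality)
  show "\<exists>p' q'. Rings.coprime p' q' \<and> f = quotient_map_of p' q' \<and> d = max (degree p') (degree q')"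
    using coprime d_def by blast
next
  fix n assume "\<exists>p' q'. Rings.coprime p' q' \<and> f = quotient_map_of p' q' \<and> n = max (degree p') (degree q')"
  then obtain p' q' where *: "Rings.coprime p' q'" "f = quotient_map_of p' q'" "n = max (degree p') (degree q')" by blast
  show "n = d"
  proof (cases "n \<ge> 1")
    case True
    then interpret R: rational_pair p' q' n by unfold_locales (use * in auto)
    show ?thesis using fiber_sum(2)[of Infty] R.fiber_sum(2)[of Infty] *(2) by simp
  next
    case False
    then have "degree p' = 0" "degree q' = 0" using *(3) by auto
    then obtain x y where xy: "p' = [:x:]" "q' = [:y:]" by (metis degree_eq_zeroE)
    have "f z = f Infty" for z
      unfolding *(2) xy by (cases z) (auto simp: quotient_map_of.simps)
    moreover obtain z w where "f z = Infty" "f w = Fin 0" using surj by metis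
    ultimately show ?thesis by (metis riemann_sphere.distinct(1))
  qed
qed

lemma rational_functionE:
  assumes "rational_function f"
  obtains p q where "rational_pair p q (rat_degree f)" "f = quotient_map_of p q"
proof -
  obtain p q where pq: "coprime p q" "max (degree p) (degree q) \<ge> 1" "f = quotient_map_of p q"
    using assms by (auto simp: rational_function_def)
  then interpret rational_pair p q "max (degree p) (degree q)" by unfold_locales auto
  have "rational_pair p q (rat_degree f)" using rational_pair_axioms rat_degree pq by simp
  then show ?thesis using that pq by blast
qed

lemma rational_germ_ord: "rational_function f \<Longrightarrow> \<exists>h n. germ f z h \<and> ord_at h n"
  by (elim rational_functionE) (metis rational_pair.germ_ord)

lemma rational_hol: "rational_function f \<Longrightarrow> hol_at f z"
  using rational_germ_ord by (auto simp: hol_at_def)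

lemma rational_degree_pos: "rational_function f \<Longrightarrow> rat_degree f \<ge> 1"
  by (elim rational_functionE) (simp add: rational_pair_def)

lemma rational_surj: "rational_function f \<Longrightarrow> \<exists>z. f z = c"
  by (elim rational_functionE) (simp add: rational_pair.surj)

lemma finite_rational_fiber: "rational_function f \<Longrightarrow> finite (f -` {c})"
  by (elim rational_functionE) (simp add: rational_pair.fiber_sum)

lemma rational_fiber_sum: "rational_function f \<Longrightarrow> (\<Sum>z\<in>f -` {c}. local_degree f z) = rat_degree f"
  by (elim rational_functionE) (metis rational_pair.fiber_sum(2))

lemma local_degree_pos: "rational_function f \<Longrightarrow> local_degree f z \<ge> 1"
  by (elim rational_functionE) (metis rational_pair.local_degree_pos)

lemma rational_riemann_hurwitz:
  assumes "rational_function f"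
  shows "finite {z. local_degree f z > 1}"
    "(\<Sum>z | local_degree f z > 1. local_degree f z - 1) = 2 * rat_degree f - 2"
proof -
  obtain p q where pq: "rational_pair p q (rat_degree f)" "f = quotient_map_of p q"
    using rational_functionE[OF assms] by blast
  show "finite {z. local_degree f z > 1}"
    "(\<Sum>z | local_degree f z > 1. local_degree f z - 1) = 2 * rat_degree f - 2"
    by (rule rational_pair.riemann_hurwitz[OF pq(1), folded pq(2)])+
qed

lemma rational_not_const: "rational_function f \<Longrightarrow> f \<noteq> (\<lambda>_. c)"
  using rational_surj by (metis riemann_sphere.distinct(1))

lemma rational_compose:
  assumes "rational_function f" "rational_function g" shows "rational_function (f \<circ> g)"
proof (rule rational_functionI)
  show "hol_at (f \<circ> g) z" for z using assms by (intro hol_at_compose rational_hol)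
  show "f \<circ> g \<noteq> (\<lambda>_. c)" for c
    by (metis assms comp_apply rational_surj riemann_sphere.distinct(1))
qed

lemma local_degree_compose:
  assumes "rational_function f" "rational_function g"
  shows "local_degree (f \<circ> g) z = local_degree f (g z) * local_degree g z"
proof -
  obtain h n where h: "germ f (g z) h" "ord_at h n" using rational_germ_ord assms by blast
  obtain k m where k: "germ g z k" "ord_at k m" using rational_germ_ord assms by blast
  have "ord_at (h \<circ> k) (n * m)" using h k by (intro ord_at_compose) (auto simp: germ_def)
  then show ?thesis using local_degree_eqI germ_compose h k by metis
qed

lemma rat_degree_compose:
  assumes f: "rational_function f" and g: "rational_function g"
  shows "rat_degree (f \<circ> g) = rat_degree f * rat_degree g"
proof -
  have "rat_degree (f \<circ> g) = (\<Sum>z\<in>(f \<circ> g) -` {Infty}. local_degree (f \<circ> g) z)"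
    using rational_fiber_sum[OF rational_compose[OF f g]] by simp
  also have "(f \<circ> g) -` {Infty} = (\<Union>y\<in>f -` {Infty}. g -` {y})" by auto
  also have "(\<Sum>z\<in>\<dots>. local_degree (f \<circ> g) z) = (\<Sum>y\<in>f -` {Infty}. \<Sum>z\<in>g -` {y}. local_degree (f \<circ> g) z)"
    by (rule sum.UNION_disjoint) (use finite_rational_fiber f g in auto)
  also have "\<dots> = (\<Sum>y\<in>f -` {Infty}. \<Sum>z\<in>g -` {y}. local_degree f y * local_degree g z)"
    by (intro sum.cong refl) (auto simp: local_degree_compose[OF f g])
  also have "\<dots> = (\<Sum>y\<in>f -` {Infty}. local_degree f y * rat_degree g)"
    by (simp add: rational_fiber_sum[OF g] flip: sum_distrib_left)
  also have "\<dots> = rat_degree f * rat_degree g"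
    by (simp add: rational_fiber_sum[OF f] flip: sum_distrib_right)
  finally show ?thesis .
qed

lemma ord_at_root:
  assumes "ord_at h n" "n \<ge> 1"
  shows "\<exists>\<phi>. \<phi> analytic_on {0} \<and> \<phi> 0 = 0 \<and> ord_at \<phi> 1 \<and> (\<forall>\<^sub>F u in nhds 0. h u = \<phi> u ^ n)"
proof -
  obtain k where k: "k analytic_on {0}" "k 0 \<noteq> 0" "\<forall>\<^sub>F u in nhds 0. h u = u ^ n * k u"
    using assms by (auto simp: ord_at_def)
  define e where "e = (\<lambda>u. exp (Ln (k 0) / n) * exp (Ln (k u / k 0) / n))"
  have "(\<lambda>u. k u / k 0) analytic_on {0}" using k by (intro analytic_intros) auto
  moreover have "k 0 / k 0 \<notin> \<real>\<^sub>\<le>\<^sub>0" using k by simp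
  ultimately have e: "e analytic_on {0}" unfolding e_def
    by (intro analytic_intros k(1)) (use assms k in auto)
  have en: "e u ^ n = k u" if "k u \<noteq> 0" for u
    unfolding e_def power_mult_distrib exp_of_nat_mult[symmetric] using assms that k(2) by simp
  have e0: "e 0 \<noteq> 0" by (simp add: e_def)
  have "\<forall>\<^sub>F u in nhds 0. k u \<noteq> 0"
    using analytic_tendsto_nhds[OF k(1)] k(2) by (rule tendsto_imp_eventually_ne)
  with k(3) have "\<forall>\<^sub>F u in nhds 0. h u = (u * e u) ^ n"
    by eventually_elim (simp add: power_mult_distrib en)
  moreover have "ord_at (\<lambda>u. u * e u) 1" unfolding ord_at_def
    using e e0 by (intro exI[of _ e]) auto
  ultimately show ?thesis using e by (intro exI[of _ "\<lambda>u. u * e u"]) (auto intro!: analytic_intros)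
qed

lemma rational_normal_form:
  assumes "rational_function f"
  shows "\<exists>\<phi>. \<phi> analytic_on {0} \<and> \<phi> 0 = 0 \<and> ord_at \<phi> 1 \<and> germ f z (\<lambda>u. \<phi> u ^ local_degree f z)"
proof -
  obtain h n where h: "germ f z h" "ord_at h n" using rational_germ_ord assms by blast
  then have n: "local_degree f z = n" by (rule local_degree_eqI)
  obtain \<phi> where \<phi>: "\<phi> analytic_on {0}" "\<phi> 0 = 0" "ord_at \<phi> 1" "\<forall>\<^sub>F u in nhds 0. h u = \<phi> u ^ n"
    using ord_at_root[OF h(2)] local_degree_pos[OF assms, of z] n by blast
  have "\<forall>\<^sub>F u in nhds 0. f (param z u) = param (f z) (h u)" using h by (simp add: germ_def)
  then have "\<forall>\<^sub>F u in nhds 0. f (param z u) = param (f z) (\<phi> u ^ n)"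
    using \<phi>(4) by eventually_elim simp
  then have "germ f z (\<lambda>u. \<phi> u ^ n)"
    unfolding germ_def using \<phi> local_degree_pos[OF assms, of z] n by (auto intro!: analytic_intros)
  then show ?thesis using \<phi> n by blast
qed

lemma local_inverse:
  assumes "\<phi> analytic_on {0}" "\<phi> 0 = 0" "ord_at \<phi> 1"
  shows "\<exists>\<psi>. \<psi> analytic_on {0} \<and> \<psi> 0 = 0 \<and> ord_at \<psi> 1 \<and>
           (\<forall>\<^sub>F u in nhds 0. \<psi> (\<phi> u) = u) \<and> (\<forall>\<^sub>F v in nhds 0. \<phi> (\<psi> v) = v)"
proof -
  obtain k where k: "k analytic_on {0}" "k 0 \<noteq> 0" "\<forall>\<^sub>F u in nhds 0. \<phi> u = u ^ 1 * k u"
    using assms by (auto simp: ord_at_def)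
  obtain k' where k': "(k has_field_derivative k') (at 0)"
    using k(1) analytic_on_imp_differentiable_at field_differentiable_def by blast
  have "((\<lambda>u. u * k u) has_field_derivative (k 0)) (at 0)"
    using k' by (auto intro!: derivative_eq_intros)
  moreover have "\<forall>\<^sub>F u in nhds 0. \<phi> u = u * k u" using k(3) by simp
  ultimately have D: "(\<phi> has_field_derivative (k 0)) (at 0)"
    by (subst DERIV_cong_ev) auto
  then have d: "deriv \<phi> 0 \<noteq> 0" using k(2) by (simp add: DERIV_imp_deriv)
  obtain r0 where r0: "r0 > 0" "\<phi> holomorphic_on ball 0 r0" using assms by (auto simp: analytic_on_def)
  obtain r where r: "r > 0" "ball (0::complex) r \<subseteq> ball 0 r0" "inj_on \<phi> (ball 0 r)"
    using has_complex_derivative_locally_injective[OF r0(2) _ open_ball d] r0(1) centre_in_ball by blast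
  have hol: "\<phi> holomorphic_on ball 0 r" by (rule holomorphic_on_subset[OF r0(2) r(2)])
  obtain \<psi> where \<psi>: "\<psi> holomorphic_on (\<phi> ` ball 0 r)" "\<And>z. z \<in> ball 0 r \<Longrightarrow> deriv \<phi> z * deriv \<psi> (\<phi> z) = 1"
      "\<And>z. z \<in> ball 0 r \<Longrightarrow> \<psi> (\<phi> z) = z"
    using holomorphic_has_inverse[OF hol open_ball r(3)] by blast
  have op: "open (\<phi> ` ball 0 r)" by (rule open_mapping_thm3[OF hol open_ball r(3)])
  have mem: "0 \<in> \<phi> ` ball 0 r" using assms(2) r(1) by (metis centre_in_ball image_eqI)
  have an: "\<psi> analytic_on {0}" using \<psi>(1) op mem by (auto simp: analytic_at)
  have \<psi>0: "\<psi> 0 = 0" using \<psi>(3)[of 0] r assms(2) by simp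
  have e1: "\<forall>\<^sub>F u in nhds 0. \<psi> (\<phi> u) = u"
    using eventually_nhds_in_open[OF open_ball, of 0 0 r] r(1) \<psi>(3) by (auto elim: eventually_mono)
  have e2: "\<forall>\<^sub>F v in nhds 0. \<phi> (\<psi> v) = v"
    using eventually_nhds_in_open[OF op mem] by eventually_elim (use \<psi>(3) in auto)
  have "ord_at \<psi> 1"
  proof -
    have "\<not> (\<forall>\<^sub>F v in nhds 0. \<psi> v = 0)"
    proof
      assume z: "\<forall>\<^sub>F v in nhds 0. \<psi> v = 0"
      have "\<forall>\<^sub>F v in nhds (0::complex). v = 0" using z e2 by eventually_elim (use assms(2) in auto)
      then have "\<forall>\<^sub>F v in at (0::complex). False" by (simp add: eventually_at_filter)
      then show False by simp
    qed
    then obtain n where n: "ord_at \<psi> n" using analytic_ord_cases[OF an] by blast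
    have "ord_at (\<psi> \<circ> \<phi>) (n * 1)" by (rule ord_at_compose) (use n assms in auto)
    then have "ord_at (\<lambda>u. u) n" using ord_at_cong[of "\<psi> \<circ> \<phi>" "\<lambda>u. u"] e1 by simp
    moreover have "ord_at (\<lambda>u. u) 1" unfolding ord_at_def by (intro exI[of _ "\<lambda>_. 1"]) auto
    moreover have "germ (\<lambda>x. x) (Fin 0) (\<lambda>u. u)" by (rule germ_id)
    ultimately show ?thesis using n local_degree_eqI by metis
  qed
  then show ?thesis using an \<psi>0 e1 e2 by blast
qed

lemma rational_fixed_point:
  assumes "rational_function f" shows "\<exists>z. f z = z"
proof (cases "f Infty = Infty")
  case True then show ?thesis by blast
next
  case False
  obtain p q where pq: "rational_pair p q (rat_degree f)" "f = quotient_map_of p q"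
    using rational_functionE[OF assms] by blast
  interpret rational_pair p q "rat_degree f" by (rule pq(1))
  have q: "coeff q (rat_degree f) \<noteq> 0" using False value_Infty[of Infty] pq(2) by simp
  define r where "r = p - monom 1 1 * q"
  have "coeff r (Suc (rat_degree f)) = - coeff q (rat_degree f)"
    using degree_le(2)[of Infty] by (simp add: r_def coeff_monom_mult coeff_eq_0)
  then have "degree r \<ge> Suc (rat_degree f)" using q by (intro le_degree) simp
  then have "\<not> constant (poly r)" by (simp add: constant_degree)
  then obtain z where "poly r z = 0" using fundamental_theorem_of_algebra by blast
  then have "poly p z = z * poly q z" by (simp add: r_def poly_monom)
  then have "poly q z \<noteq> 0" using no_common_root[of z] by auto
  then have "f (Fin z) = Fin z" using \<open>poly p z = z * poly q z\<close> pq(2) by (simp add: quotient_map_of.simps)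
  then show ?thesis by blast
qed

section \<open>Moebius transformations and local lifts\<close>

definition mobius :: "(riemann_sphere \<Rightarrow> riemann_sphere) \<Rightarrow> bool" where
  "mobius \<sigma> \<longleftrightarrow> rational_function \<sigma> \<and> rat_degree \<sigma> = 1"

lemma mobius_rational: "mobius \<sigma> \<Longrightarrow> rational_function \<sigma>"
  by (simp add: mobius_def)

lemma mobius_compose: "mobius \<sigma> \<Longrightarrow> mobius \<tau> \<Longrightarrow> mobius (\<sigma> \<circ> \<tau>)"
  by (simp add: mobius_def rational_compose rat_degree_compose)

lemma mobius_fiber:
  assumes "mobius \<sigma>" shows "\<exists>z. \<sigma> -` {c} = {z} \<and> local_degree \<sigma> z = 1"
proof -
  have r: "rational_function \<sigma>" and s: "(\<Sum>z\<in>\<sigma> -` {c}. local_degree \<sigma> z) = 1"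
    using assms rational_fiber_sum[of \<sigma> c] by (auto simp: mobius_def)
  obtain z where z: "\<sigma> z = c" using rational_surj[OF r] by blast
  have fin: "finite (\<sigma> -` {c})" by (rule finite_rational_fiber[OF r])
  have "local_degree \<sigma> z + (\<Sum>z\<in>\<sigma> -` {c} - {z}. local_degree \<sigma> z) = 1"
    using s sum.remove[OF fin, of z "local_degree \<sigma>"] z by simp
  then have 0: "(\<Sum>z\<in>\<sigma> -` {c} - {z}. local_degree \<sigma> z) = 0" and 1: "local_degree \<sigma> z = 1"
    using local_degree_pos[OF r, of z] by (simp_all del: sum_eq_0_iff)
  have "\<sigma> -` {c} - {z} = {}"
    using 0 fin local_degree_pos[OF r] by (metis finite_Diff sum_eq_0_iff not_one_le_zero equals0I)
  then show ?thesis using z 1 by blast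
qed

lemma mobius_bij: assumes "mobius \<sigma>" shows "bij \<sigma>"
proof (rule bijI')
  fix x y
  obtain z where z: "\<sigma> -` {\<sigma> x} = {z}" using mobius_fiber[OF assms, of "\<sigma> x"] by blast
  have "x \<in> \<sigma> -` {\<sigma> x}" "\<sigma> x = \<sigma> y \<Longrightarrow> y \<in> \<sigma> -` {\<sigma> x}" by auto
  then show "(\<sigma> x = \<sigma> y) = (x = y)" unfolding z by auto
next
  fix y show "\<exists>x. y = \<sigma> x" using mobius_fiber[OF assms, of y] by auto
qed

lemma mobius_local_degree: "mobius \<sigma> \<Longrightarrow> local_degree \<sigma> z = 1"
  using mobius_fiber[of \<sigma> "\<sigma> z"] by (metis singletonD singletonI vimage_singleton_eq)

lemma rational_id: "rational_function (\<lambda>x. x)"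
  by (rule rational_functionI) (auto simp: hol_at_id fun_eq_iff, metis riemann_sphere.distinct(1))

lemma mobius_id: "mobius (\<lambda>x. x)"
  using rat_degree_compose[OF rational_id rational_id] rational_degree_pos[OF rational_id]
  by (simp add: mobius_def rational_id o_def)

lemma mobius_inv:
  assumes "mobius \<sigma>" shows "mobius (inv \<sigma>)" "\<sigma> \<circ> inv \<sigma> = (\<lambda>x. x)" "inv \<sigma> \<circ> \<sigma> = (\<lambda>x. x)"
proof -
  have r: "rational_function \<sigma>" using assms by (simp add: mobius_def)
  note b = mobius_bij[OF assms]
  show i1: "\<sigma> \<circ> inv \<sigma> = (\<lambda>x. x)" and i2: "inv \<sigma> \<circ> \<sigma> = (\<lambda>x. x)"
    using b by (auto simp: fun_eq_iff bij_is_surj surj_f_inv_f bij_is_inj inv_f_f)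
  have "hol_at (inv \<sigma>) y" for y
  proof -
    obtain z where z: "y = \<sigma> z" using b by (metis bij_pointE)
    obtain \<phi> where \<phi>: "\<phi> analytic_on {0}" "\<phi> 0 = 0" "ord_at \<phi> 1" "germ \<sigma> z \<phi>"
      using rational_normal_form[OF r, of z] mobius_local_degree[OF assms, of z] by auto
    obtain \<psi> where \<psi>: "\<psi> analytic_on {0}" "\<psi> 0 = 0" "\<forall>\<^sub>F v in nhds 0. \<phi> (\<psi> v) = v"
      using local_inverse[OF \<phi>(1-3)] by blast
    have "(\<psi> \<longlongrightarrow> 0) (nhds 0)" using analytic_tendsto_nhds[OF \<psi>(1)] \<psi>(2) by simp
    then have "\<forall>\<^sub>F v in nhds 0. \<sigma> (param z (\<psi> v)) = param y (\<phi> (\<psi> v))"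
      using \<phi>(4) z by (auto simp: germ_def intro: eventually_compose_filterlim)
    with \<psi>(3) have "\<forall>\<^sub>F v in nhds 0. inv \<sigma> (param y v) = param (inv \<sigma> y) (\<psi> v)"
    proof eventually_elim
      case (elim v)
      then have "inv \<sigma> (param y v) = inv \<sigma> (\<sigma> (param z (\<psi> v)))" by simp
      then show ?case using b z by (simp add: bij_is_inj inv_f_f)
    qed
    then show ?thesis using \<psi> by (auto simp: hol_at_def germ_def)
  qed
  moreover have "inv \<sigma> \<noteq> (\<lambda>_. c)" for c
    using bij_imp_bij_inv[OF b] by (metis UNIV_I bij_def imageE riemann_sphere.distinct(1) surj_def)
  ultimately have r': "rational_function (inv \<sigma>)" by (rule rational_functionI)
  have "rat_degree (\<lambda>x. x) = 1" using mobius_id by (simp add: mobius_def)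
  then have "rat_degree \<sigma> * rat_degree (inv \<sigma>) = 1" using rat_degree_compose[OF r r'] i1 by simp
  then show "mobius (inv \<sigma>)" using r' by (simp add: mobius_def)
qed

lemma mobius_affine:
  assumes "a \<noteq> 0" shows "mobius (quotient_map_of [:b, a:] 1)"
proof -
  interpret rational_pair "[:b, a:]" 1 1 by unfold_locales (use assms in auto)
  show ?thesis using rat_degree coprime d_def unfolding mobius_def rational_function_def by (metis order_refl)
qed

lemma mobius_reciprocal: "mobius (quotient_map_of 1 [:0, 1:])"
proof -
  interpret rational_pair 1 "[:0, 1:]" 1 by unfold_locales auto
  show ?thesis using rat_degree coprime d_def unfolding mobius_def rational_function_def by (metis order_refl)
qed

lemma affine_simps:
  "a \<noteq> 0 \<Longrightarrow> quotient_map_of [:b, a:] 1 (Fin z) = Fin (b + a * z)"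
  "a \<noteq> 0 \<Longrightarrow> quotient_map_of [:b, a:] 1 Infty = Infty"
  by (auto simp: quotient_map_of.simps mult.commute)

lemma reciprocal_simps:
  "quotient_map_of 1 [:0, 1:] (Fin z) = (if z = 0 then Infty else Fin (1 / z))"
  "quotient_map_of 1 [:0, 1:] Infty = Fin 0"
  by (auto simp: quotient_map_of.simps)

lemma mobius_to_Infty: "\<exists>\<mu>. mobius \<mu> \<and> \<mu> c = Infty"
proof (cases c)
  case Infty then show ?thesis using mobius_id by blast
next
  case (Fin a)
  have "mobius (quotient_map_of 1 [:0, 1:] \<circ> quotient_map_of [:-a, 1:] 1)"
    by (intro mobius_compose mobius_reciprocal mobius_affine) simp
  moreover have "(quotient_map_of 1 [:0, 1:] \<circ> quotient_map_of [:-a, 1:] 1) c = Infty"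
    by (simp add: Fin affine_simps reciprocal_simps)
  ultimately show ?thesis by blast
qed

lemma mobius_normalize:
  assumes "a \<noteq> b" "b \<noteq> c" "a \<noteq> c"
  shows "\<exists>\<mu>. mobius \<mu> \<and> \<mu> a = Fin 0 \<and> \<mu> b = Infty \<and> \<mu> c = Fin 1"
proof -
  obtain \<mu> where \<mu>: "mobius \<mu>" "\<mu> b = Infty" using mobius_to_Infty by blast
  have inj: "inj \<mu>" using mobius_bij[OF \<mu>(1)] by (rule bij_is_inj)
  then have "\<mu> a \<noteq> Infty" "\<mu> c \<noteq> Infty" "\<mu> a \<noteq> \<mu> c" using \<mu>(2) assms by (metis injD)+
  then obtain x y where xy: "\<mu> a = Fin x" "\<mu> c = Fin y" "y - x \<noteq> 0"
    by (cases "\<mu> a"; cases "\<mu> c") auto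
  define \<tau> where "\<tau> = quotient_map_of [:-x / (y - x), 1 / (y - x):] 1"
  have nz: "1 / (y - x) \<noteq> 0" using xy by simp
  have "mobius (\<tau> \<circ> \<mu>)" unfolding \<tau>_def by (intro mobius_compose \<mu> mobius_affine nz)
  moreover have "(\<tau> \<circ> \<mu>) a = Fin 0" "(\<tau> \<circ> \<mu>) c = Fin 1" "(\<tau> \<circ> \<mu>) b = Infty"
    using nz xy \<mu>(2) by (simp_all add: \<tau>_def affine_simps) (simp flip: diff_divide_distrib add_divide_distrib)
  ultimately show ?thesis by blast
qed

lemma mobius_transitive:
  assumes "a \<noteq> b" "b \<noteq> c" "a \<noteq> c" "a' \<noteq> b'" "b' \<noteq> c'" "a' \<noteq> c'"
  shows "\<exists>\<mu>. mobius \<mu> \<and> \<mu> a = a' \<and> \<mu> b = b' \<and> \<mu> c = c'"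
proof -
  obtain \<mu> where \<mu>: "mobius \<mu>" "\<mu> a = Fin 0" "\<mu> b = Infty" "\<mu> c = Fin 1"
    using mobius_normalize[OF assms(1-3)] by blast
  obtain \<mu>' where \<mu>': "mobius \<mu>'" "\<mu>' a' = Fin 0" "\<mu>' b' = Infty" "\<mu>' c' = Fin 1"
    using mobius_normalize[OF assms(4-6)] by blast
  have "mobius (inv \<mu>' \<circ> \<mu>)" by (intro mobius_compose mobius_inv \<mu> \<mu>')
  moreover have "inj \<mu>'" using mobius_bij[OF \<mu>'(1)] by (rule bij_is_inj)
  ultimately show ?thesis using \<mu> \<mu>' by (intro exI[of _ "inv \<mu>' \<circ> \<mu>"]) (auto simp: inv_f_eq)
qed

lemma sphere_compactness:
  assumes "\<And>w. \<exists>\<delta>>0. \<forall>\<^sub>F v in nhds 0. Q (param w v) \<delta>"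
    and mono: "\<And>x \<delta> \<delta>'. Q x \<delta> \<Longrightarrow> 0 < \<delta>' \<Longrightarrow> \<delta>' \<le> \<delta> \<Longrightarrow> Q x \<delta>'"
  shows "\<exists>\<delta>>0. \<forall>x. Q x (\<delta> :: real)"
proof -
  have chart: "\<exists>\<delta>>0. \<forall>s\<in>cball 0 1. Q (param c s) \<delta>" for c
  proof -
    have "\<exists>\<delta>>0. \<exists>S. open S \<and> s \<in> S \<and> (\<forall>v\<in>S. Q (param c v) \<delta>)" for s
    proof -
      obtain \<delta> where \<delta>: "\<delta> > 0" "\<forall>\<^sub>F v in nhds 0. Q (param (param c s) v) \<delta>" using assms(1) by blast
      obtain T where T: "T analytic_on {0}" "T 0 = 0" "\<forall>\<^sub>F v in nhds 0. param c (s + v) = param (param c s) (T v)"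
        using param_transition by blast
      have "(T \<longlongrightarrow> 0) (nhds 0)" using analytic_tendsto_nhds[OF T(1)] T(2) by simp
      from eventually_compose_filterlim[OF \<delta>(2) this] T(3)
      have "\<forall>\<^sub>F v in nhds 0. Q (param c (s + v)) \<delta>" by eventually_elim simp
      moreover have "((\<lambda>v. v - s) \<longlongrightarrow> 0) (nhds s)"
        using tendsto_diff[of "\<lambda>x. x" s "nhds s" "\<lambda>_. s" s] by (simp add: filterlim_ident)
      ultimately have "\<forall>\<^sub>F v in nhds s. Q (param c (s + (v - s))) \<delta>"
        by (rule eventually_compose_filterlim)
      then show ?thesis using \<delta>(1) by (auto simp: eventually_nhds)
    qed
    then obtain D S where DS: "\<And>s. D s > 0" "\<And>s. open (S s)" "\<And>s. s \<in> S s" "\<And>s v. v \<in> S s \<Longrightarrow> Q (param c v) (D s)"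
      by metis
    obtain B where B: "B \<subseteq> cball 0 1" "finite B" "cball 0 1 \<subseteq> (\<Union>s\<in>B. S s)"
      using compactE_image[of "cball 0 (1::real) :: complex set" "cball 0 1" S] DS by (metis UN_I compact_cball subsetI)
    have "0 < Min (insert 1 (D ` B))" using B DS(1) by simp
    moreover have "\<forall>s\<in>cball 0 1. Q (param c s) (Min (insert 1 (D ` B)))"
    proof
      fix s :: complex assume "s \<in> cball 0 1"
      then obtain t where t: "t \<in> B" "s \<in> S t" using B(3) by blast
      have "Min (insert 1 (D ` B)) \<le> D t" using t B(2) by simp
      then show "Q (param c s) (Min (insert 1 (D ` B)))"
        using mono[OF DS(4)[OF t(2)]] calculation by blast
    qed
    ultimately show ?thesis by blast
  qed
  obtain d1 d2 where d: "d1 > 0" "\<forall>s\<in>cball 0 1. Q (param (Fin 0) s) d1" "d2 > 0" "\<forall>s\<in>cball 0 1. Q (param Infty s) d2"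
    using chart by metis
  have "Q x (min d1 d2)" for x
  proof (cases x rule: sphere_cases)
    case (1 a) then show ?thesis using mono[of x d1 "min d1 d2"] d by (simp del: param.simps)
  next
    case (2 a) then show ?thesis using mono[of x d2 "min d1 d2"] d by (simp del: param.simps)
  qed
  then show ?thesis using d by (metis min_less_iff_conj)
qed

lemma separated_ball:
  assumes "hol_at \<theta> w" "\<theta> w \<noteq> c"
  shows "\<exists>\<epsilon>>0. \<forall>v s. norm v < \<epsilon> \<longrightarrow> norm s < \<epsilon> \<longrightarrow> \<theta> (param w v) \<noteq> param c s"
proof -
  obtain h where h: "germ \<theta> w h" using assms by (auto simp: hol_at_def)
  define F where "F = (nhds 0 \<times>\<^sub>F nhds 0 :: (complex \<times> complex) filter)"
  have ff: "filterlim fst (nhds 0) F" "filterlim snd (nhds 0) F"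
    unfolding F_def by (rule filterlim_fst filterlim_snd)+
  have "((\<lambda>p. h (fst p)) \<longlongrightarrow> 0) F" using filterlim_compose[OF germ_tendsto[OF h] ff(1)] .
  from param_separated[OF assms(2) this ff(2)]
  have 1: "\<forall>\<^sub>F p in F. param (\<theta> w) (h (fst p)) \<noteq> param c (snd p)" .
  have "\<forall>\<^sub>F v in nhds 0. \<theta> (param w v) = param (\<theta> w) (h v)" using h by (simp add: germ_def)
  from eventually_compose_filterlim[OF this ff(1)]
  have "\<forall>\<^sub>F p in F. \<theta> (param w (fst p)) = param (\<theta> w) (h (fst p))" .
  with 1 have "\<forall>\<^sub>F p in F. \<theta> (param w (fst p)) \<noteq> param c (snd p)" by eventually_elim simp
  then obtain P R where PR: "eventually P (nhds 0)" "eventually R (nhds 0)"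
      "\<And>x y. P x \<Longrightarrow> R y \<Longrightarrow> \<theta> (param w x) \<noteq> param c y"
    unfolding F_def eventually_prod_filter by auto
  obtain d1 d2 where "d1 > 0" "\<And>v. norm v < d1 \<Longrightarrow> P v" "d2 > 0" "\<And>v. norm v < d2 \<Longrightarrow> R v"
    using PR(1,2) by (auto simp: eventually_nhds_metric dist_norm)
  then show ?thesis using PR(3) by (intro exI[of _ "min d1 d2"]) auto
qed

lemma fiber_nearby:
  assumes hol: "\<And>w. hol_at \<theta> w" and \<epsilon>: "\<And>w. \<theta> w = c \<Longrightarrow> \<epsilon> w > 0"
  shows "\<exists>\<delta>>0. \<forall>x s. norm s < \<delta> \<and> \<theta> x = param c s \<longrightarrow>
           (\<exists>w v. \<theta> w = c \<and> norm v < \<epsilon> w \<and> x = param w v)"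
proof -
  define Q where "Q x \<delta> \<longleftrightarrow> (\<forall>s. norm s < \<delta> \<and> \<theta> x = param c s \<longrightarrow>
           (\<exists>w v. \<theta> w = c \<and> norm v < \<epsilon> w \<and> x = param w v))" for x and \<delta> :: real
  have "\<exists>\<delta>>0. \<forall>x. Q x \<delta>"
  proof (rule sphere_compactness)
    fix w
    show "\<exists>\<delta>>0. \<forall>\<^sub>F v in nhds 0. Q (param w v) \<delta>"
    proof (cases "\<theta> w = c")
      case True
      have "\<forall>\<^sub>F v in nhds (0::complex). norm v < \<epsilon> w"
        using \<epsilon>[OF True] by (auto simp: eventually_nhds_metric dist_norm)
      then have "\<forall>\<^sub>F v in nhds 0. Q (param w v) 1" by eventually_elim (use True in \<open>auto simp: Q_def\<close>)
      then show ?thesis by (intro exI[of _ 1]) simp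
    next
      case False
      then obtain e where e: "e > 0" "\<And>v s. norm v < e \<Longrightarrow> norm s < e \<Longrightarrow> \<theta> (param w v) \<noteq> param c s"
        using separated_ball[OF hol] by blast
      have "\<forall>\<^sub>F v in nhds 0. norm (v::complex) < e"
        using e(1) by (auto simp: eventually_nhds_metric dist_norm)
      then have "\<forall>\<^sub>F v in nhds 0. Q (param w v) e" by eventually_elim (use e in \<open>auto simp: Q_def\<close>)
      then show ?thesis using e(1) by blast
    qed
  next
    fix x \<delta> \<delta>' assume "Q x \<delta>" "0 < \<delta>'" "\<delta>' \<le> \<delta>"
    then show "Q x \<delta>'" unfolding Q_def by (meson order_less_le_trans)
  qed
  then show ?thesis by (simp add: Q_def)
qed

lemma local_lift:
  assumes \<theta>: "rational_function \<theta>" and g: "rational_function g"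
    and n: "\<And>w. \<theta> w = g z \<Longrightarrow> local_degree \<theta> w = n" "n dvd local_degree g z"
  shows "\<exists>r>0. \<forall>u1 w1. norm u1 < r \<longrightarrow> \<theta> w1 = g (param z u1) \<longrightarrow>
           (\<exists>q. (\<forall>u. norm u < r \<longrightarrow> hol_at q (param z u) \<and> \<theta> (q (param z u)) = g (param z u)) \<and> q (param z u1) = w1)"
proof -
  define c where "c = g z"
  have npos: "n \<ge> 1" using rational_surj[OF \<theta>, of c] n(1) local_degree_pos[OF \<theta>] c_def by metis
  define P where "P w \<phi> \<psi> \<epsilon> \<rho> \<longleftrightarrow> \<epsilon> > 0 \<and> \<rho> > 0 \<and> \<phi> 0 = 0 \<and> \<psi> 0 = 0 \<and>
      (\<forall>v. norm v < \<epsilon> \<longrightarrow> \<theta> (param w v) = param c (\<phi> v ^ n) \<and> \<psi> (\<phi> v) = v) \<and>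
      (\<forall>y. norm y < \<rho> \<longrightarrow> \<phi> (\<psi> y) = y \<and> norm (\<psi> y) < \<epsilon> \<and> \<psi> analytic_on {y})" for w \<phi> \<psi> \<epsilon> \<rho>
  have "\<exists>\<phi> \<psi> \<epsilon> \<rho>. P w \<phi> \<psi> \<epsilon> \<rho>" if w: "\<theta> w = c" for w
  proof -
    obtain \<phi> where \<phi>: "\<phi> analytic_on {0}" "\<phi> 0 = 0" "ord_at \<phi> 1" "germ \<theta> w (\<lambda>u. \<phi> u ^ n)"
      using rational_normal_form[OF \<theta>, of w] n(1)[of w] w c_def by auto
    obtain \<psi> where \<psi>: "\<psi> analytic_on {0}" "\<psi> 0 = 0" "\<forall>\<^sub>F v in nhds 0. \<psi> (\<phi> v) = v" "\<forall>\<^sub>F v in nhds 0. \<phi> (\<psi> v) = v"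
      using local_inverse[OF \<phi>(1-3)] by blast
    have "\<forall>\<^sub>F v in nhds 0. \<theta> (param w v) = param c (\<phi> v ^ n)" using \<phi>(4) w by (simp add: germ_def)
    with \<psi>(3) have "\<forall>\<^sub>F v in nhds 0. \<theta> (param w v) = param c (\<phi> v ^ n) \<and> \<psi> (\<phi> v) = v" by eventually_elim simp
    then obtain \<epsilon> where \<epsilon>: "\<epsilon> > 0" "\<forall>v. norm v < \<epsilon> \<longrightarrow> \<theta> (param w v) = param c (\<phi> v ^ n) \<and> \<psi> (\<phi> v) = v"
      by (auto simp: eventually_nhds_metric dist_norm)
    have "\<forall>\<^sub>F y in nhds 0. norm (\<psi> y) < \<epsilon>"
      using order_tendstoD(2)[OF tendsto_norm[OF analytic_tendsto_nhds[OF \<psi>(1)]], of \<epsilon>] \<psi>(2) \<epsilon>(1) by simp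
    then have "\<forall>\<^sub>F y in nhds 0. \<phi> (\<psi> y) = y \<and> norm (\<psi> y) < \<epsilon> \<and> \<psi> analytic_on {y}"
      using \<psi>(4) analytic_nearby[OF \<psi>(1)] by eventually_elim blast
    then obtain \<rho> where "\<rho> > 0" "\<forall>y. norm y < \<rho> \<longrightarrow> \<phi> (\<psi> y) = y \<and> norm (\<psi> y) < \<epsilon> \<and> \<psi> analytic_on {y}"
      by (auto simp: eventually_nhds_metric dist_norm)
    then show ?thesis unfolding P_def using \<epsilon> \<phi>(2) \<psi>(2) by blast
  qed
  then obtain \<phi> \<psi> \<epsilon> \<rho> where P: "\<And>w. \<theta> w = c \<Longrightarrow> P w (\<phi> w) (\<psi> w) (\<epsilon> w) (\<rho> w)" by metis
  then have E: "\<And>w. \<theta> w = c \<Longrightarrow> \<epsilon> w > 0" "\<And>w. \<theta> w = c \<Longrightarrow> \<rho> w > 0" "\<And>w. \<theta> w = c \<Longrightarrow> \<phi> w 0 = 0" "\<And>w. \<theta> w = c \<Longrightarrow> \<psi> w 0 = 0"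
    "\<And>w v. \<theta> w = c \<Longrightarrow> norm v < \<epsilon> w \<Longrightarrow> \<theta> (param w v) = param c (\<phi> w v ^ n)"
    "\<And>w v. \<theta> w = c \<Longrightarrow> norm v < \<epsilon> w \<Longrightarrow> \<psi> w (\<phi> w v) = v"
    "\<And>w y. \<theta> w = c \<Longrightarrow> norm y < \<rho> w \<Longrightarrow> \<phi> w (\<psi> w y) = y"
    "\<And>w y. \<theta> w = c \<Longrightarrow> norm y < \<rho> w \<Longrightarrow> norm (\<psi> w y) < \<epsilon> w"
    "\<And>w y. \<theta> w = c \<Longrightarrow> norm y < \<rho> w \<Longrightarrow> \<psi> w analytic_on {y}"
    unfolding P_def by blast+
  obtain \<delta> where \<delta>: "\<delta> > 0" "\<And>x s. norm s < \<delta> \<Longrightarrow> \<theta> x = param c s \<Longrightarrow> \<exists>w v. \<theta> w = c \<and> norm v < \<epsilon> w \<and> x = param w v"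
    using fiber_nearby[of \<theta> c \<epsilon>] rational_hol[OF \<theta>] E(1) by blast
  have finf: "finite (\<theta> -` {c})" by (rule finite_rational_fiber[OF \<theta>])
  define \<rho>m where "\<rho>m = Min (insert 1 (\<rho> ` (\<theta> -` {c})))"
  have \<rho>m: "\<rho>m > 0" "\<And>w. \<theta> w = c \<Longrightarrow> \<rho>m \<le> \<rho> w" using finf E(2) by (auto simp: \<rho>m_def)
  obtain k where k: "local_degree g z = n * k" using n(2) by blast
  have kpos: "k \<ge> 1" using k local_degree_pos[OF g, of z] by (cases k) auto
  obtain \<gamma> where \<gamma>: "\<gamma> analytic_on {0}" "\<gamma> 0 = 0" "ord_at \<gamma> 1" "germ g z (\<lambda>u. \<gamma> u ^ (n * k))"
    using rational_normal_form[OF g, of z] k by auto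
  define \<eta> where "\<eta> u = \<gamma> u ^ k" for u
  have \<eta>: "\<eta> analytic_on {0}" "\<eta> 0 = 0" unfolding \<eta>_def using \<gamma> kpos by (auto intro!: analytic_intros)
  have "\<forall>\<^sub>F u in nhds 0. u \<noteq> 0 \<longrightarrow> \<eta> u \<noteq> 0"
    using ord_at_nonzero[OF \<gamma>(3)] by (auto simp: \<eta>_def eventually_at_filter elim: eventually_mono)
  moreover have "\<forall>\<^sub>F u in nhds 0. g (param z u) = param c (\<eta> u ^ n)"
    using \<gamma>(4) by (auto simp: germ_def c_def \<eta>_def power_mult mult.commute elim: eventually_mono)
  moreover have "\<forall>\<^sub>F u in nhds 0. norm (\<eta> u) < \<rho>m"
    using order_tendstoD(2)[OF tendsto_norm[OF analytic_tendsto_nhds[OF \<eta>(1)]], of \<rho>m] \<eta>(2) \<rho>m(1) by simp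
  moreover have "(\<lambda>u. \<eta> u ^ n) analytic_on {0}" using \<eta> by (intro analytic_intros)
  from order_tendstoD(2)[OF tendsto_norm[OF analytic_tendsto_nhds[OF this]], of \<delta>]
  have "\<forall>\<^sub>F u in nhds 0. norm (\<eta> u ^ n) < \<delta>" using \<delta>(1) \<eta>(2) npos by (simp add: power_0_left)
  moreover have "\<forall>\<^sub>F u in nhds 0. \<eta> analytic_on {u}" by (rule analytic_nearby[OF \<eta>(1)])
  ultimately have "\<forall>\<^sub>F u in nhds 0. (u \<noteq> 0 \<longrightarrow> \<eta> u \<noteq> 0) \<and> g (param z u) = param c (\<eta> u ^ n) \<and> norm (\<eta> u) < \<rho>m \<and> norm (\<eta> u ^ n) < \<delta> \<and> \<eta> analytic_on {u}"
    by (intro eventually_conj)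
  then obtain r where r: "r > 0" "\<And>u. norm u < r \<Longrightarrow> u \<noteq> 0 \<Longrightarrow> \<eta> u \<noteq> 0" "\<And>u. norm u < r \<Longrightarrow> g (param z u) = param c (\<eta> u ^ n)"
      "\<And>u. norm u < r \<Longrightarrow> norm (\<eta> u) < \<rho>m" "\<And>u. norm u < r \<Longrightarrow> norm (\<eta> u ^ n) < \<delta>" "\<And>u. norm u < r \<Longrightarrow> \<eta> analytic_on {u}"
    by (auto simp: eventually_nhds_metric dist_norm)
  show ?thesis
  proof (intro exI[of _ r] conjI r(1) allI impI)
    fix u1 w1 assume u1: "norm u1 < r" and w1: "\<theta> w1 = g (param z u1)"
    obtain w v where wv: "\<theta> w = c" "norm v < \<epsilon> w" "w1 = param w v"
      using \<delta>(2)[OF r(5)[OF u1], of w1] w1 r(3)[OF u1] by auto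
    have "\<phi> w v ^ n = \<eta> u1 ^ n" using E(5)[OF wv(1,2)] wv(3) w1 r(3)[OF u1] by simp
    then obtain \<zeta> where \<zeta>: "\<phi> w v = \<zeta> * \<eta> u1" "\<zeta> ^ n = 1"
    proof (cases "\<eta> u1 = 0")
      case True then show ?thesis using that[of 1] \<open>\<phi> w v ^ n = \<eta> u1 ^ n\<close> npos by (simp add: power_0_left)
    next
      case False
      then show ?thesis using that[of "\<phi> w v / \<eta> u1"] \<open>\<phi> w v ^ n = \<eta> u1 ^ n\<close> by (simp add: power_divide)
    qed
    have "norm \<zeta> ^ n = 1" using \<zeta>(2) by (metis norm_one norm_power)
    then have \<zeta>1: "norm \<zeta> = 1" using npos power_eq_imp_eq_base[of "norm \<zeta>" n 1] by simp
    define q where "q x = param w (\<psi> w (\<zeta> * \<eta> (local_coord z x)))" for x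
    have small: "norm (\<zeta> * \<eta> u) < \<rho> w" if "norm u < r" for u
      using r(4)[OF that] \<rho>m(2)[OF wv(1)] by (simp add: norm_mult \<zeta>1)
    show "\<exists>q. (\<forall>u. norm u < r \<longrightarrow> hol_at q (param z u) \<and> \<theta> (q (param z u)) = g (param z u)) \<and> q (param z u1) = w1"
    proof (intro exI[of _ q] conjI allI impI)
      fix u :: complex assume u: "norm u < r"
      have "(\<lambda>v. \<zeta> * \<eta> v) analytic_on {u}" using r(6)[OF u] by (intro analytic_intros)
      then have "(\<psi> w \<circ> (\<lambda>v. \<zeta> * \<eta> v)) analytic_on {u}"
        by (rule analytic_on_compose) (use E(9)[OF wv(1) small[OF u]] in auto)
      then show "hol_at q (param z u)" by (rule hol_at_chartI[where d = w]) (simp add: q_def)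
      have "\<theta> (q (param z u)) = param c (\<phi> w (\<psi> w (\<zeta> * \<eta> u)) ^ n)"
        unfolding q_def using E(5)[OF wv(1) E(8)[OF wv(1) small[OF u]]] by simp
      also have "\<dots> = param c (\<eta> u ^ n)" using E(7)[OF wv(1) small[OF u]] \<zeta>(2) by (simp add: power_mult_distrib)
      finally show "\<theta> (q (param z u)) = g (param z u)" using r(3)[OF u] by simp
    next
      show "q (param z u1) = w1" using E(6)[OF wv(1,2)] wv(3) by (simp add: q_def \<zeta>(1)[symmetric])
    qed
  qed
qed

lemma lift_agree:
  assumes \<theta>: "rational_function \<theta>" and q: "hol_at q1 x" "hol_at q2 x" "q1 x = q2 x"
    and d: "local_degree \<theta> (q1 x) = 1" and e: "\<forall>\<^sub>F u in nhds 0. \<theta> (q1 (param x u)) = \<theta> (q2 (param x u))"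
  shows "agree q1 q2 x"
proof -
  define w where "w = q1 x"
  obtain h1 h2 where h: "germ q1 x h1" "germ q2 x h2" using q by (auto simp: hol_at_def)
  obtain \<phi> where \<phi>: "\<phi> analytic_on {0}" "\<phi> 0 = 0" "ord_at \<phi> 1" "germ \<theta> w \<phi>"
    using rational_normal_form[OF \<theta>, of w] d by (auto simp: w_def)
  obtain \<psi> where \<psi>: "\<forall>\<^sub>F v in nhds 0. \<psi> (\<phi> v) = v"
    using local_inverse[OF \<phi>(1-3)] by blast
  have *: "\<forall>\<^sub>F v in nhds 0. \<theta> (param w v) = param (\<theta> w) (\<phi> v) \<and> \<psi> (\<phi> v) = v"
    using \<phi>(4) \<psi> by (auto simp: germ_def intro: eventually_conj)
  have "\<forall>\<^sub>F u in nhds 0. \<theta> (param w (h1 u)) = param (\<theta> w) (\<phi> (h1 u)) \<and> \<psi> (\<phi> (h1 u)) = h1 u"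
    by (rule eventually_compose_filterlim[OF * germ_tendsto[OF h(1)]])
  moreover have "\<forall>\<^sub>F u in nhds 0. \<theta> (param w (h2 u)) = param (\<theta> w) (\<phi> (h2 u)) \<and> \<psi> (\<phi> (h2 u)) = h2 u"
    by (rule eventually_compose_filterlim[OF * germ_tendsto[OF h(2)]])
  moreover have "\<forall>\<^sub>F u in nhds 0. q1 (param x u) = param w (h1 u)" "\<forall>\<^sub>F u in nhds 0. q2 (param x u) = param w (h2 u)"
    using h q(3) by (auto simp: germ_def w_def)
  ultimately show ?thesis using e unfolding agree_def
    by eventually_elim (metis param_eq_iff)
qed

section \<open>Lifting to universal coverings\<close>

lemma hol_at_cong:
  assumes "\<forall>\<^sub>F u in nhds 0. f (param z u) = g (param z u)" "hol_at g z"
  shows "hol_at f z"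
proof -
  obtain h where h: "germ g z h" using assms by (auto simp: hol_at_def)
  have "f z = g z" using eventually_nhds_x_imp_x[OF assms(1)] by simp
  moreover have "\<forall>\<^sub>F u in nhds 0. g (param z u) = param (g z) (h u)" using h by (simp add: germ_def)
  with assms(1) have "\<forall>\<^sub>F u in nhds 0. f (param z u) = param (g z) (h u)" by eventually_elim simp
  ultimately show ?thesis using h unfolding hol_at_def germ_def by auto
qed

lemma hol_at_cong_open:
  assumes "open V" "z \<in> V" "\<And>v. v \<in> V \<Longrightarrow> f (Fin v) = g (Fin v)" "hol_at g (Fin z)"
  shows "hol_at f (Fin z)"
proof (rule hol_at_cong[OF _ assms(4)])
  have "\<forall>\<^sub>F v in nhds z. f (Fin v) = g (Fin v)"
    using eventually_nhds_in_open[OF assms(1,2)] by eventually_elim (rule assms(3))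
  then show "\<forall>\<^sub>F u in nhds 0. f (param (Fin z) u) = g (param (Fin z) u)"
    using agree_Fin[of f g z] by (simp add: agree_def)
qed

locale lifting =
  fixes \<theta> g :: "riemann_sphere \<Rightarrow> riemann_sphere" and \<nu> :: "riemann_sphere \<Rightarrow> nat"
  assumes \<theta>: "rational_function \<theta>" and g: "rational_function g"
    and \<nu>_\<theta>: "\<And>w. \<nu> (\<theta> w) = local_degree \<theta> w"
    and \<nu>_g: "\<And>z. \<nu> (g (Fin z)) dvd local_degree g (Fin z)"
begin

definition is_lift :: "complex set \<Rightarrow> (riemann_sphere \<Rightarrow> riemann_sphere) \<Rightarrow> bool" where
  "is_lift V q \<longleftrightarrow> (\<forall>z\<in>V. hol_at q (Fin z) \<and> \<theta> (q (Fin z)) = g (Fin z))"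

lemma is_lift_subset: "is_lift V q \<Longrightarrow> U \<subseteq> V \<Longrightarrow> is_lift U q"
  by (auto simp: is_lift_def)

lemma finite_ramified: "finite {z. \<nu> (g (Fin z)) \<noteq> 1}"
proof -
  have "{c. \<nu> c \<noteq> 1} \<subseteq> \<theta> ` {w. local_degree \<theta> w > 1}"
  proof
    fix c assume c: "c \<in> {c. \<nu> c \<noteq> 1}"
    obtain w where "\<theta> w = c" using rational_surj[OF \<theta>] by blast
    then show "c \<in> \<theta> ` {w. local_degree \<theta> w > 1}"
      using c \<nu>_\<theta>[of w] local_degree_pos[OF \<theta>, of w] by force
  qed
  then have 1: "finite {c. \<nu> c \<noteq> 1}"
    using rational_riemann_hurwitz(1)[OF \<theta>] finite_subset by blast
  have "{z. \<nu> (g (Fin z)) \<noteq> 1} = Fin -` (\<Union>c\<in>{c. \<nu> c \<noteq> 1}. g -` {c})" by auto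
  moreover have "finite (\<Union>c\<in>{c. \<nu> c \<noteq> 1}. g -` {c})" using 1 finite_rational_fiber[OF g] by auto
  ultimately show ?thesis by (metis finite_vimageI injI riemann_sphere.inject)
qed

lemma local_lifts:
  "\<exists>r>0. (\<forall>z1\<in>ball z r. \<forall>w. \<theta> w = g (Fin z1) \<longrightarrow> (\<exists>q. is_lift (ball z r) q \<and> q (Fin z1) = w)) \<and>
         (\<forall>z1\<in>ball z r - {z}. \<nu> (g (Fin z1)) = 1)"
proof -
  have "\<exists>r>0. \<forall>u1 w1. norm u1 < r \<longrightarrow> \<theta> w1 = g (param (Fin z) u1) \<longrightarrow>
           (\<exists>q. (\<forall>u. norm u < r \<longrightarrow> hol_at q (param (Fin z) u) \<and> \<theta> (q (param (Fin z) u)) = g (param (Fin z) u)) \<and> q (param (Fin z) u1) = w1)"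
    by (rule local_lift[OF \<theta> g, where n = "\<nu> (g (Fin z))"]) (use \<nu>_\<theta> \<nu>_g in metis)+
  then obtain r where r: "r > 0" "\<And>u1 w1. norm u1 < r \<Longrightarrow> \<theta> w1 = g (Fin (z + u1)) \<Longrightarrow>
           (\<exists>q. (\<forall>u. norm u < r \<longrightarrow> hol_at q (Fin (z + u)) \<and> \<theta> (q (Fin (z + u))) = g (Fin (z + u))) \<and> q (Fin (z + u1)) = w1)"
    by auto
  obtain r' where r': "r' > 0" "\<forall>x\<in>{z. \<nu> (g (Fin z)) \<noteq> 1}. x \<noteq> z \<longrightarrow> r' \<le> dist z x"
    using finite_set_avoid[OF finite_ramified, of z] by blast
  have "\<exists>q. is_lift (ball z (min r r')) q \<and> q (Fin z1) = w"
    if z1: "z1 \<in> ball z (min r r')" and w: "\<theta> w = g (Fin z1)" for z1 w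
  proof -
    have "norm (z1 - z) < r" using z1 by (simp add: dist_norm norm_minus_commute)
    from r(2)[OF this, of w] obtain q where q: "\<And>u. norm u < r \<Longrightarrow> hol_at q (Fin (z + u)) \<and> \<theta> (q (Fin (z + u))) = g (Fin (z + u))"
      "q (Fin z1) = w" using w by auto
    have "is_lift (ball z (min r r')) q" unfolding is_lift_def
    proof
      fix v assume "v \<in> ball z (min r r')"
      then have "norm (v - z) < r" by (simp add: dist_norm norm_minus_commute)
      from q(1)[OF this] show "hol_at q (Fin v) \<and> \<theta> (q (Fin v)) = g (Fin v)" by simp
    qed
    with q(2) show ?thesis by blast
  qed
  moreover have "\<nu> (g (Fin z1)) = 1" if "z1 \<in> ball z (min r r') - {z}" for z1
    using r'(2) that by force
  ultimately show ?thesis using r(1) r'(1) by (intro exI[of _ "min r r'"]) auto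
qed

lemma lift_unique:
  assumes V: "open V" "connected V" "is_lift V q1" "is_lift V q2"
    and z: "z \<in> V" "q1 (Fin z) = q2 (Fin z)" "\<nu> (g (Fin z)) = 1" and v: "v \<in> V"
  shows "q1 (Fin v) = q2 (Fin v)"
proof -
  have "\<forall>\<^sub>F v in nhds z. \<theta> (q1 (Fin v)) = \<theta> (q2 (Fin v))"
    using eventually_nhds_in_open[OF V(1) z(1)] by eventually_elim (use V in \<open>auto simp: is_lift_def\<close>)
  then have e: "\<forall>\<^sub>F u in nhds 0. \<theta> (q1 (param (Fin z) u)) = \<theta> (q2 (param (Fin z) u))"
    using agree_Fin[of "\<theta> \<circ> q1" "\<theta> \<circ> q2" z] by (simp add: agree_def)
  have "agree q1 q2 (Fin z)"
    by (rule lift_agree[OF \<theta> _ _ z(2) _ e])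
      (use V z \<nu>_\<theta>[of "q1 (Fin z)"] in \<open>auto simp: is_lift_def\<close>)
  then show ?thesis
    using identity_connected(1)[OF V(1,2), of q1 q2 z v] V z v by (auto simp: is_lift_def)
qed

lemma open_unramified:
  assumes "open U" "U \<noteq> {}" obtains z where "z \<in> U" "\<nu> (g (Fin z)) = 1"
proof -
  have "infinite U" using assms finite_imp_not_open by blast
  then have "\<not> U \<subseteq> {z. \<nu> (g (Fin z)) \<noteq> 1}" using finite_ramified finite_subset by blast
  then show ?thesis using that by auto
qed

lemma lift_unique_open:
  assumes V: "open V" "connected V" "is_lift V q1" "is_lift V q2"
    and U: "open U" "U \<noteq> {}" "U \<subseteq> V" "\<And>z. z \<in> U \<Longrightarrow> q1 (Fin z) = q2 (Fin z)" and v: "v \<in> V"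
  shows "q1 (Fin v) = q2 (Fin v)"
proof -
  obtain z where "z \<in> U" "\<nu> (g (Fin z)) = 1" using open_unramified[OF U(1,2)] .
  then show ?thesis using lift_unique[OF V, of z v] U v by blast
qed

text \<open>A lift over a disc extends past its boundary circle: near each boundary point it continues
  to a full neighbourhood, and two such continuations agree because their common domain is convex
  and meets the disc.\<close>

lemma lift_extends:
  assumes R: "R > 0" and q: "is_lift (ball a R) q"
  shows "\<exists>R'>R. \<exists>q'. is_lift (ball a R') q' \<and> (\<forall>z\<in>ball a R. q' (Fin z) = q (Fin z))"
proof -
  have "\<exists>r q'. r > 0 \<and> is_lift (ball \<xi> r) q' \<and> (\<forall>z\<in>ball a R \<inter> ball \<xi> r. q' (Fin z) = q (Fin z))" if \<xi>: "\<xi> \<in> sphere a R" for \<xi>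
  proof -
    obtain r where r: "r > 0" "\<And>z1 w. z1 \<in> ball \<xi> r \<Longrightarrow> \<theta> w = g (Fin z1) \<Longrightarrow> \<exists>q. is_lift (ball \<xi> r) q \<and> q (Fin z1) = w"
      "\<And>z1. z1 \<in> ball \<xi> r - {\<xi>} \<Longrightarrow> \<nu> (g (Fin z1)) = 1"
      using local_lifts[of \<xi>] by blast
    define V where "V = ball a R \<inter> ball \<xi> r"
    have V: "open V" "connected V" "V \<subseteq> ball a R" "V \<subseteq> ball \<xi> r"
      unfolding V_def by (auto intro: convex_connected convex_Int)
    have "\<xi> \<in> closure (ball a R)" using \<xi> R by simp
    then have "V \<noteq> {}" unfolding V_def using r(1)
      by (metis closure_iff_nhds_not_empty centre_in_ball open_ball Int_commute order_refl)
    then obtain z1 where z1: "z1 \<in> V" "\<nu> (g (Fin z1)) = 1" using open_unramified V(1) by blast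
    have "z1 \<in> ball \<xi> r" "\<theta> (q (Fin z1)) = g (Fin z1)" using z1(1) q V by (auto simp: is_lift_def)
    then obtain q' where q': "is_lift (ball \<xi> r) q'" "q' (Fin z1) = q (Fin z1)"
      using r(2) by blast
    have lV: "is_lift V q'" "is_lift V q" using q'(1) q V is_lift_subset by blast+
    have "q' (Fin z) = q (Fin z)" if "z \<in> V" for z
      by (rule lift_unique[OF V(1,2) lV z1(1) q'(2) z1(2) that])
    then show ?thesis using r(1) q'(1) V_def by blast
  qed
  then obtain r Q where rQ: "\<And>\<xi>. \<xi> \<in> sphere a R \<Longrightarrow> r \<xi> > 0" "\<And>\<xi>. \<xi> \<in> sphere a R \<Longrightarrow> is_lift (ball \<xi> (r \<xi>)) (Q \<xi>)"
    "\<And>\<xi> z. \<xi> \<in> sphere a R \<Longrightarrow> z \<in> ball a R \<Longrightarrow> z \<in> ball \<xi> (r \<xi>) \<Longrightarrow> Q \<xi> (Fin z) = q (Fin z)"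
    by (metis Int_iff)
  have compat: "Q \<xi> (Fin z) = Q \<xi>' (Fin z)"
    if \<xi>: "\<xi> \<in> sphere a R" "\<xi>' \<in> sphere a R" and z: "z \<in> ball \<xi> (r \<xi>)" "z \<in> ball \<xi>' (r \<xi>')" for \<xi> \<xi>' z
  proof -
    define V where "V = ball \<xi> (r \<xi>) \<inter> ball \<xi>' (r \<xi>')"
    define p where "p = closest_point (cball a R) z"
    have c: "dist (closest_point (cball a R) \<xi>) p \<le> dist \<xi> z" "dist (closest_point (cball a R) \<xi>') p \<le> dist \<xi>' z"
      unfolding p_def using R by (auto intro!: closest_point_lipschitz)
    have "p \<in> V" using c \<xi> z by (simp add: V_def closest_point_self)
    moreover have "p \<in> closure (ball a R)" unfolding p_def using R closest_point_in_set[of "cball a R" z] by auto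
    moreover have V: "open V" "connected V" unfolding V_def by (auto intro: convex_connected convex_Int)
    ultimately have ne: "V \<inter> ball a R \<noteq> {}"
      by (metis closure_iff_nhds_not_empty order_refl Int_commute)
    have op: "open (V \<inter> ball a R)" using V by auto
    have l: "is_lift V (Q \<xi>)" "is_lift V (Q \<xi>')"
      using rQ(2) \<xi> is_lift_subset unfolding V_def by blast+
    have eq: "Q \<xi> (Fin z) = Q \<xi>' (Fin z)" if "z \<in> V \<inter> ball a R" for z
      using that rQ(3)[OF \<xi>(1), of z] rQ(3)[OF \<xi>(2), of z] by (simp add: V_def)
    show ?thesis
    proof (rule lift_unique_open[OF V l op ne])
      show "z \<in> V" using z by (simp add: V_def)
      show "\<And>z. z \<in> V \<inter> ball a R \<Longrightarrow> Q \<xi> (Fin z) = Q \<xi>' (Fin z)" by (rule eq)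
    qed auto
  qed
  define q' where "q' x = (if fin_part x \<in> ball a R then q x
     else Q (SOME \<xi>. \<xi> \<in> sphere a R \<and> fin_part x \<in> ball \<xi> (r \<xi>)) x)" for x
  have q'1: "q' (Fin z) = q (Fin z)" if "z \<in> ball a R" for z using that by (simp add: q'_def)
  have q'2: "q' (Fin z) = Q \<xi> (Fin z)" if "\<xi> \<in> sphere a R" "z \<in> ball \<xi> (r \<xi>)" for z \<xi>
  proof (cases "z \<in> ball a R")
    case True then show ?thesis using q'1 rQ(3) that by simp
  next
    case False
    define \<xi>' where "\<xi>' = (SOME \<xi>. \<xi> \<in> sphere a R \<and> z \<in> ball \<xi> (r \<xi>))"
    have "\<xi>' \<in> sphere a R \<and> z \<in> ball \<xi>' (r \<xi>')"
      using someI[of "\<lambda>\<xi>. \<xi> \<in> sphere a R \<and> z \<in> ball \<xi> (r \<xi>)" \<xi>] that unfolding \<xi>'_def by blast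
    moreover have "q' (Fin z) = Q \<xi>' (Fin z)" using False by (simp add: q'_def \<xi>'_def)
    ultimately show ?thesis using compat that by metis
  qed
  define U where "U = ball a R \<union> (\<Union>\<xi>\<in>sphere a R. ball \<xi> (r \<xi>))"
  have lift: "is_lift U q'"
    unfolding is_lift_def
  proof
    fix z assume "z \<in> U"
    then consider "z \<in> ball a R" | \<xi> where "\<xi> \<in> sphere a R" "z \<in> ball \<xi> (r \<xi>)" unfolding U_def by blast
    then show "hol_at q' (Fin z) \<and> \<theta> (q' (Fin z)) = g (Fin z)"
    proof cases
      case 1
      then have "hol_at q' (Fin z)" by (rule hol_at_cong_open[OF open_ball]) (use q'1 q 1 in \<open>auto simp: is_lift_def\<close>)
      then show ?thesis using q q'1[OF 1] 1 by (simp add: is_lift_def)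
    next
      case 2
      have "hol_at q' (Fin z)"
        by (rule hol_at_cong_open[of "ball \<xi> (r \<xi>)" z q' "Q \<xi>"])
          (use rQ(2)[OF 2(1)] 2 q'2[OF 2(1)] in \<open>auto simp: is_lift_def\<close>)
      then show ?thesis using rQ(2)[OF 2(1)] q'2[OF 2] 2 by (simp add: is_lift_def)
    qed
  qed
  have "cball a R \<subseteq> U"
  proof
    fix z assume "z \<in> cball a R"
    then consider "z \<in> ball a R" | "z \<in> sphere a R" by fastforce
    then show "z \<in> U"
    proof cases
      case 2
      then have "z \<in> ball z (r z)" using rQ(1) by simp
      with 2 show ?thesis unfolding U_def by blast
    qed (simp add: U_def)
  qed
  moreover have "open U" unfolding U_def by auto
  ultimately obtain e where e: "e > 0" "(\<Union>x\<in>cball a R. ball x e) \<subseteq> U"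
    using compact_subset_open_imp_ball_epsilon_subset[OF compact_cball] by metis
  have "ball a (R + e) \<subseteq> U"
  proof
    fix y assume y: "y \<in> ball a (R + e)"
    show "y \<in> U"
    proof (cases "y \<in> cball a R")
      case True then show ?thesis using \<open>cball a R \<subseteq> U\<close> by blast
    next
      case False
      then have d: "dist a y > R" by simp
      define x where "x = a + (R / dist a y) *\<^sub>R (y - a)"
      have "a \<noteq> y" using d R by auto
      then have "dist a x = R" using d R by (simp add: x_def dist_norm norm_minus_commute)
      have "y - x = (1 - R / dist a y) *\<^sub>R (y - a)" by (simp add: x_def algebra_simps)
      then have "norm (y - x) = (1 - R / dist a y) * dist a y"
        using d R by (simp add: dist_norm norm_minus_commute divide_le_eq_1)
      also have "\<dots> = dist a y - R" using d R by (auto simp: field_simps)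
      finally have "dist x y < e" using y by (simp add: dist_norm norm_minus_commute)
      then show ?thesis using e(2) \<open>dist a x = R\<close> by (intro subsetD[OF e(2)]) auto
    qed
  qed
  then have "is_lift (ball a (R + e)) q'" using lift is_lift_subset by blast
  then show ?thesis using q'1 e(1) by (intro exI[of _ "R + e"]) auto
qed

lemma plane_lift:
  assumes w: "\<theta> w = g (Fin a)"
  shows "\<exists>q. is_lift UNIV q \<and> q (Fin a) = w"
proof -
  obtain r0 q0 where r0: "r0 > 0" "is_lift (ball a r0) q0" "q0 (Fin a) = w"
    using local_lifts[of a] w by (metis centre_in_ball)
  define A where "A = {r. r > 0 \<and> (\<exists>q. is_lift (ball a r) q \<and> (\<forall>z\<in>ball a (min r r0). q (Fin z) = q0 (Fin z)))}"
  have "r0 \<in> A" using r0 by (auto simp: A_def)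
  have "\<forall>r\<in>A. \<exists>q. is_lift (ball a r) q \<and> (\<forall>z\<in>ball a (min r r0). q (Fin z) = q0 (Fin z))"
    by (simp add: A_def)
  from bchoice[OF this] obtain Q where Q: "\<And>r. r \<in> A \<Longrightarrow> is_lift (ball a r) (Q r)"
      "\<And>r z. r \<in> A \<Longrightarrow> z \<in> ball a (min r r0) \<Longrightarrow> Q r (Fin z) = q0 (Fin z)" by blast
  have pos: "r > 0" if "r \<in> A" for r using that by (simp add: A_def)
  have compat: "Q r (Fin z) = Q r' (Fin z)" if "r \<in> A" "r' \<in> A" "z \<in> ball a r" "z \<in> ball a r'" for r r' z
  proof -
    define s where "s = min r r'"
    show ?thesis
    proof (rule lift_unique_open[OF open_ball connected_ball])
      show "is_lift (ball a s) (Q r)"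
        by (rule is_lift_subset[OF Q(1)[OF \<open>r \<in> A\<close>]]) (auto simp: s_def)
      show "is_lift (ball a s) (Q r')"
        by (rule is_lift_subset[OF Q(1)[OF \<open>r' \<in> A\<close>]]) (auto simp: s_def)
      show "ball a (min s r0) \<noteq> {}" using pos[OF \<open>r \<in> A\<close>] pos[OF \<open>r' \<in> A\<close>] r0(1) by (simp add: s_def)
      show "ball a (min s r0) \<subseteq> ball a s" by (auto simp: s_def)
      show "Q r (Fin z) = Q r' (Fin z)" if "z \<in> ball a (min s r0)" for z
        using Q(2)[OF \<open>r \<in> A\<close>, of z] Q(2)[OF \<open>r' \<in> A\<close>, of z] that by (simp add: s_def)
    qed (use that in \<open>auto simp: s_def\<close>)
  qed
  define q where "q x = Q (SOME r. r \<in> A \<and> fin_part x \<in> ball a r) x" for x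
  have qQ: "q (Fin z) = Q r (Fin z)" if "r \<in> A" "z \<in> ball a r" for r z
  proof -
    define r' where "r' = (SOME r. r \<in> A \<and> z \<in> ball a r)"
    have "r' \<in> A \<and> z \<in> ball a r'"
      using someI[of "\<lambda>r. r \<in> A \<and> z \<in> ball a r" r] that unfolding r'_def by blast
    moreover have "q (Fin z) = Q r' (Fin z)" by (simp add: q_def r'_def)
    ultimately show ?thesis using compat that by metis
  qed
  define U where "U = (\<Union>r\<in>A. ball a r)"
  have qU: "is_lift U q"
    unfolding is_lift_def
  proof
    fix z assume "z \<in> U"
    then obtain r where r: "r \<in> A" "z \<in> ball a r" by (auto simp: U_def)
    have "hol_at q (Fin z)"
      by (rule hol_at_cong_open[of "ball a r" z q "Q r"])
        (use Q(1)[OF r(1)] r qQ[OF r(1)] in \<open>auto simp: is_lift_def\<close>)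
    then show "hol_at q (Fin z) \<and> \<theta> (q (Fin z)) = g (Fin z)" using Q(1)[OF r(1)] qQ[OF r] r by (simp add: is_lift_def)
  qed
  have q0: "q (Fin z) = q0 (Fin z)" if "z \<in> ball a r0" for z
    using qQ[OF \<open>r0 \<in> A\<close>, of z] Q(2)[OF \<open>r0 \<in> A\<close>, of z] that by simp
  have "U = UNIV"
  proof (cases "bdd_above A")
    case True
    define R where "R = Sup A"
    have "r0 \<le> R" unfolding R_def using True \<open>r0 \<in> A\<close> by (rule cSup_upper[rotated])
    then have "R > 0" using r0 by simp
    have "ball a R \<subseteq> U"
    proof
      fix z assume "z \<in> ball a R"
      then have "dist a z < Sup A" by (simp add: R_def)
      then obtain r where "r \<in> A" "dist a z < r" using True \<open>r0 \<in> A\<close> by (metis empty_iff less_cSupD)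
      then show "z \<in> U" by (auto simp: U_def)
    qed
    then have "is_lift (ball a R) q" using qU is_lift_subset by blast
    from lift_extends[OF \<open>R > 0\<close> this] obtain R' q' where R': "R' > R" "is_lift (ball a R') q'" "\<And>z. z \<in> ball a R \<Longrightarrow> q' (Fin z) = q (Fin z)"
      by blast
    have "R' \<in> A" unfolding A_def using R' \<open>R > 0\<close> q0 \<open>r0 \<le> R\<close> by (auto intro!: exI[of _ q'])
    then have "R' \<le> R" unfolding R_def using True by (rule cSup_upper)
    then show ?thesis using R' by simp
  next
    case False
    then have "\<exists>r\<in>A. norm (z - a) < r" for z by (metis bdd_above.I linorder_not_less)
    then show ?thesis by (auto simp: U_def dist_norm norm_minus_commute)
  qed
  moreover have "q (Fin a) = w" using q0[of a] r0 by simp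
  ultimately show ?thesis using qU by auto
qed

end

lemma lift_rational_aux:
  assumes \<theta>: "rational_function \<theta>" and g: "rational_function g"
    and q: "\<And>z. hol_at q (Fin z)" "\<And>z. \<theta> (q (Fin z)) = g (Fin z)" and ne: "\<theta> Infty \<noteq> g Infty"
  shows "\<exists>q'. rational_function q' \<and> \<theta> \<circ> q' = g \<and> (\<forall>z. q' (Fin z) = q (Fin z))"
proof -
  obtain \<epsilon> where \<epsilon>: "\<epsilon> > 0" "\<And>v s. norm v < \<epsilon> \<Longrightarrow> norm s < \<epsilon> \<Longrightarrow> \<theta> (param Infty v) \<noteq> param (g Infty) s"
    using separated_ball[OF rational_hol[OF \<theta>] ne] by blast
  obtain h where h: "germ g Infty h" using rational_hol[OF g] by (auto simp: hol_at_def)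
  have "\<forall>\<^sub>F u in nhds 0. norm (h u) < \<epsilon>"
    using order_tendstoD(2)[OF tendsto_norm[OF germ_tendsto[OF h]], of \<epsilon>] \<epsilon>(1) by simp
  moreover have "\<forall>\<^sub>F u in nhds 0. g (param Infty u) = param (g Infty) (h u)" using h by (simp add: germ_def)
  ultimately have "\<forall>\<^sub>F u in nhds 0. u \<noteq> 0 \<longrightarrow> (\<forall>v. norm v < \<epsilon> \<longrightarrow> q (param Infty u) \<noteq> param Infty v)"
  proof eventually_elim
    case (elim u)
    show ?case
    proof (intro impI allI notI)
      fix v assume "u \<noteq> 0" "norm v < \<epsilon>" "q (param Infty u) = param Infty v"
      then have "\<theta> (param Infty v) = param (g Infty) (h u)" using q(2)[of "1/u"] elim by simp
      then show False using \<epsilon>(2)[OF \<open>norm v < \<epsilon>\<close> elim(1)] by blast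
    qed
  qed
  then obtain r where r: "r > 0"
      "\<And>u. norm u < r \<Longrightarrow> u \<noteq> 0 \<longrightarrow> (\<forall>v. norm v < \<epsilon> \<longrightarrow> q (param Infty u) \<noteq> param Infty v)"
    by (auto simp: eventually_nhds_metric dist_norm simp del: param.simps)
  have r2: "q (Fin (1/u)) \<noteq> param Infty v" if "norm u < r" "u \<noteq> 0" "norm v < \<epsilon>" for u v :: complex
    using r(2)[OF that(1)] that(2,3) by (simp del: param.simps) (simp add: that(2))
  define F where "F u = fin_part (q (Fin (1/u)))" for u
  have F: "q (Fin (1/u)) = Fin (F u)" if "norm u < r" "u \<noteq> 0" for u :: complex
    using r2[OF that, of 0] \<epsilon>(1) by (cases "q (Fin (1/u))") (auto simp: F_def)
  have Fb: "norm (F u) \<le> 1 / \<epsilon>" if "norm u < r" "u \<noteq> 0" for u :: complex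
  proof (rule ccontr)
    assume "\<not> norm (F u) \<le> 1 / \<epsilon>"
    then have "1 / \<epsilon> < norm (F u)" by simp
    moreover have "0 < 1 / \<epsilon>" using \<epsilon>(1) by simp
    ultimately have "F u \<noteq> 0" by auto
    moreover have "1 < \<epsilon> * norm (F u)" using \<open>1 / \<epsilon> < norm (F u)\<close> \<epsilon>(1) by (simp add: field_simps)
    ultimately have "norm (1 / F u) < \<epsilon>" by (simp add: norm_divide divide_less_eq)
    then show False using r2[OF that, of "1 / F u"] F[OF that] \<open>F u \<noteq> 0\<close> by simp
  qed
  have "F holomorphic_on ball 0 r - {0}"
  proof (rule analytic_imp_holomorphic, subst analytic_on_analytic_at, intro ballI)
    fix u :: complex assume "u \<in> ball 0 r - {0}"
    then have u: "u \<in> ball 0 r" "u \<noteq> 0" by auto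
    have "(\<lambda>z. fin_part (q (Fin z))) analytic_on {1/u}"
      using fin_part_analytic[OF q(1), of "1/u"] F[of u] u by simp
    then have "((\<lambda>z. fin_part (q (Fin z))) \<circ> (\<lambda>u. 1 / u)) analytic_on {u}"
      using u by (intro analytic_on_compose analytic_intros) auto
    then show "F analytic_on {u}" by (simp add: F_def[abs_def] o_def)
  qed
  moreover have "\<exists>B. \<forall>\<^sub>F u in at 0. norm (F u) \<le> B"
    using r(1) Fb by (intro exI[of _ "1 / \<epsilon>"]) (auto simp: eventually_at dist_norm)
  moreover have "0 \<in> interior (ball 0 r)" using r(1) by simp
  ultimately obtain G where G: "G holomorphic_on ball 0 r" "\<And>u. u \<in> ball 0 r - {0} \<Longrightarrow> G u = F u"
    using holomorphic_on_extend_bounded[of F "ball 0 r" 0] by blast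
  define q' where "q' = (\<lambda>x. case x of Fin z \<Rightarrow> q (Fin z) | Infty \<Rightarrow> Fin (G 0))"
  have [simp]: "q' (Fin z) = q (Fin z)" "q' Infty = Fin (G 0)" for z by (simp_all add: q'_def)
  have hol: "hol_at q' z" for z
  proof (cases z)
    case (Fin a) then show ?thesis using hol_at_cong_open[OF open_UNIV _ _ q(1), of a q'] by simp
  next
    case Infty
    have "hol_at q' (param Infty 0)"
    proof (rule hol_at_chartI)
      show "G analytic_on {0}" using G(1) r(1) by (auto simp: analytic_on_def)
      have "\<forall>\<^sub>F u in nhds 0. u \<in> ball 0 r" using r(1) by (intro eventually_nhds_in_open) auto
      then show "\<forall>\<^sub>F u in nhds 0. q' (param Infty u) = param (Fin 0) (G u)"
        by eventually_elim (use F G(2) in auto)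
    qed
    then show ?thesis using Infty by simp
  qed
  have "\<theta> \<circ> q' = g"
  proof
    fix z
    have "hol_at (\<theta> \<circ> q') z" "hol_at g z" by (intro hol_at_compose hol rational_hol \<theta> g)+
    moreover have "\<forall>\<^sub>F u in at 0. (\<theta> \<circ> q') (param Infty u) = g (param Infty u)"
      using q(2) by (auto simp: eventually_at_filter)
    ultimately show "(\<theta> \<circ> q') z = g z" using q(2) hol_at_eqI[of "\<theta> \<circ> q'" Infty g] by (cases z) auto
  qed
  moreover have "q' \<noteq> (\<lambda>_. c)" for c
    using \<open>\<theta> \<circ> q' = g\<close> rational_not_const[OF g, of "\<theta> c"] by auto
  then have "rational_function q'" using hol by (intro rational_functionI)
  ultimately show ?thesis by auto
qed

lemma lift_rational:
  assumes \<theta>: "rational_function \<theta>" and g: "rational_function g"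
    and q: "\<And>z. hol_at q (Fin z)" "\<And>z. \<theta> (q (Fin z)) = g (Fin z)"
  shows "\<exists>q'. rational_function q' \<and> \<theta> \<circ> q' = g \<and> (\<forall>z. q' (Fin z) = q (Fin z))"
proof -
  obtain w0 where w0: "\<theta> w0 \<noteq> g Infty" using rational_surj[OF \<theta>] by (metis riemann_sphere.distinct(1))
  obtain \<mu> where \<mu>: "mobius \<mu>" "\<mu> w0 = Infty" using mobius_to_Infty by blast
  note inv = mobius_inv[OF \<mu>(1)]
  have inv': "inv \<mu> (\<mu> x) = x" "\<mu> (inv \<mu> x) = x" for x using inv by (auto simp: fun_eq_iff)
  have "\<exists>q'. rational_function q' \<and> (\<theta> \<circ> inv \<mu>) \<circ> q' = g \<and> (\<forall>z. q' (Fin z) = (\<mu> \<circ> q) (Fin z))"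
  proof (rule lift_rational_aux)
    show "rational_function (\<theta> \<circ> inv \<mu>)" by (intro rational_compose \<theta> mobius_rational inv)
    show "hol_at (\<mu> \<circ> q) (Fin z)" for z by (intro hol_at_compose q rational_hol mobius_rational \<mu>)
    show "(\<theta> \<circ> inv \<mu>) Infty \<noteq> g Infty" using w0 inv'(1)[of w0] \<mu>(2) by simp
  qed (use g q inv' in auto)
  then obtain q' where q': "rational_function q'" "(\<theta> \<circ> inv \<mu>) \<circ> q' = g" "\<And>z. q' (Fin z) = \<mu> (q (Fin z))" by auto
  have "rational_function (inv \<mu> \<circ> q')" by (intro rational_compose q' mobius_rational inv)
  then show ?thesis using q' inv' by (intro exI[of _ "inv \<mu> \<circ> q'"]) (auto simp: o_assoc)
qed

theorem rational_lift_Fin: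
  assumes \<theta>: "universal_covering \<nu> \<theta>" and g: "rational_function g"
    and dvd: "\<And>z. \<nu> (g (Fin z)) dvd local_degree g (Fin z)" and w: "\<theta> w = g (Fin a)"
  shows "\<exists>q. rational_function q \<and> \<theta> \<circ> q = g \<and> q (Fin a) = w"
proof -
  interpret L: lifting \<theta> g \<nu>
    by unfold_locales (use \<theta> g dvd in \<open>auto simp: universal_covering_def orbifold_covering_def\<close>)
  obtain q where q: "L.is_lift UNIV q" "q (Fin a) = w" using L.plane_lift[OF w] by blast
  then obtain q' where "rational_function q'" "\<theta> \<circ> q' = g" "\<forall>z. q' (Fin z) = q (Fin z)"
    using lift_rational[OF L.\<theta> L.g, of q] by (auto simp: L.is_lift_def)
  then show ?thesis using q(2) by (intro exI[of _ q']) simp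
qed

section \<open>Factorisation and multipliers\<close>

lemma compose_mobius_local_degree:
  "rational_function f \<Longrightarrow> mobius \<sigma> \<Longrightarrow> local_degree (f \<circ> \<sigma>) z = local_degree f (\<sigma> z)"
  by (simp add: local_degree_compose mobius_rational mobius_local_degree)

theorem rational_lift:
  assumes \<theta>: "universal_covering \<nu> \<theta>" and g: "rational_function g"
    and dvd: "\<And>z. \<nu> (g z) dvd local_degree g z" and w: "\<theta> w = g x"
  shows "\<exists>q. rational_function q \<and> \<theta> \<circ> q = g \<and> q x = w"
proof (cases x)
  case (Fin a) then show ?thesis using rational_lift_Fin[OF \<theta> g dvd] w by simp
next
  case Infty
  obtain \<mu> where \<mu>: "mobius \<mu>" "\<mu> (Fin 0) = Infty" using mobius_to_Infty by blast
  note inv = mobius_inv[OF \<mu>(1)]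
  have "\<exists>q. rational_function q \<and> \<theta> \<circ> q = g \<circ> \<mu> \<and> q (Fin 0) = w"
  proof (rule rational_lift_Fin[OF \<theta>])
    show "rational_function (g \<circ> \<mu>)" by (intro rational_compose g mobius_rational \<mu>)
    show "\<nu> ((g \<circ> \<mu>) (Fin z)) dvd local_degree (g \<circ> \<mu>) (Fin z)" for z
      using dvd by (simp add: compose_mobius_local_degree[OF g \<mu>(1)])
    show "\<theta> w = (g \<circ> \<mu>) (Fin 0)" using w Infty \<mu>(2) by simp
  qed
  then obtain q where q: "rational_function q" "\<theta> \<circ> q = g \<circ> \<mu>" "q (Fin 0) = w" by blast
  have "rational_function (q \<circ> inv \<mu>)" by (intro rational_compose q mobius_rational inv)
  moreover have "\<theta> \<circ> (q \<circ> inv \<mu>) = g"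
    unfolding comp_assoc[symmetric] q(2) using inv(2) by (simp add: comp_assoc fun_eq_iff)
  moreover have "inv \<mu> Infty = Fin 0" using \<mu>(2) inv(3) by (metis comp_apply)
  ultimately show ?thesis using q(3) Infty by (intro exI[of _ "q \<circ> inv \<mu>"]) simp
qed

lemma lift_unique_sphere:
  assumes "rational_function \<theta>" "rational_function q1" "rational_function q2"
    and "\<theta> \<circ> q1 = \<theta> \<circ> q2" "q1 a = q2 a" "local_degree \<theta> (q1 a) = 1"
  shows "q1 = q2"
proof (rule identity_sphere)
  show "agree q1 q2 a"
    by (rule lift_agree[OF assms(1)]) (use assms in \<open>auto simp: rational_hol fun_eq_iff\<close>)
qed (use assms rational_hol in auto)

lemma eventually_param_notin:
  assumes "finite A" shows "\<forall>\<^sub>F u in at 0. param z u \<notin> A"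
proof -
  have "finite (param z -` A)" using assms by (intro finite_vimageI injI) simp_all
  then have "\<not> 0 islimpt (param z -` A)" by (rule islimpt_finite)
  then show ?thesis by (simp add: islimpt_iff_eventually)
qed

lemma eq_cofinite:
  assumes "\<And>z. hol_at f z" "\<And>z. hol_at g z" "finite {z. f z \<noteq> g z}"
  shows "f = g"
proof
  fix z
  have "\<forall>\<^sub>F u in at 0. f (param z u) = g (param z u)"
    using eventually_param_notin[OF assms(3), of z] by simp
  then show "f z = g z" using hol_at_eqI assms by blast
qed

lemma finite_fixed_points:
  assumes "rational_function \<sigma>" "\<sigma> \<noteq> (\<lambda>x. x)" shows "finite {z. \<sigma> z = z}"
proof (rule sphere_finite)
  fix z
  have "\<not> agree \<sigma> (\<lambda>x. x) z"
    using identity_sphere[of \<sigma> "\<lambda>x. x" z] assms rational_hol hol_at_id by blast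
  then show "\<forall>\<^sub>F u in at 0. \<sigma> (param z u) \<noteq> param z u"
    using hol_at_dichotomy[OF rational_hol[OF assms(1)] hol_at_id, of z] by (simp add: agree_def)
qed

lemma local_section:
  assumes f: "rational_function f"
  shows "\<exists>\<kappa>. \<kappa> analytic_on {0} \<and> \<kappa> 0 = 0 \<and> ord_at \<kappa> 1 \<and>
     (\<forall>\<^sub>F v in nhds 0. f (param z (\<kappa> v)) = param (f z) (v ^ local_degree f z))"
proof -
  define n where "n = local_degree f z"
  obtain \<phi> where \<phi>: "\<phi> analytic_on {0}" "\<phi> 0 = 0" "ord_at \<phi> 1" "germ f z (\<lambda>u. \<phi> u ^ n)"
    using rational_normal_form[OF f, of z] n_def by auto
  obtain \<kappa> where \<kappa>: "\<kappa> analytic_on {0}" "\<kappa> 0 = 0" "ord_at \<kappa> 1" "\<forall>\<^sub>F v in nhds 0. \<phi> (\<kappa> v) = v"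
    using local_inverse[OF \<phi>(1-3)] by blast
  have "\<forall>\<^sub>F u in nhds 0. f (param z u) = param (f z) (\<phi> u ^ n)" using \<phi>(4) by (simp add: germ_def)
  moreover have "(\<kappa> \<longlongrightarrow> 0) (nhds 0)" using analytic_tendsto_nhds[OF \<kappa>(1)] \<kappa>(2) by simp
  ultimately have "\<forall>\<^sub>F v in nhds 0. f (param z (\<kappa> v)) = param (f z) (\<phi> (\<kappa> v) ^ n)"
    by (rule eventually_compose_filterlim)
  with \<kappa>(4) have "\<forall>\<^sub>F v in nhds 0. f (param z (\<kappa> v)) = param (f z) (v ^ n)" by eventually_elim simp
  then show ?thesis using \<kappa> n_def by blast
qed

lemma tendsto_root:
  assumes "n \<ge> 1"
  shows "\<exists>\<rho>. (\<forall>s. \<rho> s ^ n = (s::complex)) \<and> (\<rho> \<longlongrightarrow> 0) (nhds 0)"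
proof -
  have "\<exists>r. r ^ n = (s::complex)" for s
    using assms by (intro exI[of _ "if s = 0 then 0 else exp (Ln s / n)"])
      (auto simp: power_0_left simp flip: exp_of_nat_mult)
  then obtain \<rho> where \<rho>: "\<And>s. \<rho> s ^ n = (s::complex)" by metis
  have eq: "norm (\<rho> s) = root n (norm s)" for s
    using \<rho>[of s] assms by (metis norm_power norm_ge_zero real_root_power_cancel less_le_trans zero_less_one)
  have "((\<lambda>s::complex. norm s) \<longlongrightarrow> norm (0::complex)) (nhds 0)"
    by (intro tendsto_norm filterlim_ident)
  from tendsto_real_root[OF this, of n] have "((\<lambda>s. norm (\<rho> s)) \<longlongrightarrow> 0) (nhds 0)"
    using assms by (simp add: eq)
  then have "(\<rho> \<longlongrightarrow> 0) (nhds 0)" by (rule tendsto_norm_zero_cancel)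
  then show ?thesis using \<rho> by blast
qed

lemma rational_open_at:
  assumes f: "rational_function f" and e: "\<epsilon> > 0"
  shows "\<forall>\<^sub>F s in nhds 0. \<exists>v. norm v < \<epsilon> \<and> f (param z v) = param (f z) s"
proof -
  obtain \<kappa> where \<kappa>: "\<kappa> analytic_on {0}" "\<kappa> 0 = 0"
     "\<forall>\<^sub>F v in nhds 0. f (param z (\<kappa> v)) = param (f z) (v ^ local_degree f z)"
    using local_section[OF f] by blast
  obtain \<rho> :: "complex \<Rightarrow> complex" where \<rho>: "\<And>s. \<rho> s ^ local_degree f z = s" "(\<rho> \<longlongrightarrow> 0) (nhds 0)"
    using tendsto_root[OF local_degree_pos[OF f, of z]] by blast
  have "\<forall>\<^sub>F v in nhds 0. norm (\<kappa> v) < \<epsilon>"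
    using order_tendstoD(2)[OF tendsto_norm[OF analytic_tendsto_nhds[OF \<kappa>(1)]], of \<epsilon>] \<kappa>(2) e by simp
  with \<kappa>(3) have "\<forall>\<^sub>F v in nhds 0. norm (\<kappa> v) < \<epsilon> \<and> f (param z (\<kappa> v)) = param (f z) (v ^ local_degree f z)"
    by eventually_elim simp
  from eventually_compose_filterlim[OF this \<rho>(2)] show ?thesis
    by eventually_elim (use \<rho>(1) in auto)
qed

theorem rational_factor:
  assumes \<psi>: "rational_function \<psi>" and h: "rational_function h"
    and const: "\<And>x y. \<psi> x = \<psi> y \<Longrightarrow> h x = h y"
  shows "\<exists>w. rational_function w \<and> h = w \<circ> \<psi>"
proof -
  define w where "w c = h (SOME z. \<psi> z = c)" for c
  have w: "w (\<psi> z) = h z" for z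
    unfolding w_def by (rule const) (rule someI[of "\<lambda>y. \<psi> y = \<psi> z" z], simp)
  have hol1: "hol_at w (\<psi> x)" if d: "local_degree \<psi> x = 1" for x
  proof -
    obtain \<kappa> where \<kappa>: "\<kappa> analytic_on {0}" "\<kappa> 0 = 0"
        "\<forall>\<^sub>F v in nhds 0. \<psi> (param x (\<kappa> v)) = param (\<psi> x) v"
      using local_section[OF \<psi>, of x] unfolding d by auto
    obtain k where k: "germ h x k" using rational_hol[OF h] by (auto simp: hol_at_def)
    have "(\<kappa> \<longlongrightarrow> 0) (nhds 0)" using analytic_tendsto_nhds[OF \<kappa>(1)] \<kappa>(2) by simp
    then have "\<forall>\<^sub>F v in nhds 0. h (param x (\<kappa> v)) = param (h x) (k (\<kappa> v))"
      using k by (auto simp: germ_def intro: eventually_compose_filterlim)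
    with \<kappa>(3) have "\<forall>\<^sub>F v in nhds 0. w (param (\<psi> x) v) = param (w (\<psi> x)) ((k \<circ> \<kappa>) v)"
      by eventually_elim (metis w comp_apply)
    moreover have "(k \<circ> \<kappa>) analytic_on {0}" by (rule analytic_on_compose) (use \<kappa> k in \<open>auto simp: germ_def\<close>)
    ultimately show ?thesis unfolding hol_at_def germ_def using \<kappa>(2) k by (auto simp: germ_def intro!: exI[of _ "k \<circ> \<kappa>"])
  qed
  have hol: "hol_at w c" for c
  proof -
    obtain x where x: "\<psi> x = c" using rational_surj[OF \<psi>] by blast
    define n where "n = local_degree \<psi> x"
    obtain \<kappa> where \<kappa>: "\<kappa> analytic_on {0}" "\<kappa> 0 = 0"
       "\<forall>\<^sub>F v in nhds 0. \<psi> (param x (\<kappa> v)) = param c (v ^ n)"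
      using local_section[OF \<psi>, of x] x n_def by blast
    obtain \<rho> :: "complex \<Rightarrow> complex" where \<rho>: "\<And>s. \<rho> s ^ n = s" "(\<rho> \<longlongrightarrow> 0) (nhds 0)"
      using tendsto_root[OF local_degree_pos[OF \<psi>, of x]] unfolding n_def by blast
    have n0: "n \<noteq> 0" using local_degree_pos[OF \<psi>, of x] by (simp add: n_def)
    obtain k where k: "germ h x k" using rational_hol[OF h] by (auto simp: hol_at_def)
    have \<kappa>l: "(\<kappa> \<longlongrightarrow> 0) (nhds 0)" using analytic_tendsto_nhds[OF \<kappa>(1)] \<kappa>(2) by simp
    then have "\<forall>\<^sub>F v in nhds 0. h (param x (\<kappa> v)) = param (h x) (k (\<kappa> v))"
      using k by (auto simp: germ_def intro: eventually_compose_filterlim)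
    with \<kappa>(3) have e: "\<forall>\<^sub>F v in nhds 0. w (param c (v ^ n)) = param (h x) (k (\<kappa> v))"
      by eventually_elim (metis w)
    define W where "W s = k (\<kappa> (\<rho> s))" for s
    have We: "\<forall>\<^sub>F s in nhds 0. w (param c s) = param (h x) (W s)"
      using eventually_compose_filterlim[OF e \<rho>(2)] by (simp add: \<rho>(1) W_def)
    have \<rho>0: "\<rho> 0 = 0" using \<rho>(1)[of 0] n0 by simp
    have W0: "W 0 = 0" using k \<kappa>(2) by (simp add: W_def \<rho>0 germ_def)
    have Wl: "(W \<longlongrightarrow> W 0) (nhds 0)"
      unfolding W0 unfolding W_def
      by (rule filterlim_compose[OF germ_tendsto[OF k] filterlim_compose[OF \<kappa>l \<rho>(2)]])
    have "\<forall>\<^sub>F s in at 0. param c s \<notin> \<psi> ` {y. local_degree \<psi> y > 1}"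
      using rational_riemann_hurwitz(1)[OF \<psi>] by (intro eventually_param_notin finite_imageI)
    moreover have "hol_at w c'" if "c' \<notin> \<psi> ` {y. local_degree \<psi> y > 1}" for c'
    proof -
      obtain y where y: "\<psi> y = c'" using rational_surj[OF \<psi>] by blast
      then have "local_degree \<psi> y = 1" using that local_degree_pos[OF \<psi>, of y] by force
      then show ?thesis using hol1 y by blast
    qed
    ultimately have "\<forall>\<^sub>F s in at 0. hol_at w (param c s)" by (auto elim: eventually_mono)
    then have "\<forall>\<^sub>F s in nhds 0. s \<noteq> 0 \<longrightarrow> hol_at w (param c s)" by (simp add: eventually_at_filter)
    moreover have "\<forall>\<^sub>F s in nhds 0. \<forall>\<^sub>F s' in nhds s. w (param c s') = param (h x) (W s')"
      using We by (simp add: eventually_eventually)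
    ultimately have "\<forall>\<^sub>F s in nhds 0. s \<noteq> 0 \<longrightarrow> W analytic_on {s}"
    proof eventually_elim
      case (elim s)
      show ?case
      proof
        assume "s \<noteq> 0"
        obtain V where V: "V analytic_on {s}" "\<forall>\<^sub>F v in nhds s. w (param c v) = param (h x) (V v)"
          using hol_at_chartE[of w c s "h x" "W s"] elim \<open>s \<noteq> 0\<close> eventually_nhds_x_imp_x[OF elim(2)] by blast
        from V(2) elim(2) have "\<forall>\<^sub>F v in nhds s. V v = W v" by eventually_elim simp
        then show "W analytic_on {s}" using V(1) analytic_at_cong by blast
      qed
    qed
    then obtain r where r: "r > 0" "\<And>s. norm s < r \<Longrightarrow> s \<noteq> 0 \<Longrightarrow> W analytic_on {s}"
      by (auto simp: eventually_nhds_metric dist_norm)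
    have "W holomorphic_on ball 0 r"
    proof (rule no_isolated_singularity'[of "{0}"])
      show "(W \<longlongrightarrow> W z) (at z within ball 0 r)" if "z \<in> {0}" for z
        using that Wl tendsto_mono[OF order.trans[OF at_le[OF subset_UNIV] at_le_nhds]] by blast
      show "W holomorphic_on ball 0 r - {0}"
        by (rule analytic_imp_holomorphic, subst analytic_on_analytic_at) (use r in auto)
    qed auto
    then have "W analytic_on {0}" using r(1) by (auto simp: analytic_on_def)
    then have "hol_at w (param c 0)" by (rule hol_at_chartI) (rule We)
    then show ?thesis by simp
  qed
  have "h = w \<circ> \<psi>" using w by auto
  moreover have "w \<noteq> (\<lambda>_. c)" for c using calculation rational_not_const[OF h, of c] by (auto simp: o_def)
  ultimately show ?thesis using rational_functionI[of w] hol by blast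
qed

definition multiplier :: "(riemann_sphere \<Rightarrow> riemann_sphere) \<Rightarrow> riemann_sphere \<Rightarrow> complex \<Rightarrow> bool" where
  "multiplier \<sigma> z c \<longleftrightarrow> \<sigma> z = z \<and> (\<exists>t. t analytic_on {0} \<and> t 0 = c \<and> germ \<sigma> z (\<lambda>u. u * t u))"

lemma germ_cong: "germ f z h \<Longrightarrow> \<forall>\<^sub>F u in nhds 0. h u = k u \<Longrightarrow> germ f z k"
  unfolding germ_def using analytic_at_cong[of h k 0]
  by (auto elim: eventually_elim2 dest: eventually_nhds_x_imp_x)

lemma multiplierI:
  assumes "germ \<sigma> z h" "ord_at h 1" "\<sigma> z = z" shows "\<exists>c. multiplier \<sigma> z c"
proof -
  obtain t where "t analytic_on {0}" "\<forall>\<^sub>F u in nhds 0. h u = u * t u"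
    using assms(2) by (auto simp: ord_at_def)
  then show ?thesis using germ_cong[OF assms(1)] assms(3) by (auto simp: multiplier_def)
qed

lemma multiplier_exists:
  assumes "mobius \<sigma>" "\<sigma> z = z" shows "\<exists>c. multiplier \<sigma> z c"
proof -
  obtain h n where h: "germ \<sigma> z h" "ord_at h n"
    using rational_germ_ord[OF mobius_rational[OF assms(1)]] by blast
  moreover have "n = 1" using local_degree_eqI[OF h] mobius_local_degree[OF assms(1)] by simp
  ultimately show ?thesis using multiplierI assms(2) by blast
qed

lemma multiplier_id: "multiplier (\<lambda>x. x) z 1"
  unfolding multiplier_def using germ_id[of z] by (auto intro!: exI[of _ "\<lambda>_. 1"])

lemma multiplier_compose:
  assumes "multiplier \<sigma> z c" "multiplier \<tau> z d" shows "multiplier (\<sigma> \<circ> \<tau>) z (c * d)"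
proof -
  obtain s where s: "s analytic_on {0}" "s 0 = c" "germ \<sigma> z (\<lambda>u. u * s u)" "\<sigma> z = z"
    using assms(1) by (auto simp: multiplier_def)
  obtain t where t: "t analytic_on {0}" "t 0 = d" "germ \<tau> z (\<lambda>u. u * t u)" "\<tau> z = z"
    using assms(2) by (auto simp: multiplier_def)
  have "germ (\<sigma> \<circ> \<tau>) z ((\<lambda>u. u * s u) \<circ> (\<lambda>u. u * t u))"
    by (rule germ_compose) (use s t in auto)
  moreover have "(s \<circ> (\<lambda>u. u * t u)) analytic_on {0}"
    by (rule analytic_on_compose) (use s t in \<open>auto intro!: analytic_intros\<close>)
  then have "(\<lambda>u. t u * s (u * t u)) analytic_on {0}"
    using t(1) by (auto simp: o_def intro!: analytic_intros)
  ultimately show ?thesis unfolding multiplier_def using s t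
    by (auto simp: o_def mult_ac intro!: exI[of _ "\<lambda>u. t u * s (u * t u)"])
qed

lemma multiplier_funpow: "multiplier \<sigma> z c \<Longrightarrow> multiplier (\<sigma> ^^ j) z (c ^ j)"
proof (induction j)
  case 0 then show ?case using multiplier_id by (simp add: id_def)
next
  case (Suc j) then show ?case
    using multiplier_compose[of \<sigma> z c "\<sigma> ^^ j" "c ^ j"] by (simp only: funpow.simps power_Suc)
qed

lemma multiplier_unique:
  assumes "multiplier \<sigma> z c" "multiplier \<sigma> z d" shows "c = d"
proof -
  obtain s where s: "s analytic_on {0}" "s 0 = c" "germ \<sigma> z (\<lambda>u. u * s u)" "\<sigma> z = z"
    using assms(1) by (auto simp: multiplier_def)
  obtain t where t: "t analytic_on {0}" "t 0 = d" "germ \<sigma> z (\<lambda>u. u * t u)"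
    using assms(2) by (auto simp: multiplier_def)
  have "\<forall>\<^sub>F u in nhds 0. \<sigma> (param z u) = param (\<sigma> z) (u * s u)" "\<forall>\<^sub>F u in nhds 0. \<sigma> (param z u) = param (\<sigma> z) (u * t u)"
    using s t by (auto simp: germ_def)
  then have "\<forall>\<^sub>F u in at 0. s u = t u" unfolding eventually_at_filter by eventually_elim auto
  moreover have "(s \<longlongrightarrow> c) (at 0)"
    using tendsto_mono[OF at_le_nhds analytic_tendsto_nhds[OF s(1)]] s(2) by simp
  ultimately have "(t \<longlongrightarrow> c) (at 0)" by (rule Lim_transform_eventually[rotated])
  moreover have "(t \<longlongrightarrow> d) (at 0)"
    using tendsto_mono[OF at_le_nhds analytic_tendsto_nhds[OF t(1)]] t(2) by simp
  ultimately show ?thesis by (rule tendsto_unique[OF trivial_limit_at])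
qed

lemma multiplier_invariant:
  assumes m: "multiplier \<sigma> z c" and f: "rational_function f" "f \<circ> \<sigma> = f" and s: "rational_function \<sigma>"
  shows "c ^ local_degree f z = 1" "c = 1 \<Longrightarrow> \<sigma> = (\<lambda>x. x)"
proof -
  define n where "n = local_degree f z"
  obtain t where t: "t analytic_on {0}" "t 0 = c" "germ \<sigma> z (\<lambda>u. u * t u)" "\<sigma> z = z"
    using m by (auto simp: multiplier_def)
  obtain \<phi> where \<phi>: "\<phi> analytic_on {0}" "\<phi> 0 = 0" "ord_at \<phi> 1" "germ f z (\<lambda>u. \<phi> u ^ n)"
    using rational_normal_form[OF f(1), of z] n_def by auto
  obtain e where e: "e analytic_on {0}" "e 0 \<noteq> 0" "\<forall>\<^sub>F u in nhds 0. \<phi> u = u * e u"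
    using \<phi>(3) by (auto simp: ord_at_def)
  have sl: "((\<lambda>u. u * t u) \<longlongrightarrow> 0) (nhds 0)" by (rule germ_tendsto[OF t(3)])
  have fe: "\<forall>\<^sub>F u in nhds 0. f (param z u) = param (f z) (\<phi> u ^ n)" using \<phi>(4) by (simp add: germ_def)
  have pw: "\<forall>\<^sub>F u in nhds 0. \<phi> (u * t u) ^ n = \<phi> u ^ n"
  proof -
    have "\<forall>\<^sub>F u in nhds 0. \<sigma> (param z u) = param z (u * t u)" using t by (simp add: germ_def)
    with fe eventually_compose_filterlim[OF fe sl] show ?thesis
      by eventually_elim (metis comp_apply f(2) param_eq_iff)
  qed
  define R where "R u = t u * e (u * t u) / e u" for u
  have el: "(e \<longlongrightarrow> e 0) (nhds 0)" by (rule analytic_tendsto_nhds[OF e(1)])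
  have "(R \<longlongrightarrow> c * e 0 / e 0) (nhds 0)"
    unfolding R_def using e(2) t(2) analytic_tendsto_nhds[OF t(1)]
    by (intro tendsto_intros el filterlim_compose[OF el sl]) auto
  then have Rl: "(R \<longlongrightarrow> c) (at 0)" using e(2) tendsto_mono[OF at_le_nhds] by auto
  have "\<forall>\<^sub>F u in nhds 0. e u \<noteq> 0" using el e(2) by (rule tendsto_imp_eventually_ne)
  with e(3) eventually_compose_filterlim[OF e(3) sl] pw
  have Rn: "\<forall>\<^sub>F u in at 0. R u ^ n = 1 \<and> \<phi> (u * t u) = R u * \<phi> u"
    unfolding eventually_at_filter
  proof eventually_elim
    case (elim u)
    show ?case
    proof (intro impI)
      assume "u \<noteq> 0"
      have 1: "\<phi> (u * t u) = R u * \<phi> u" using elim by (simp add: R_def)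
      have "\<phi> u \<noteq> 0" using elim \<open>u \<noteq> 0\<close> by simp
      then have "R u ^ n = 1" using elim(3) unfolding 1 by (simp add: power_mult_distrib)
      with 1 show "R u ^ n = 1 \<and> \<phi> (u * t u) = R u * \<phi> u" by simp
    qed
  qed
  have "((\<lambda>u. R u ^ n) \<longlongrightarrow> c ^ n) (at 0)" by (intro tendsto_intros Rl)
  moreover have "\<forall>\<^sub>F u in at 0. R u ^ n = 1" using Rn by eventually_elim simp
  then have "((\<lambda>u. R u ^ n) \<longlongrightarrow> 1) (at 0)" by (rule tendsto_eventually)
  ultimately have "c ^ n = 1" using tendsto_unique trivial_limit_at by blast
  then show "c ^ local_degree f z = 1" by (simp add: n_def)
  assume "c = 1"
  have n: "n > 0" using local_degree_pos[OF f(1), of z] by (simp add: n_def)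
  have "finite {\<zeta>::complex. \<zeta> ^ n = 1}" using n by (simp add: finite_roots_unity)
  then have "finite ({\<zeta>::complex. \<zeta> ^ n = 1} - {1})" by simp
  moreover have "\<forall>\<^sub>F u in at 0. R u \<noteq> \<zeta>" if "\<zeta> \<in> {\<zeta>::complex. \<zeta> ^ n = 1} - {1}" for \<zeta>
    using Rl that \<open>c = 1\<close> by (intro tendsto_imp_eventually_ne[of R 1]) auto
  ultimately have "\<forall>\<^sub>F u in at 0. \<forall>\<zeta>\<in>{\<zeta>::complex. \<zeta> ^ n = 1} - {1}. R u \<noteq> \<zeta>"
    by (intro eventually_ball_finite) auto
  with Rn have "\<forall>\<^sub>F u in at 0. \<phi> (u * t u) = \<phi> u" by eventually_elim auto
  then have eq: "\<forall>\<^sub>F u in nhds 0. \<phi> (u * t u) = \<phi> u"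
    unfolding eventually_at_filter by eventually_elim auto
  obtain \<kappa> where \<kappa>: "\<forall>\<^sub>F u in nhds 0. \<kappa> (\<phi> u) = u" using local_inverse[OF \<phi>(1-3)] by blast
  from \<kappa> eventually_compose_filterlim[OF \<kappa> sl] eq have "\<forall>\<^sub>F u in nhds 0. u * t u = u"
    by eventually_elim metis
  moreover have "\<forall>\<^sub>F u in nhds 0. \<sigma> (param z u) = param z (u * t u)" using t by (simp add: germ_def)
  ultimately have "\<forall>\<^sub>F u in nhds 0. \<sigma> (param z u) = param z u" by eventually_elim simp
  then have "agree \<sigma> (\<lambda>x. x) z" by (simp add: agree_def)
  then show "\<sigma> = (\<lambda>x. x)" using identity_sphere rational_hol[OF s] hol_at_id by blast
qed

section \<open>Deck groups and quotients\<close>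

definition deck :: "(riemann_sphere \<Rightarrow> riemann_sphere) \<Rightarrow> (riemann_sphere \<Rightarrow> riemann_sphere) set" where
  "deck \<theta> = {\<sigma>. rational_function \<sigma> \<and> \<theta> \<circ> \<sigma> = \<theta>}"

lemma universal_covering_rational: "universal_covering \<nu> \<theta> \<Longrightarrow> rational_function \<theta>"
  by (simp add: universal_covering_def orbifold_covering_def)

lemma universal_covering_degree: "universal_covering \<nu> \<theta> \<Longrightarrow> local_degree \<theta> z = \<nu> (\<theta> z)"
  by (simp add: universal_covering_def orbifold_covering_def)

lemma deck_mobius:
  assumes "rational_function \<theta>" "\<sigma> \<in> deck \<theta>" shows "mobius \<sigma>"
  using rat_degree_compose[of \<theta> \<sigma>] rational_degree_pos[OF assms(1)] assms by (auto simp: deck_def mobius_def)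

lemma deck_id: "(\<lambda>x. x) \<in> deck \<theta>"
  by (simp add: deck_def rational_id o_def)

lemma deck_compose: "\<sigma> \<in> deck \<theta> \<Longrightarrow> \<tau> \<in> deck \<theta> \<Longrightarrow> \<sigma> \<circ> \<tau> \<in> deck \<theta>"
  by (auto simp: deck_def rational_compose comp_assoc[symmetric])

lemma deck_inv:
  assumes "rational_function \<theta>" "\<sigma> \<in> deck \<theta>" shows "inv \<sigma> \<in> deck \<theta>"
proof -
  note inv = mobius_inv[OF deck_mobius[OF assms]]
  have "\<theta> (inv \<sigma> x) = \<theta> x" for x
    using assms(2) inv(2) by (metis (mono_tags, lifting) comp_apply deck_def mem_Collect_eq)
  then show ?thesis using inv(1) by (auto simp: deck_def mobius_rational)
qed

lemma deck_transitive:
  assumes "universal_covering \<nu> \<theta>" "\<theta> a = \<theta> b" shows "\<exists>\<sigma>\<in>deck \<theta>. \<sigma> a = b"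
proof -
  have "\<exists>q. rational_function q \<and> \<theta> \<circ> q = \<theta> \<and> q a = b"
    by (rule rational_lift[OF assms(1)])
      (use assms universal_covering_rational universal_covering_degree in auto)
  then show ?thesis by (auto simp: deck_def)
qed

lemma deck_unique:
  assumes "rational_function \<theta>" "\<sigma> \<in> deck \<theta>" "\<tau> \<in> deck \<theta>" "\<sigma> a = \<tau> a" "local_degree \<theta> (\<sigma> a) = 1"
  shows "\<sigma> = \<tau>"
  using lift_unique_sphere[of \<theta> \<sigma> \<tau> a] assms by (auto simp: deck_def)

lemma infinite_sphere: "infinite (UNIV :: riemann_sphere set)"
proof
  assume "finite (UNIV :: riemann_sphere set)"
  then have "finite (range Fin)" by (rule finite_subset[OF subset_UNIV])
  then show False by (simp add: finite_image_iff inj_on_def infinite_UNIV_char_0)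
qed

lemma unramified_value:
  assumes "rational_function f" "finite A"
  obtains c where "c \<notin> A" "\<And>z. f z = c \<Longrightarrow> local_degree f z = 1"
proof -
  have "finite (A \<union> f ` {z. local_degree f z > 1})"
    using assms rational_riemann_hurwitz(1) by blast
  then obtain c where c: "c \<notin> A \<union> f ` {z. local_degree f z > 1}"
    using infinite_sphere by (metis ex_new_if_finite)
  have "local_degree f z = 1" if "f z = c" for z
    using c that local_degree_pos[OF assms(1), of z] by force
  then show ?thesis using c that by blast
qed

lemma deck_card:
  assumes uc: "universal_covering \<nu> \<theta>"
  shows "finite (deck \<theta>)" "card (deck \<theta>) = rat_degree \<theta>"
proof -
  have r: "rational_function \<theta>" using uc by (rule universal_covering_rational)
  obtain c where c: "\<And>z. \<theta> z = c \<Longrightarrow> local_degree \<theta> z = 1" using unramified_value[OF r] by blast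
  obtain a where a: "\<theta> a = c" using rational_surj[OF r] by blast
  have val: "\<theta> (\<sigma> a) = c" if "\<sigma> \<in> deck \<theta>" for \<sigma> using that a by (auto simp: deck_def fun_eq_iff)
  have bij: "bij_betw (\<lambda>\<sigma>. \<sigma> a) (deck \<theta>) (\<theta> -` {c})"
    unfolding bij_betw_def
  proof
    show "inj_on (\<lambda>\<sigma>. \<sigma> a) (deck \<theta>)"
      using deck_unique[OF r] c val by (intro inj_onI) blast
    show "(\<lambda>\<sigma>. \<sigma> a) ` deck \<theta> = \<theta> -` {c}"
    proof (intro equalityI subsetI)
      fix z assume "z \<in> \<theta> -` {c}"
      then obtain \<sigma> where "\<sigma> \<in> deck \<theta>" "\<sigma> a = z" using deck_transitive[OF uc, of a z] a by auto
      then show "z \<in> (\<lambda>\<sigma>. \<sigma> a) ` deck \<theta>" by blast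
    qed (use val in auto)
  qed
  show "finite (deck \<theta>)" using bij_betw_finite[OF bij] finite_rational_fiber[OF r] by blast
  have "rat_degree \<theta> = (\<Sum>z\<in>\<theta> -` {c}. 1)"
    unfolding rational_fiber_sum[OF r, of c, symmetric] by (intro sum.cong) (auto simp: c)
  then show "card (deck \<theta>) = rat_degree \<theta>" using bij_betw_same_card[OF bij] by simp
qed

lemma coprime_complexI:
  fixes p q :: "complex poly"
  assumes "\<And>z. poly p z = 0 \<Longrightarrow> poly q z \<noteq> 0" shows "coprime p q"
proof (rule coprimeI)
  fix r assume r: "r dvd p" "r dvd q"
  have nr: "poly r z \<noteq> 0" for z
    using r assms[of z] by (auto elim!: dvdE)
  then have "constant (poly r)" using fundamental_theorem_of_algebra by blast
  then have "degree r = 0" by (simp add: constant_degree)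
  moreover have "r \<noteq> 0" using nr by auto
  ultimately show "is_unit r" by (simp add: is_unit_iff_degree)
qed

locale mobius_group =
  fixes \<Gamma> :: "(riemann_sphere \<Rightarrow> riemann_sphere) set"
  assumes fin: "finite \<Gamma>" and mob: "\<And>\<sigma>. \<sigma> \<in> \<Gamma> \<Longrightarrow> mobius \<sigma>"
    and id: "(\<lambda>x. x) \<in> \<Gamma>" and comp: "\<And>\<sigma> \<tau>. \<sigma> \<in> \<Gamma> \<Longrightarrow> \<tau> \<in> \<Gamma> \<Longrightarrow> \<sigma> \<circ> \<tau> \<in> \<Gamma>"
    and inv: "\<And>\<sigma>. \<sigma> \<in> \<Gamma> \<Longrightarrow> inv \<sigma> \<in> \<Gamma>"
begin

lemma inv_apply: "\<sigma> \<in> \<Gamma> \<Longrightarrow> inv \<sigma> (\<sigma> x) = x" "\<sigma> \<in> \<Gamma> \<Longrightarrow> \<sigma> (inv \<sigma> x) = x"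
  using mobius_inv[OF mob] by (auto simp: fun_eq_iff)

lemma reindex: "\<tau> \<in> \<Gamma> \<Longrightarrow> (\<Prod>\<sigma>\<in>\<Gamma>. m (\<sigma> (\<tau> x))) = (\<Prod>\<sigma>\<in>\<Gamma>. m (\<sigma> x) :: complex)"
proof -
  assume \<tau>: "\<tau> \<in> \<Gamma>"
  have "bij_betw (\<lambda>\<sigma>. \<sigma> \<circ> \<tau>) \<Gamma> \<Gamma>"
  proof (rule bij_betwI[where g = "\<lambda>\<sigma>. \<sigma> \<circ> inv \<tau>"])
    show "(\<sigma> \<circ> \<tau>) \<circ> inv \<tau> = \<sigma>" "(\<sigma> \<circ> inv \<tau>) \<circ> \<tau> = \<sigma>" for \<sigma>
      using inv_apply[OF \<tau>] by (auto simp: fun_eq_iff)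
  qed (use \<tau> comp inv in auto)
  from prod.reindex_bij_betw[OF this, of "\<lambda>\<sigma>. m (\<sigma> x)"] show ?thesis by simp
qed

definition fixed :: "riemann_sphere set" where
  "fixed = (\<Union>\<sigma>\<in>\<Gamma> - {\<lambda>x. x}. {z. \<sigma> z = z})"

lemma finite_fixed: "finite fixed"
  unfolding fixed_def using fin finite_fixed_points mob mobius_rational by blast

lemma orbit_card: assumes "x \<notin> fixed" shows "card ((\<lambda>\<sigma>. \<sigma> x) ` \<Gamma>) = card \<Gamma>"
proof (rule card_image, rule inj_onI)
  fix \<sigma> \<tau> assume st: "\<sigma> \<in> \<Gamma>" "\<tau> \<in> \<Gamma>" "\<sigma> x = \<tau> x"
  then have "(inv \<tau> \<circ> \<sigma>) x = x" by (simp add: inv_apply)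
  moreover have "inv \<tau> \<circ> \<sigma> \<in> \<Gamma>" using st comp inv by blast
  ultimately have "inv \<tau> \<circ> \<sigma> = (\<lambda>x. x)" using assms unfolding fixed_def by blast
  then have "inv \<tau> (\<sigma> y) = y" for y by (metis comp_apply)
  then show "\<sigma> = \<tau>" using inv_apply(2)[OF st(2)] by (metis ext)
qed

text \<open>The quotient map is a product over the group of a Moebius transformation with zero \<open>a\<close>
  and pole \<open>b\<close> in different orbits.\<close>

theorem quotient:
  "\<exists>\<psi>. rational_function \<psi> \<and> rat_degree \<psi> = card \<Gamma> \<and> (\<forall>x y. \<psi> x = \<psi> y \<longleftrightarrow> (\<exists>\<sigma>\<in>\<Gamma>. \<sigma> x = y))"
proof -
  have "finite ((\<lambda>\<sigma>. fin_part (\<sigma> (Fin 0))) ` \<Gamma>)" using fin by simp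
  then obtain b where b: "b \<notin> (\<lambda>\<sigma>. fin_part (\<sigma> (Fin 0))) ` \<Gamma>"
    by (metis ex_new_if_finite infinite_UNIV_char_0)
  then have orb: "\<sigma> (Fin 0) \<noteq> Fin b" if "\<sigma> \<in> \<Gamma>" for \<sigma> using that by force
  have "\<exists>p q. rational_pair p q 1 \<and> \<sigma> = quotient_map_of p q" if "\<sigma> \<in> \<Gamma>" for \<sigma>
    using mob[OF that] by (metis mobius_def rational_functionE)
  then obtain p q where pq: "\<And>\<sigma>. \<sigma> \<in> \<Gamma> \<Longrightarrow> rational_pair (p \<sigma>) (q \<sigma>) 1" "\<And>\<sigma>. \<sigma> \<in> \<Gamma> \<Longrightarrow> \<sigma> = quotient_map_of (p \<sigma>) (q \<sigma>)"
    by metis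
  define N where "N c = (\<Prod>\<sigma>\<in>\<Gamma>. p \<sigma> - smult c (q \<sigma>))" for c
  have val: "poly (p \<sigma> - smult c (q \<sigma>)) z = 0 \<longleftrightarrow> \<sigma> (Fin z) = Fin c" if "\<sigma> \<in> \<Gamma>" for \<sigma> c z
    using rational_pair.value_Fin[OF pq(1)[OF that], of z "Fin c"] pq(2)[OF that] by simp
  have N0: "poly (N c) z = 0 \<longleftrightarrow> (\<exists>\<sigma>\<in>\<Gamma>. \<sigma> (Fin z) = Fin c)" for c z
    using fin val by (auto simp: N_def poly_prod simp del: poly_diff poly_smult)
  have deg: "degree (N c) \<le> card \<Gamma>" for c
  proof -
    have "degree (N c) \<le> (\<Sum>\<sigma>\<in>\<Gamma>. degree (p \<sigma> - smult c (q \<sigma>)))"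
      unfolding N_def using degree_prod_sum_le[OF fin, of "\<lambda>\<sigma>. p \<sigma> - smult c (q \<sigma>)"] by (simp add: o_def)
    also have "\<dots> \<le> (\<Sum>\<sigma>\<in>\<Gamma>. 1)"
      by (intro sum_mono) (use rational_pair.degree_le(1)[OF pq(1), of _ "Fin c"] in simp)
    finally show ?thesis by simp
  qed
  have cop: "coprime (N 0) (N b)"
  proof (rule coprime_complexI, rule notI)
    fix z assume "poly (N 0) z = 0" "poly (N b) z = 0"
    then obtain \<sigma> \<tau> where st: "\<sigma> \<in> \<Gamma>" "\<sigma> (Fin z) = Fin 0" "\<tau> \<in> \<Gamma>" "\<tau> (Fin z) = Fin b" by (auto simp: N0)
    then have "(\<tau> \<circ> inv \<sigma>) (Fin 0) = Fin b" using inv_apply(1)[OF st(1), of "Fin z"] by simp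
    then show False using orb comp inv st by blast
  qed
  have "poly (N b) b = 0" "poly (N b) 0 \<noteq> 0" using id orb by (auto simp: N0)
  then have degb: "degree (N b) \<ge> 1"
    by (metis One_nat_def Suc_leI degree_eq_zeroE poly_const_conv neq0_conv)
  define d where "d = max (degree (N 0)) (degree (N b))"
  interpret \<psi>: rational_pair "N 0" "N b" d by unfold_locales (use cop degb d_def in auto)
  define \<psi> where "\<psi> = \<psi>.f"
  have r: "rational_function \<psi>" "rat_degree \<psi> = d"
    using cop \<psi>.d_pos d_def \<psi>.rat_degree by (auto simp: \<psi>_def rational_function_def)
  have dle: "d \<le> card \<Gamma>" using deg by (simp add: d_def)
  define m where "m s = fin_part s / (fin_part s - b)" for s
  have eval: "\<psi> (Fin y) = Fin (\<Prod>\<sigma>\<in>\<Gamma>. m (\<sigma> (Fin y)))" if y: "\<And>\<sigma>. \<sigma> \<in> \<Gamma> \<Longrightarrow> \<sigma> (Fin y) \<noteq> Infty \<and> \<sigma> (Fin y) \<noteq> Fin b" for y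
  proof -
    have "poly (N b) y \<noteq> 0" using y by (simp add: N0)
    then have "\<psi> (Fin y) = Fin (poly (N 0) y / poly (N b) y)" by (simp add: \<psi>_def quotient_map_of.simps)
    also have "poly (N 0) y / poly (N b) y = (\<Prod>\<sigma>\<in>\<Gamma>. poly (p \<sigma>) y / (poly (p \<sigma>) y - b * poly (q \<sigma>) y))"
      by (simp add: N_def poly_prod prod_dividef)
    also have "\<dots> = (\<Prod>\<sigma>\<in>\<Gamma>. m (\<sigma> (Fin y)))"
    proof (rule prod.cong[OF refl])
      fix \<sigma> assume s: "\<sigma> \<in> \<Gamma>"
      have e: "\<sigma> (Fin y) = (if poly (q \<sigma>) y = 0 then Infty else Fin (poly (p \<sigma>) y / poly (q \<sigma>) y))"
        by (subst pq(2)[OF s]) (simp add: quotient_map_of.simps)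
      then have "poly (q \<sigma>) y \<noteq> 0" "poly (p \<sigma>) y / poly (q \<sigma>) y \<noteq> b" using y[OF s] by (auto split: if_splits)
      then show "poly (p \<sigma>) y / (poly (p \<sigma>) y - b * poly (q \<sigma>) y) = m (\<sigma> (Fin y))"
        unfolding e m_def by (simp add: field_simps)
    qed
    finally show ?thesis .
  qed
  have inva: "\<psi> \<circ> \<tau> = \<psi>" if \<tau>: "\<tau> \<in> \<Gamma>" for \<tau>
  proof (rule eq_cofinite)
    have rt: "rational_function \<tau>" using mob[OF \<tau>] by (rule mobius_rational)
    show "hol_at (\<psi> \<circ> \<tau>) z" "hol_at \<psi> z" for z using r rt by (auto intro: rational_hol rational_compose)
    define X where "X = insert Infty (\<tau> -` {Infty} \<union> (\<Union>\<sigma>\<in>\<Gamma>. \<sigma> -` {Infty} \<union> \<sigma> -` {Fin b}))"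
    have "finite X" unfolding X_def using fin rt mob mobius_rational finite_rational_fiber by auto
    moreover have "{z. (\<psi> \<circ> \<tau>) z \<noteq> \<psi> z} \<subseteq> X"
    proof (rule subsetI, rule ccontr)
      fix z assume z: "z \<in> {z. (\<psi> \<circ> \<tau>) z \<noteq> \<psi> z}" "z \<notin> X"
      have sz: "\<sigma> z \<noteq> Infty \<and> \<sigma> z \<noteq> Fin b" if "\<sigma> \<in> \<Gamma>" for \<sigma> using z(2) that by (auto simp: X_def)
      have "z \<noteq> Infty" "\<tau> z \<noteq> Infty" using z(2) by (auto simp: X_def)
      then obtain x x' where x: "z = Fin x" "\<tau> z = Fin x'" by (metis riemann_sphere.exhaust)
      have "\<psi> (Fin x') = Fin (\<Prod>\<sigma>\<in>\<Gamma>. m (\<sigma> (Fin x')))"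
      proof (rule eval)
        fix \<sigma> assume "\<sigma> \<in> \<Gamma>"
        then have "\<sigma> \<circ> \<tau> \<in> \<Gamma>" using comp \<tau> by blast
        from sz[OF this] show "\<sigma> (Fin x') \<noteq> Infty \<and> \<sigma> (Fin x') \<noteq> Fin b" using x(2) by simp
      qed
      also have "(\<Prod>\<sigma>\<in>\<Gamma>. m (\<sigma> (Fin x'))) = (\<Prod>\<sigma>\<in>\<Gamma>. m (\<sigma> z))" using reindex[OF \<tau>, of m z] x(2) by simp
      also have "Fin \<dots> = \<psi> z" using eval[of x] sz x(1) by simp
      finally show False using z(1) x(2) by simp
    qed
    ultimately show "finite {z. (\<psi> \<circ> \<tau>) z \<noteq> \<psi> z}" using finite_subset by blast
  qed
  have inv': "\<psi> (\<sigma> x) = \<psi> x" if "\<sigma> \<in> \<Gamma>" for \<sigma> x using inva[OF that] by (simp add: fun_eq_iff)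
  have generic: "\<psi> -` {\<psi> x} = (\<lambda>\<sigma>. \<sigma> x) ` \<Gamma> \<and> d = card \<Gamma>" if "x \<notin> fixed" for x
  proof -
    have sub: "(\<lambda>\<sigma>. \<sigma> x) ` \<Gamma> \<subseteq> \<psi> -` {\<psi> x}" using inv' by auto
    have ff: "finite (\<psi> -` {\<psi> x})" by (rule finite_rational_fiber[OF r(1)])
    have "card (\<psi> -` {\<psi> x}) = (\<Sum>z\<in>\<psi> -` {\<psi> x}. 1)" by simp
    also have "\<dots> \<le> (\<Sum>z\<in>\<psi> -` {\<psi> x}. local_degree \<psi> z)" by (intro sum_mono local_degree_pos[OF r(1)])
    also have "\<dots> = d" using rational_fiber_sum[OF r(1)] r(2) by simp
    finally have "card (\<psi> -` {\<psi> x}) \<le> d" .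
    moreover have "card \<Gamma> \<le> card (\<psi> -` {\<psi> x})" using card_mono[OF ff sub] orbit_card[OF that] by simp
    ultimately show ?thesis using dle card_subset_eq[OF ff sub] orbit_card[OF that] by simp
  qed
  have fib: "\<exists>\<sigma>\<in>\<Gamma>. \<sigma> x = y" if xy: "\<psi> x = \<psi> y" for x y
  proof (rule ccontr)
    assume n: "\<not> (\<exists>\<sigma>\<in>\<Gamma>. \<sigma> x = y)"
    have "\<forall>\<sigma>\<in>\<Gamma>. \<exists>\<epsilon>>0. \<forall>v s. norm v < \<epsilon> \<longrightarrow> norm s < \<epsilon> \<longrightarrow> \<sigma> (param x v) \<noteq> param y s"
    proof
      fix \<sigma> assume s: "\<sigma> \<in> \<Gamma>"
      show "\<exists>\<epsilon>>0. \<forall>v s. norm v < \<epsilon> \<longrightarrow> norm s < \<epsilon> \<longrightarrow> \<sigma> (param x v) \<noteq> param y s"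
        by (rule separated_ball) (use n s mob mobius_rational rational_hol in auto)
    qed
    from bchoice[OF this] obtain e where e: "\<And>\<sigma>. \<sigma> \<in> \<Gamma> \<Longrightarrow> e \<sigma> > (0::real)"
      "\<And>\<sigma> v s. \<sigma> \<in> \<Gamma> \<Longrightarrow> norm v < e \<sigma> \<Longrightarrow> norm s < e \<sigma> \<Longrightarrow> \<sigma> (param x v) \<noteq> param y s" by blast
    define \<epsilon> where "\<epsilon> = Min (e ` \<Gamma>)"
    have ne: "\<Gamma> \<noteq> {}" using id by auto
    have \<epsilon>: "\<epsilon> > 0" "\<And>\<sigma>. \<sigma> \<in> \<Gamma> \<Longrightarrow> \<epsilon> \<le> e \<sigma>" using e(1) fin ne by (auto simp: \<epsilon>_def)
    define c where "c = \<psi> x"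
    have "\<forall>\<^sub>F s in at 0. \<exists>v. norm v < \<epsilon> \<and> \<psi> (param x v) = param c s"
      unfolding c_def by (rule filter_leD[OF at_le_nhds rational_open_at[OF r(1) \<epsilon>(1)]])
    moreover have "\<forall>\<^sub>F s in at 0. \<exists>v. norm v < \<epsilon> \<and> \<psi> (param y v) = param c s"
      unfolding c_def xy by (rule filter_leD[OF at_le_nhds rational_open_at[OF r(1) \<epsilon>(1)]])
    moreover have "\<forall>\<^sub>F s in at 0. param c s \<notin> \<psi> ` fixed"
      by (intro eventually_param_notin finite_imageI finite_fixed)
    ultimately have "\<forall>\<^sub>F s in at (0::complex). False"
    proof eventually_elim
      case (elim s)
      then obtain v v' where v: "norm v < \<epsilon>" "\<psi> (param x v) = param c s" "norm v' < \<epsilon>" "\<psi> (param y v') = param c s" by blast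
      have "param x v \<notin> fixed" using v(2) elim(3) by (metis imageI)
      then have "\<psi> -` {param c s} = (\<lambda>\<sigma>. \<sigma> (param x v)) ` \<Gamma>" using generic[of "param x v"] v(2) by simp
      moreover have "param y v' \<in> \<psi> -` {param c s}" using v(4) by simp
      ultimately have "param y v' \<in> (\<lambda>\<sigma>. \<sigma> (param x v)) ` \<Gamma>" by simp
      then obtain \<sigma> where s: "\<sigma> \<in> \<Gamma>" "\<sigma> (param x v) = param y v'" by auto
      then show False using e(2)[OF s(1), of v v'] \<epsilon>(2)[OF s(1)] v by simp
    qed
    then show False by simp
  qed
  obtain x where "x \<notin> fixed" using finite_fixed infinite_sphere by (metis ex_new_if_finite)
  then have "d = card \<Gamma>" using generic by blast
  then show ?thesis using r fib inv' by (intro exI[of _ \<psi>]) metis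
qed

end

text \<open>A stabiliser contains the rotation of full order: lift the rotated local coordinate by deck
  transformations, finitely many of which serve all points near \<open>x\<close>.\<close>

lemma rotation_exists:
  assumes \<psi>: "rational_function \<psi>" and \<Gamma>: "finite \<Gamma>" "\<And>\<sigma>. \<sigma> \<in> \<Gamma> \<Longrightarrow> rational_function \<sigma>"
    and tr: "\<And>x y. \<psi> x = \<psi> y \<Longrightarrow> \<exists>\<sigma>\<in>\<Gamma>. \<sigma> x = y"
    and \<zeta>: "\<zeta> ^ local_degree \<psi> x = 1"
  shows "\<exists>\<tau>\<in>\<Gamma>. multiplier \<tau> x \<zeta>"
proof -
  define n where "n = local_degree \<psi> x"
  have npos: "n \<ge> 1" using local_degree_pos[OF \<psi>] n_def by simp
  have \<zeta>0: "\<zeta> \<noteq> 0" using \<zeta> npos by (auto simp: n_def[symmetric] power_0_left)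
  obtain \<phi> where \<phi>: "\<phi> analytic_on {0}" "\<phi> 0 = 0" "ord_at \<phi> 1" "germ \<psi> x (\<lambda>u. \<phi> u ^ n)"
    using rational_normal_form[OF \<psi>, of x] n_def by auto
  obtain \<kappa> where \<kappa>: "\<kappa> analytic_on {0}" "\<kappa> 0 = 0" "ord_at \<kappa> 1" "\<forall>\<^sub>F u in nhds 0. \<kappa> (\<phi> u) = u" "\<forall>\<^sub>F v in nhds 0. \<phi> (\<kappa> v) = v"
    using local_inverse[OF \<phi>(1-3)] by blast
  obtain e where e: "e analytic_on {0}" "e 0 \<noteq> 0" "\<forall>\<^sub>F u in nhds 0. \<phi> u = u * e u"
    using \<phi>(3) by (auto simp: ord_at_def)
  obtain k where k: "k analytic_on {0}" "k 0 \<noteq> 0" "\<forall>\<^sub>F u in nhds 0. \<kappa> u = u * k u"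
    using \<kappa>(3) by (auto simp: ord_at_def)
  define h where "h u = \<kappa> (\<zeta> * \<phi> u)" for u
  have za: "(\<lambda>u. \<zeta> * \<phi> u) analytic_on {0}" using \<phi> by (intro analytic_intros)
  have zl: "((\<lambda>u. \<zeta> * \<phi> u) \<longlongrightarrow> 0) (nhds 0)" using analytic_tendsto_nhds[OF za] \<phi>(2) by simp
  have \<phi>l: "(\<phi> \<longlongrightarrow> 0) (nhds 0)" using analytic_tendsto_nhds[OF \<phi>(1)] \<phi>(2) by simp
  have "(\<kappa> \<circ> (\<lambda>u. \<zeta> * \<phi> u)) analytic_on {0}" by (rule analytic_on_compose[OF za]) (use \<kappa> \<phi> in auto)
  then have ha: "h analytic_on {0}" "h 0 = 0" using \<phi> \<kappa> by (simp_all add: h_def[abs_def] o_def)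
  have hl: "(h \<longlongrightarrow> 0) (nhds 0)" using analytic_tendsto_nhds[OF ha(1)] ha(2) by simp
  define K where "K z = param x (h (local_coord x z))" for z
  have K: "germ K x h" unfolding germ_def K_def using ha by (cases x) (auto simp: K_def)
  have pe: "\<forall>\<^sub>F u in nhds 0. \<psi> (param x u) = param (\<psi> x) (\<phi> u ^ n)" using \<phi>(4) by (simp add: germ_def)
  have "\<forall>\<^sub>F u in nhds 0. \<psi> (K (param x u)) = \<psi> (param x u)"
    using eventually_compose_filterlim[OF pe hl] pe eventually_compose_filterlim[OF \<kappa>(5) zl]
  proof eventually_elim
    case (elim u)
    have "\<psi> (K (param x u)) = param (\<psi> x) (\<phi> (h u) ^ n)" using elim(1) by (simp add: K_def)
    also have "\<phi> (h u) = \<zeta> * \<phi> u" using elim(3) by (simp add: h_def)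
    also have "(\<zeta> * \<phi> u) ^ n = \<phi> u ^ n" using \<zeta> by (simp add: power_mult_distrib n_def)
    finally show ?case using elim(2) by simp
  qed
  then have "\<forall>\<^sub>F u in nhds 0. \<exists>\<sigma>\<in>\<Gamma>. \<sigma> (param x u) = K (param x u)"
    by eventually_elim (rule tr[OF sym])
  then have "\<forall>\<^sub>F u in at 0. \<exists>\<sigma>\<in>\<Gamma>. \<sigma> (param x u) = K (param x u)"
    by (rule filter_leD[OF at_le_nhds])
  then have "\<exists>\<^sub>F u in at 0. \<exists>\<sigma>\<in>\<Gamma>. \<sigma> (param x u) = K (param x u)"
    by (rule eventually_frequently[OF trivial_limit_at])
  from frequently_bex_finite[OF \<Gamma>(1) this]
  obtain \<tau> where \<tau>: "\<tau> \<in> \<Gamma>" "\<exists>\<^sub>F u in at 0. \<tau> (param x u) = K (param x u)" by blast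
  have "hol_at \<tau> x" "hol_at K x" using rational_hol[OF \<Gamma>(2)[OF \<tau>(1)]] K by (auto simp: hol_at_def)
  then have ev: "\<forall>\<^sub>F u in nhds 0. \<tau> (param x u) = K (param x u)"
    using hol_at_dichotomy[of \<tau> x K] \<tau>(2) by (auto simp: frequently_def)
  then have \<tau>x: "\<tau> x = x" using eventually_nhds_x_imp_x[OF ev] ha(2) by (simp add: K_def del: param.simps) (simp add: local_coord_param[of x 0, simplified] ha)
  define t where "t u = \<zeta> * e u * k (\<zeta> * \<phi> u)" for u
  have "(k \<circ> (\<lambda>u. \<zeta> * \<phi> u)) analytic_on {0}" by (rule analytic_on_compose[OF za]) (use k \<phi> in auto)
  then have ta: "t analytic_on {0}" unfolding t_def using e by (intro analytic_intros) (auto simp: o_def)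
  have ek: "e 0 * k 0 = 1"
  proof -
    have "\<forall>\<^sub>F u in at 0. e u * k (\<phi> u) = 1"
      using e(3) \<kappa>(4) eventually_compose_filterlim[OF k(3) \<phi>l] unfolding eventually_at_filter
    proof eventually_elim
      case (elim u)
      then have "u = u * (e u * k (\<phi> u))" by simp
      then show ?case by (metis mult_cancel_left1)
    qed
    then have "((\<lambda>u. e u * k (\<phi> u)) \<longlongrightarrow> 1) (at 0)" by (rule tendsto_eventually)
    moreover have "((\<lambda>u. e u * k (\<phi> u)) \<longlongrightarrow> e 0 * k 0) (nhds 0)"
      by (intro tendsto_mult analytic_tendsto_nhds e filterlim_compose[OF analytic_tendsto_nhds[OF k(1)] \<phi>l])
    then have "((\<lambda>u. e u * k (\<phi> u)) \<longlongrightarrow> e 0 * k 0) (at 0)" by (rule tendsto_mono[OF at_le_nhds])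
    ultimately show ?thesis using tendsto_unique trivial_limit_at by blast
  qed
  have "\<forall>\<^sub>F u in nhds 0. h u = u * t u"
    using e(3) eventually_compose_filterlim[OF k(3) zl] by eventually_elim (simp add: h_def t_def)
  with ev have "\<forall>\<^sub>F u in nhds 0. \<tau> (param x u) = param x (u * t u)" by eventually_elim (simp add: K_def)
  then have "germ \<tau> x (\<lambda>u. u * t u)" unfolding germ_def using ta \<tau>x by (auto intro!: analytic_intros)
  moreover have "t 0 = \<zeta>" using ek \<phi>(2) by (simp add: t_def mult.assoc)
  ultimately show ?thesis using \<tau>(1) \<tau>x ta by (auto simp: multiplier_def)
qed

section \<open>Euler characteristics\<close>

lemma orbifold_euler_superset:
  assumes "orbifold \<nu>" "finite B" "{z. \<nu> z > 1} \<subseteq> B"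
  shows "orbifold_euler \<nu> = 2 + (\<Sum>z\<in>B. (1 / real (\<nu> z) - 1))"
proof -
  have "(\<Sum>z\<in>{z. \<nu> z > 1}. (1 / real (\<nu> z) - 1)) = (\<Sum>z\<in>B. (1 / real (\<nu> z) - 1))"
  proof (intro sum.mono_neutral_left assms ballI)
    fix z assume "z \<in> B - {z. \<nu> z > 1}"
    then have "\<nu> z = 1" using assms(1) by (auto simp: orbifold_def intro: le_antisym)
    then show "1 / real (\<nu> z) - 1 = 0" by simp
  qed
  then show ?thesis by (simp add: orbifold_euler_def)
qed

lemma riemann_hurwitz_sum:
  assumes f: "rational_function f" and B: "finite B" "f ` {z. local_degree f z > 1} \<subseteq> B"
  shows "finite (f -` B)"
    "(\<Sum>z\<in>f -` B. real (local_degree f z) / \<alpha> (f z) - 1) + 2 = rat_degree f * (2 + (\<Sum>b\<in>B. 1 / \<alpha> b - 1))"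
proof -
  have U: "f -` B = (\<Union>b\<in>B. f -` {b})" by auto
  show fin: "finite (f -` B)" unfolding U using B finite_rational_fiber[OF f] by blast
  have fib: "(\<Sum>z\<in>f -` B. real (local_degree f z) * \<beta> (f z)) = rat_degree f * (\<Sum>b\<in>B. \<beta> b)" for \<beta> :: "riemann_sphere \<Rightarrow> real"
  proof -
    have "(\<Sum>z\<in>f -` B. real (local_degree f z) * \<beta> (f z)) = (\<Sum>b\<in>B. \<Sum>z\<in>f -` {b}. real (local_degree f z) * \<beta> (f z))"
      unfolding U by (rule sum.UNION_disjoint) (use B finite_rational_fiber[OF f] in auto)
    also have "\<dots> = (\<Sum>b\<in>B. \<Sum>z\<in>f -` {b}. real (local_degree f z) * \<beta> b)"
      by (intro sum.cong refl) auto
    also have "\<dots> = (\<Sum>b\<in>B. real (rat_degree f) * \<beta> b)"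
    proof (rule sum.cong[OF refl])
      fix b
      have "(\<Sum>z\<in>f -` {b}. real (local_degree f z) * \<beta> b) = real (\<Sum>z\<in>f -` {b}. local_degree f z) * \<beta> b"
        by (simp add: sum_distrib_right)
      then show "(\<Sum>z\<in>f -` {b}. real (local_degree f z) * \<beta> b) = real (rat_degree f) * \<beta> b"
        by (simp only: rational_fiber_sum[OF f])
    qed
    finally show ?thesis by (simp add: sum_distrib_left)
  qed
  have "(\<Sum>z\<in>f -` B. real (local_degree f z - 1)) = (\<Sum>z | local_degree f z > 1. real (local_degree f z - 1))"
    by (rule sum.mono_neutral_right) (use fin B in auto)
  also have "\<dots> = 2 * real (rat_degree f) - 2"
    using arg_cong[OF rational_riemann_hurwitz(2)[OF f], of real] rational_degree_pos[OF f] by (simp add: of_nat_diff)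
  finally have rh: "(\<Sum>z\<in>f -` B. real (local_degree f z) - 1) = 2 * real (rat_degree f) - 2"
    using local_degree_pos[OF f] by (simp add: of_nat_diff)
  have 1: "(\<Sum>z\<in>f -` B. real (local_degree f z)) = rat_degree f * card B" using fib[of "\<lambda>_. 1"] by simp
  have 2: "(\<Sum>z\<in>f -` B. real (local_degree f z) / \<alpha> (f z)) = rat_degree f * (\<Sum>b\<in>B. 1 / \<alpha> b)"
    using fib[of "\<lambda>b. 1 / \<alpha> b"] by simp
  have "(\<Sum>z\<in>f -` B. 1 :: real) = rat_degree f * card B - (2 * real (rat_degree f) - 2)"
    using rh 1 by (simp add: sum_subtractf)
  then show "(\<Sum>z\<in>f -` B. real (local_degree f z) / \<alpha> (f z) - 1) + 2 = rat_degree f * (2 + (\<Sum>b\<in>B. 1 / \<alpha> b - 1))"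
    using 2 by (simp add: sum_subtractf algebra_simps)
qed

lemma orbifold_pos: "orbifold \<nu> \<Longrightarrow> \<nu> z \<ge> 1"
  by (simp add: orbifold_def)

lemma pullback_times: "pullback_orbifold f \<nu> z * gcd (local_degree f z) (\<nu> (f z)) = \<nu> (f z)"
  by (simp add: pullback_orbifold_def)

lemma pullback_is_orbifold:
  assumes f: "rational_function f" and \<nu>: "orbifold \<nu>"
  shows "orbifold (pullback_orbifold f \<nu>)"
proof -
  have "pullback_orbifold f \<nu> z \<ge> 1" for z
    using pullback_times[of f \<nu> z] orbifold_pos[OF \<nu>, of "f z"] by (cases "pullback_orbifold f \<nu> z") auto
  moreover have "{z. pullback_orbifold f \<nu> z > 1} \<subseteq> f -` {z. \<nu> z > 1}"
  proof
    fix z assume "z \<in> {z. pullback_orbifold f \<nu> z > 1}"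
    then have "pullback_orbifold f \<nu> z > 1" by simp
    also have "pullback_orbifold f \<nu> z \<le> \<nu> (f z)" by (simp add: pullback_orbifold_def)
    finally show "z \<in> f -` {z. \<nu> z > 1}" by simp
  qed
  moreover have "finite (f -` {z. \<nu> z > 1})"
  proof -
    have "f -` {z. \<nu> z > 1} = (\<Union>b\<in>{z. \<nu> z > 1}. f -` {b})" by auto
    then show ?thesis using \<nu> finite_rational_fiber[OF f] by (simp add: orbifold_def)
  qed
  ultimately show ?thesis by (auto simp: orbifold_def intro: finite_subset)
qed

lemma euler_sum:
  assumes f: "rational_function f" and \<nu>: "orbifold \<nu>" and \<nu>': "orbifold \<nu>'" and le: "\<And>z. \<nu>' z \<le> \<nu> (f z)"
  obtains A where "finite A" "orbifold_euler \<nu>' = 2 + (\<Sum>z\<in>A. 1 / real (\<nu>' z) - 1)"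
    "rat_degree f * orbifold_euler \<nu> = 2 + (\<Sum>z\<in>A. real (local_degree f z) / real (\<nu> (f z)) - 1)"
proof -
  define B where "B = {z. \<nu> z > 1} \<union> f ` {z. local_degree f z > 1}"
  have B: "finite B" using \<nu> rational_riemann_hurwitz(1)[OF f] by (simp add: B_def orbifold_def)
  have B': "f ` {z. local_degree f z > 1} \<subseteq> B" by (auto simp: B_def)
  note rh = riemann_hurwitz_sum(1)[OF f B B'] riemann_hurwitz_sum(2)[OF f B B', of "\<lambda>b. real (\<nu> b)"]
  have "orbifold_euler \<nu>' = 2 + (\<Sum>z\<in>f -` B. 1 / real (\<nu>' z) - 1)"
  proof (rule orbifold_euler_superset[OF \<nu>'])
    show "finite (f -` B)" by (rule rh(1))
    show "{z. \<nu>' z > 1} \<subseteq> f -` B" using le by (auto simp: B_def intro: order.strict_trans2)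
  qed
  moreover have "orbifold_euler \<nu> = 2 + (\<Sum>z\<in>B. 1 / real (\<nu> z) - 1)"
    by (rule orbifold_euler_superset[OF \<nu> B]) (auto simp: B_def)
  ultimately show ?thesis using that[of "f -` B"] rh by simp
qed

lemma euler_pullback_le:
  assumes f: "rational_function f" and \<nu>: "orbifold \<nu>"
  shows "orbifold_euler (pullback_orbifold f \<nu>) \<le> rat_degree f * orbifold_euler \<nu>"
proof -
  define \<nu>' where "\<nu>' = pullback_orbifold f \<nu>"
  have "\<nu>' z \<le> \<nu> (f z)" for z by (simp add: \<nu>'_def pullback_orbifold_def)
  then obtain A where A: "orbifold_euler \<nu>' = 2 + (\<Sum>z\<in>A. 1 / real (\<nu>' z) - 1)"
    "rat_degree f * orbifold_euler \<nu> = 2 + (\<Sum>z\<in>A. real (local_degree f z) / real (\<nu> (f z)) - 1)"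
    using euler_sum[OF f \<nu> pullback_is_orbifold[OF f \<nu>, folded \<nu>'_def]] by blast
  have "1 / real (\<nu>' z) \<le> real (local_degree f z) / real (\<nu> (f z))" for z
  proof -
    define g where "g = gcd (local_degree f z) (\<nu> (f z))"
    have e: "real (\<nu>' z) * real g = real (\<nu> (f z))"
      using pullback_times[of f \<nu> z] by (simp add: \<nu>'_def g_def flip: of_nat_mult)
    have p: "\<nu> (f z) \<ge> 1" "\<nu>' z \<ge> 1" using orbifold_pos \<nu> pullback_is_orbifold[OF f \<nu>] by (auto simp: \<nu>'_def)
    then have "1 / real (\<nu>' z) = real g / real (\<nu> (f z))" using e by (auto simp: field_simps)
    also have "g \<le> local_degree f z" using local_degree_pos[OF f, of z] by (simp add: g_def gcd_le1_nat)
    then have "real g / real (\<nu> (f z)) \<le> real (local_degree f z) / real (\<nu> (f z))" by (simp add: divide_right_mono)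
    finally show ?thesis .
  qed
  then show ?thesis unfolding \<nu>'_def[symmetric] A by (simp add: sum_mono)
qed

lemma covering_is_orbifold:
  assumes c: "orbifold_covering \<nu>' f \<nu>" and \<nu>: "orbifold \<nu>"
  shows "orbifold \<nu>'" "\<nu>' = pullback_orbifold f \<nu>"
proof -
  have f: "rational_function f" and e: "\<And>z. \<nu> (f z) = \<nu>' z * local_degree f z"
    using c by (auto simp: orbifold_covering_def)
  have "\<nu>' z = pullback_orbifold f \<nu> z" for z
    using local_degree_pos[OF f, of z] by (simp add: pullback_orbifold_def e)
  then show "\<nu>' = pullback_orbifold f \<nu>" by blast
  then show "orbifold \<nu>'" using pullback_is_orbifold[OF f \<nu>] by simp
qed

lemma euler_covering:
  assumes c: "orbifold_covering \<nu>' f \<nu>" and \<nu>: "orbifold \<nu>"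
  shows "orbifold_euler \<nu>' = rat_degree f * orbifold_euler \<nu>"
proof -
  have f: "rational_function f" and e: "\<And>z. \<nu> (f z) = \<nu>' z * local_degree f z"
    using c by (auto simp: orbifold_covering_def)
  have d: "local_degree f z \<ge> 1" for z by (rule local_degree_pos[OF f])
  have p: "\<nu>' z \<ge> 1" for z using covering_is_orbifold[OF c \<nu>] orbifold_pos by blast
  have "\<nu>' z \<le> \<nu> (f z)" for z using d[of z] by (simp add: e)
  then obtain A where A: "orbifold_euler \<nu>' = 2 + (\<Sum>z\<in>A. 1 / real (\<nu>' z) - 1)"
    "rat_degree f * orbifold_euler \<nu> = 2 + (\<Sum>z\<in>A. real (local_degree f z) / real (\<nu> (f z)) - 1)"
    using euler_sum[OF f \<nu> covering_is_orbifold(1)[OF c \<nu>]] by blast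
  have "real (local_degree f z) / real (\<nu> (f z)) = 1 / real (\<nu>' z)" for z
    using d[of z] p[of z] by (simp add: e)
  then show ?thesis using A by simp
qed

lemma euler_universal:
  assumes "universal_covering \<nu> \<theta>" "orbifold \<nu>"
  shows "rat_degree \<theta> * orbifold_euler \<nu> = 2"
  using euler_covering[of "\<lambda>_. 1" \<theta> \<nu>] assms by (simp add: universal_covering_def orbifold_euler_def)

lemma local_degree_dvd_of_lift:
  assumes \<theta>: "universal_covering \<nu> \<theta>" and g: "rational_function g"
    and dvd: "\<And>z. \<nu> (g (Fin z)) dvd local_degree g (Fin z)"
  shows "\<nu> (g z) dvd local_degree g z"
proof -
  obtain w where "\<theta> w = g (Fin 0)" using rational_surj[OF universal_covering_rational[OF \<theta>]] by blast
  then obtain q where q: "rational_function q" "\<theta> \<circ> q = g" using rational_lift_Fin[OF \<theta> g dvd] by blast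
  have "local_degree g z = local_degree \<theta> (q z) * local_degree q z"
    using local_degree_compose[OF universal_covering_rational[OF \<theta>] q(1)] q(2) by metis
  also have "local_degree \<theta> (q z) = \<nu> (g z)" using universal_covering_degree[OF \<theta>] q(2) by auto
  finally show ?thesis by simp
qed

section \<open>Spherical signatures\<close>

definition has_signature :: "(riemann_sphere \<Rightarrow> nat) \<Rightarrow> nat \<Rightarrow> nat \<Rightarrow> nat \<Rightarrow> bool" where
  "has_signature \<nu> x y z \<longleftrightarrow> (\<exists>a b c. a \<noteq> b \<and> b \<noteq> c \<and> a \<noteq> c \<and> \<nu> a = x \<and> \<nu> b = y \<and> \<nu> c = z \<and>
     (\<forall>w. w \<noteq> a \<and> w \<noteq> b \<and> w \<noteq> c \<longrightarrow> \<nu> w = 1))"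

lemma has_signatureI:
  assumes "a \<noteq> b" "b \<noteq> c" "a \<noteq> c" "\<And>w. w \<noteq> a \<Longrightarrow> w \<noteq> b \<Longrightarrow> w \<noteq> c \<Longrightarrow> \<nu> w = 1"
  shows "has_signature \<nu> (\<nu> a) (\<nu> b) (\<nu> c)"
  unfolding has_signature_def using assms by blast

lemma has_signature_swap:
  "has_signature \<nu> x y z \<Longrightarrow> has_signature \<nu> y x z"
  "has_signature \<nu> x y z \<Longrightarrow> has_signature \<nu> x z y"
  unfolding has_signature_def by metis+

lemma has_signature_sorted:
  assumes "has_signature \<nu> x y z"
  obtains x' y' z' where "has_signature \<nu> x' y' z'" "x' \<le> y'" "y' \<le> z'" "{x', y', z'} = {x, y, z}"
proof -
  note s = has_signature_swap
  consider "x \<le> y" "y \<le> z" | "x \<le> z" "z \<le> y" | "y \<le> x" "x \<le> z" | "y \<le> z" "z \<le> x" | "z \<le> x" "x \<le> y" | "z \<le> y" "y \<le> x"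
    by linarith
  then show ?thesis
  proof cases
    case 1 then show ?thesis using that assms by blast
  next
    case 2 then show ?thesis using that[of x z y] s(2)[OF assms] by auto
  next
    case 3 then show ?thesis using that[of y x z] s(1)[OF assms] by auto
  next
    case 4 then show ?thesis using that[of y z x] s(2)[OF s(1)[OF assms]] by auto
  next
    case 5 then show ?thesis using that[of z x y] s(1)[OF s(2)[OF assms]] by auto
  next
    case 6 then show ?thesis using that[of z y x] s(1)[OF s(2)[OF s(1)[OF assms]]] by auto
  qed
qed

lemma has_signature_mobius:
  assumes "has_signature \<nu> x y z" "has_signature \<nu>' x y z"
  shows "\<exists>\<mu>. mobius \<mu> \<and> (\<forall>w. \<nu> (\<mu> w) = \<nu>' w)"
proof -
  obtain a b c where abc: "a \<noteq> b" "b \<noteq> c" "a \<noteq> c" "\<nu> a = x" "\<nu> b = y" "\<nu> c = z" "\<And>w. w \<noteq> a \<Longrightarrow> w \<noteq> b \<Longrightarrow> w \<noteq> c \<Longrightarrow> \<nu> w = 1"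
    using assms(1) unfolding has_signature_def by blast
  obtain a' b' c' where abc': "a' \<noteq> b'" "b' \<noteq> c'" "a' \<noteq> c'" "\<nu>' a' = x" "\<nu>' b' = y" "\<nu>' c' = z" "\<And>w. w \<noteq> a' \<Longrightarrow> w \<noteq> b' \<Longrightarrow> w \<noteq> c' \<Longrightarrow> \<nu>' w = 1"
    using assms(2) unfolding has_signature_def by blast
  obtain \<mu> where \<mu>: "mobius \<mu>" "\<mu> a' = a" "\<mu> b' = b" "\<mu> c' = c"
    using mobius_transitive[OF abc'(1-3) abc(1-3)] by blast
  have inj: "\<mu> v = \<mu> w \<longleftrightarrow> v = w" for v w using mobius_bij[OF \<mu>(1)] by (auto simp: bij_def inj_def)
  have "\<nu> (\<mu> w) = \<nu>' w" for w
  proof (cases "w = a' \<or> w = b' \<or> w = c'")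
    case True then show ?thesis using \<mu> abc abc' by auto
  next
    case False
    then have "\<mu> w \<noteq> a" "\<mu> w \<noteq> b" "\<mu> w \<noteq> c" using inj \<mu> by metis+
    then show ?thesis using abc(7) abc'(7) False by metis
  qed
  then show ?thesis using \<mu>(1) by blast
qed

lemma has_signature_value: "has_signature \<nu> x y z \<Longrightarrow> \<nu> w \<in> {x, y, z, 1}"
  unfolding has_signature_def by auto metis

lemma signature_euler:
  assumes "has_signature \<nu> x y z" "orbifold \<nu>"
  shows "orbifold_euler \<nu> = 1 / real x + 1 / real y + 1 / real z - 1"
proof -
  obtain a b c where abc: "a \<noteq> b" "b \<noteq> c" "a \<noteq> c" "\<nu> a = x" "\<nu> b = y" "\<nu> c = z" "\<And>w. w \<noteq> a \<Longrightarrow> w \<noteq> b \<Longrightarrow> w \<noteq> c \<Longrightarrow> \<nu> w = 1"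
    using assms(1) unfolding has_signature_def by blast
  have "{z. \<nu> z > 1} \<subseteq> {a, b, c}" using abc(7) by force
  then have "orbifold_euler \<nu> = 2 + (\<Sum>z\<in>{a, b, c}. 1 / real (\<nu> z) - 1)"
    by (intro orbifold_euler_superset assms) auto
  then show ?thesis using abc by simp
qed

definition spherical :: "nat \<Rightarrow> nat \<Rightarrow> nat \<Rightarrow> bool" where
  "spherical x y z \<longleftrightarrow> (x = y \<and> z = 1 \<and> x \<ge> 1) \<or> (x = 2 \<and> y = 2 \<and> z \<ge> 2) \<or> (x = 2 \<and> y = 3 \<and> z \<in> {3, 4, 5})"

lemma spherical_of_euler:
  assumes "2 \<le> x" "x \<le> y" "y \<le> z" "1 / real x + 1 / real y + 1 / real z > 1"
  shows "spherical x y z"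
proof -
  have x: "x = 2"
  proof (rule ccontr)
    assume "x \<noteq> 2"
    then have "x \<ge> 3" "y \<ge> 3" "z \<ge> 3" using assms by auto
    then have "1 / real x \<le> 1 / 3" "1 / real y \<le> 1 / 3" "1 / real z \<le> 1 / 3" by (auto simp: field_simps)
    then show False using assms(4) by linarith
  qed
  have y: "y \<le> 3"
  proof (rule ccontr)
    assume "\<not> y \<le> 3"
    then have "y \<ge> 4" "z \<ge> 4" using assms by auto
    then have "1 / real y \<le> 1 / 4" "1 / real z \<le> 1 / 4" by (auto simp: field_simps)
    then show False using assms(4) x by simp
  qed
  have z: "z \<le> 5" if "y = 3"
  proof (rule ccontr)
    assume "\<not> z \<le> 5"
    then have "z \<ge> 6" by auto
    then have "1 / real z \<le> 1 / 6" by (auto simp: field_simps)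
    then show False using assms(4) x that by simp
  qed
  have "y = 2 \<or> y = 3" "z \<ge> 2" using x y assms by auto
  then show ?thesis using x z assms unfolding spherical_def by auto
qed

lemma distinct_sphere: "\<exists>c :: riemann_sphere. c \<noteq> a \<and> c \<noteq> b"
proof -
  show ?thesis using ex_new_if_finite[OF infinite_sphere, of "{a, b}"] by auto
qed

theorem spherical_classification:
  assumes good: "good_orbifold \<nu>" and pos: "orbifold_euler \<nu> > 0"
  shows "\<exists>x y z. has_signature \<nu> x y z \<and> spherical x y z"
proof -
  have \<nu>: "orbifold \<nu>" using good by (simp add: good_orbifold_def)
  define S where "S = {z. \<nu> z > 1}"
  have fin: "finite S" using \<nu> by (simp add: S_def orbifold_def)
  have one: "\<nu> z = 1" if "z \<notin> S" for z using that orbifold_pos[OF \<nu>, of z] by (simp add: S_def)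
  have "(\<Sum>z\<in>S. 1 / real (\<nu> z) - 1) \<le> (\<Sum>z\<in>S. - (1 / 2))"
    by (intro sum_mono) (auto simp: S_def field_simps)
  then have "card S < 4" using pos unfolding orbifold_euler_def S_def[symmetric] by simp
  then consider "card S = 0" | "card S = 1" | "card S = 2" | "card S = 3" by linarith
  then show ?thesis
  proof cases
    case 1
    then have "\<nu> w = 1" for w using fin one by auto
    then have "has_signature \<nu> 1 1 1" using has_signatureI[of "Fin 0" "Fin 1" Infty \<nu>] by simp
    then show ?thesis unfolding spherical_def by (metis order_refl)
  next
    case 2
    then obtain z where "S = {z}" by (auto simp: card_1_singleton_iff)
    then have "bad_orbifold \<nu>" using \<nu> by (auto simp: bad_orbifold_def S_def)
    then show ?thesis using good by (simp add: good_orbifold_def)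
  next
    case 3
    then obtain a b where ab: "S = {a, b}" "a \<noteq> b" by (auto simp: card_2_iff)
    have eq: "\<nu> a = \<nu> b"
    proof (rule ccontr)
      assume "\<nu> a \<noteq> \<nu> b"
      then have "bad_orbifold \<nu>" using \<nu> ab unfolding bad_orbifold_def S_def by blast
      then show False using good by (simp add: good_orbifold_def)
    qed
    obtain c where c: "c \<noteq> a" "c \<noteq> b" using distinct_sphere by blast
    have "has_signature \<nu> (\<nu> a) (\<nu> b) (\<nu> c)" by (rule has_signatureI) (use ab c one in auto)
    moreover have "\<nu> c = 1" using c ab one by auto
    ultimately show ?thesis unfolding spherical_def using eq orbifold_pos[OF \<nu>, of a] by metis
  next
    case 4
    then obtain a b c where abc: "S = {a, b, c}" "a \<noteq> b" "b \<noteq> c" "a \<noteq> c" by (auto simp: card_3_iff)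
    have "has_signature \<nu> (\<nu> a) (\<nu> b) (\<nu> c)" by (rule has_signatureI) (use abc one in auto)
    then obtain x y z where xyz: "has_signature \<nu> x y z" "x \<le> y" "y \<le> z" "{x, y, z} = {\<nu> a, \<nu> b, \<nu> c}"
      using has_signature_sorted by blast
    have "\<nu> a > 1" "\<nu> b > 1" "\<nu> c > 1" using abc(1) by (auto simp: S_def)
    moreover have "x \<in> {\<nu> a, \<nu> b, \<nu> c}" using xyz(4) by blast
    ultimately have "x \<ge> 2" by auto
    then have "spherical x y z"
      using spherical_of_euler xyz pos signature_euler[OF xyz(1) \<nu>] by simp
    then show ?thesis using xyz(1) by blast
  qed
qed

lemma universal_covering_compose:
  assumes "orbifold_covering \<nu>' w \<nu>" "universal_covering \<nu>' \<theta>"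
  shows "universal_covering \<nu> (w \<circ> \<theta>)"
  using assms by (auto simp: universal_covering_def orbifold_covering_def rational_compose local_degree_compose)

lemma mobius_covering:
  assumes "mobius \<mu>" "\<And>w. \<nu> (\<mu> w) = \<nu>' w" shows "orbifold_covering \<nu>' \<mu> \<nu>"
  using assms by (auto simp: orbifold_covering_def mobius_rational mobius_local_degree)

lemma universal_covering_same_signature:
  assumes "has_signature \<nu> x y z" "has_signature \<nu>' x y z" "universal_covering \<nu>' \<theta>'"
  shows "\<exists>\<theta>. universal_covering \<nu> \<theta>"
  using has_signature_mobius[OF assms(1,2)] mobius_covering universal_covering_compose assms(3) by metis

definition poly_map :: "complex poly \<Rightarrow> riemann_sphere \<Rightarrow> riemann_sphere" where
  "poly_map p = quotient_map_of p 1"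

context
  fixes p :: "complex poly" assumes deg: "degree p \<ge> 1"
begin

interpretation rational_pair p 1 "degree p"
  by unfold_locales (use deg in auto)

lemma poly_map_rational: "rational_function (poly_map p)"
proof -
  have "coprime p 1" "max (degree p) (degree (1 :: complex poly)) \<ge> 1" using deg by simp_all
  then show ?thesis unfolding rational_function_def poly_map_def by blast
qed

lemma poly_map_simps: "poly_map p (Fin a) = Fin (poly p a)" "poly_map p Infty = Infty"
  using deg by (auto simp: poly_map_def quotient_map_of.simps Let_def coeff_eq_0)

lemma poly_map_local_degree_Infty: "local_degree (poly_map p) Infty = degree p"
  using local_degree_Infty poly_map_simps(2) by (simp add: poly_map_def)

lemma poly_map_local_degree_Fin: "local_degree (poly_map p) (Fin a) = Suc (order a (pderiv p))"
proof -
  have "wronskian = pderiv p" by (simp add: wronskian_def pderiv_1)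
  then show ?thesis
    using wronskian_order[OF wronskian_degree(1), of a] local_degree_pos[of "Fin a"] by (simp add: poly_map_def)
qed

end

definition power_map :: "nat \<Rightarrow> riemann_sphere \<Rightarrow> riemann_sphere" where
  "power_map n = poly_map (monom 1 n)"

lemma power_map:
  assumes "n \<ge> 1"
  shows "rational_function (power_map n)" "power_map n (Fin a) = Fin (a ^ n)" "power_map n Infty = Infty"
    "local_degree (power_map n) z = (if z = Fin 0 \<or> z = Infty then n else 1)"
proof -
  have d: "degree (monom 1 n :: complex poly) \<ge> 1" using assms by (simp add: degree_monom_eq)
  show "rational_function (power_map n)" "power_map n (Fin a) = Fin (a ^ n)" "power_map n Infty = Infty"
    unfolding power_map_def using poly_map_rational[OF d] poly_map_simps[OF d] by (auto simp: poly_monom)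
  have pd: "pderiv (monom 1 n :: complex poly) = monom (of_nat n) (n - 1)" by (simp add: pderiv_monom)
  show "local_degree (power_map n) z = (if z = Fin 0 \<or> z = Infty then n else 1)"
  proof (cases z)
    case Infty then show ?thesis using poly_map_local_degree_Infty[OF d] by (simp add: power_map_def degree_monom_eq)
  next
    case (Fin a)
    show ?thesis
    proof (cases "a = 0")
      case True
      have "order 0 (monom (of_nat n) (n - 1) :: complex poly) = n - 1"
        using assms by (intro order_0_monom) auto
      then show ?thesis using poly_map_local_degree_Fin[OF d, of a] Fin True assms by (simp add: power_map_def pd)
    next
      case False
      then have "order a (pderiv (monom 1 n :: complex poly)) = 0"
        using assms by (intro order_0I) (simp add: pd poly_monom)
      then show ?thesis using poly_map_local_degree_Fin[OF d, of a] Fin False by (simp add: power_map_def)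
    qed
  qed
qed

lemma power_map_covering:
  assumes n: "n \<ge> 1" and dvd: "n dvd \<nu> (Fin 0)" "n dvd \<nu> Infty"
  shows "orbifold_covering (\<lambda>z. if z = Fin 0 \<or> z = Infty then \<nu> z div n else \<nu> (power_map n z)) (power_map n) \<nu>"
  unfolding orbifold_covering_def using power_map[OF n] dvd n by (auto simp: power_0_left)

definition three_points :: "riemann_sphere \<Rightarrow> nat \<Rightarrow> riemann_sphere \<Rightarrow> nat \<Rightarrow> riemann_sphere \<Rightarrow> nat \<Rightarrow> riemann_sphere \<Rightarrow> nat" where
  "three_points a x b y c z w = (if w = a then x else if w = b then y else if w = c then z else 1)"

lemma three_points_signature:
  "a \<noteq> b \<Longrightarrow> b \<noteq> c \<Longrightarrow> a \<noteq> c \<Longrightarrow> has_signature (three_points a x b y c z) x y z"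
  using has_signatureI[of a b c "three_points a x b y c z"] by (simp add: three_points_def)

lemma covering_cyclic:
  assumes "has_signature \<nu> n n 1" "n \<ge> 1" shows "\<exists>\<theta>. universal_covering \<nu> \<theta>"
proof (rule universal_covering_same_signature[OF assms(1)])
  show "has_signature (three_points (Fin 0) n Infty n (Fin 1) 1) n n 1" by (rule three_points_signature) auto
  have "three_points (Fin 0) n Infty n (Fin 1) 1 (power_map n z) = local_degree (power_map n) z" for z
    using power_map[OF assms(2)] assms(2) by (cases z) (auto simp: three_points_def power_0_left)
  then show "universal_covering (three_points (Fin 0) n Infty n (Fin 1) 1) (power_map n)"
    using power_map(1)[OF assms(2)] by (simp add: universal_covering_def orbifold_covering_def)
qed

lemma covering_transfer:
  assumes "has_signature \<nu> x y z" "has_signature \<nu>0 x y z" "orbifold_covering \<nu>1 w \<nu>0" "has_signature \<nu>1 x' y' z'"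
    and ex: "\<And>\<nu>. has_signature \<nu> x' y' z' \<Longrightarrow> \<exists>\<theta>. universal_covering \<nu> \<theta>"
  shows "\<exists>\<theta>. universal_covering \<nu> \<theta>"
  using ex[OF assms(4)] universal_covering_compose[OF assms(3)] universal_covering_same_signature[OF assms(1,2)] by blast

lemma covering_dihedral:
  assumes "has_signature \<nu> 2 2 n" "n \<ge> 1" shows "\<exists>\<theta>. universal_covering \<nu> \<theta>"
proof (rule covering_transfer[OF assms(1)])
  let ?\<nu> = "three_points (Fin 0) 2 Infty 2 (Fin 1) n"
  let ?\<nu>1 = "\<lambda>z. if z = Fin 0 \<or> z = Infty then ?\<nu> z div 2 else ?\<nu> (power_map 2 z)"
  show "has_signature ?\<nu> 2 2 n" by (rule three_points_signature) auto
  show "orbifold_covering ?\<nu>1 (power_map 2) ?\<nu>" by (rule power_map_covering) (auto simp: three_points_def)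
  have "?\<nu>1 w = 1" if "w \<noteq> Fin 1" "w \<noteq> Fin (-1)" "w \<noteq> Infty" for w
    using that power_map[of 2] by (cases w) (auto simp: three_points_def power2_eq_1_iff)
  then have "has_signature ?\<nu>1 (?\<nu>1 (Fin 1)) (?\<nu>1 (Fin (-1))) (?\<nu>1 Infty)"
    by (intro has_signatureI) auto
  then show "has_signature ?\<nu>1 n n 1"
    using power_map[of 2] by (simp add: three_points_def)
qed (use covering_cyclic assms in auto)

lemma covering_tetrahedral:
  assumes "has_signature \<nu> 2 3 3" shows "\<exists>\<theta>. universal_covering \<nu> \<theta>"
proof (rule covering_transfer)
  let ?\<nu> = "three_points (Fin 0) 3 Infty 3 (Fin 1) 2"
  let ?\<nu>1 = "\<lambda>z. if z = Fin 0 \<or> z = Infty then ?\<nu> z div 3 else ?\<nu> (power_map 3 z)"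
  show "has_signature \<nu> 3 3 2" using has_signature_swap assms by blast
  show "has_signature ?\<nu> 3 3 2" by (rule three_points_signature) auto
  show "orbifold_covering ?\<nu>1 (power_map 3) ?\<nu>" by (rule power_map_covering) (auto simp: three_points_def)
  define \<omega> where "\<omega> = Complex (-1/2) (sqrt 3 / 2)"
  define \<omega>' where "\<omega>' = Complex (-1/2) (- sqrt 3 / 2)"
  have dist: "\<omega> \<noteq> 1" "\<omega>' \<noteq> 1" "\<omega> \<noteq> \<omega>'" by (auto simp: \<omega>_def \<omega>'_def complex_eq_iff)
  have fac: "a ^ 3 - 1 = (a - 1) * ((a - \<omega>) * (a - \<omega>'))" for a
  proof -
    have "\<omega> + \<omega>' = -1" "\<omega> * \<omega>' = 1" by (auto simp: \<omega>_def \<omega>'_def complex_eq_iff)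
    moreover have "(a - 1) * ((a - \<omega>) * (a - \<omega>')) = (a - 1) * (a * a - (\<omega> + \<omega>') * a + \<omega> * \<omega>')" by (simp add: algebra_simps)
    ultimately show ?thesis by (simp add: algebra_simps power3_eq_cube)
  qed
  have cube: "a ^ 3 = 1 \<longleftrightarrow> a = 1 \<or> a = \<omega> \<or> a = \<omega>'" for a
    using fac[of a] by (metis diff_eq_diff_eq diff_self eq_iff_diff_eq_0 mult_eq_0_iff)
  then have nz: "\<omega> \<noteq> 0" "\<omega>' \<noteq> 0" by (auto simp: \<omega>_def \<omega>'_def complex_eq_iff)
  have "?\<nu>1 w = 1" if "w \<noteq> Fin 1" "w \<noteq> Fin \<omega>" "w \<noteq> Fin \<omega>'" for w
    using that power_map[of 3] cube by (cases w) (auto simp: three_points_def)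
  then have "has_signature ?\<nu>1 (?\<nu>1 (Fin 1)) (?\<nu>1 (Fin \<omega>)) (?\<nu>1 (Fin \<omega>'))"
    using dist by (intro has_signatureI) auto
  then show "has_signature ?\<nu>1 2 2 2"
    using power_map[of 3] cube nz by (simp add: three_points_def)
qed (use covering_dihedral in auto)

lemma covering_octahedral:
  assumes "has_signature \<nu> 2 3 4" shows "\<exists>\<theta>. universal_covering \<nu> \<theta>"
proof (rule covering_transfer)
  let ?\<nu> = "three_points (Fin 0) 2 Infty 4 (Fin 1) 3"
  let ?\<nu>1 = "\<lambda>z. if z = Fin 0 \<or> z = Infty then ?\<nu> z div 2 else ?\<nu> (power_map 2 z)"
  show "has_signature \<nu> 2 4 3" using has_signature_swap assms by blast
  show "has_signature ?\<nu> 2 4 3" by (rule three_points_signature) auto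
  show "orbifold_covering ?\<nu>1 (power_map 2) ?\<nu>" by (rule power_map_covering) (auto simp: three_points_def)
  have "?\<nu>1 w = 1" if "w \<noteq> Infty" "w \<noteq> Fin 1" "w \<noteq> Fin (-1)" for w
    using that power_map[of 2] by (cases w) (auto simp: three_points_def power2_eq_1_iff)
  then have "has_signature ?\<nu>1 (?\<nu>1 Infty) (?\<nu>1 (Fin 1)) (?\<nu>1 (Fin (-1)))"
    by (intro has_signatureI) auto
  then show "has_signature ?\<nu>1 2 3 3"
    using power_map[of 2] by (simp add: three_points_def)
qed (use covering_tetrahedral in auto)

text \<open>The degree \<open>5\<close> polynomial \<open>w = z\<^sup>3 (z\<^sup>2 + 5 z + 40)\<close> with
  \<open>w - 1728 = (z\<^sup>2 + 4 z + 24)\<^sup>2 (z - 3)\<close> is the quotient of the tetrahedral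
  by the icosahedral orbifold.\<close>

lemma covering_icosahedral:
  assumes "has_signature \<nu> 2 3 5" shows "\<exists>\<theta>. universal_covering \<nu> \<theta>"
proof (rule covering_transfer[OF assms])
  let ?\<nu> = "three_points (Fin 1728) 2 (Fin 0) 3 Infty 5"
  define p :: "complex poly" where "p = [:0, 0, 0, 40, 5, 1:]"
  have deg: "degree p = 5" "degree p \<ge> 1" by (simp_all add: p_def)
  define w where "w = poly_map p"
  let ?\<nu>1 = "\<lambda>z. ?\<nu> (w z) div local_degree w z"
  show "has_signature ?\<nu> 2 3 5" by (rule three_points_signature) auto
  have pd: "pderiv p = [:0, 0, 120, 20, 5:]" "pderiv [:0, 0, 120, 20, 5:] = [:0, 240, 60, 20 :: complex:]"
      "pderiv [:0, 240, 60, 20 :: complex:] = [:240, 120, 60:]"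
    by (simp_all add: p_def pderiv_pCons)
  have val: "w (Fin a) = Fin (a ^ 3 * (a ^ 2 + 5 * a + 40))" "w Infty = Infty" for a
    unfolding w_def poly_map_simps[OF deg(2)] by (simp_all add: p_def power_numeral_reduce algebra_simps)
  have sub: "a ^ 3 * (a ^ 2 + 5 * a + 40) - 1728 = (a ^ 2 + 4 * a + 24) ^ 2 * (a - 3)" for a :: complex
    by (simp add: power_numeral_reduce algebra_simps)
  have ldI: "local_degree w Infty = 5" unfolding w_def using poly_map_local_degree_Infty[OF deg(2)] deg by simp
  have ld0: "local_degree w (Fin 0) = 3"
  proof -
    have "order 0 (pderiv p) = Suc (Suc (order 0 [:240, 120, 60 :: complex:]))"
      by (simp add: pd order_pderiv[of "[:0, 0, 120, 20, 5:]" 0] order_pderiv[of "[:0, 240, 60, 20:]" 0])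
    also have "order 0 [:240, 120, 60 :: complex:] = 0" by (intro order_0I) simp
    finally show ?thesis unfolding w_def poly_map_local_degree_Fin[OF deg(2)] by simp
  qed
  have ld1: "local_degree w (Fin a) = 1" if "a \<noteq> 0" "a ^ 2 + 4 * a + 24 \<noteq> 0" for a
  proof -
    have "poly (pderiv p) a = 5 * a ^ 2 * (a ^ 2 + 4 * a + 24)" by (simp add: pd power_numeral_reduce algebra_simps)
    then have "order a (pderiv p) = 0" using that by (intro order_0I) simp
    then show ?thesis unfolding w_def poly_map_local_degree_Fin[OF deg(2)] by simp
  qed
  have ld2: "local_degree w (Fin a) = 2" if a: "a ^ 2 + 4 * a + 24 = 0" for a
  proof -
    have "poly (pderiv p) a = 5 * a ^ 2 * (a ^ 2 + 4 * a + 24)" by (simp add: pd power_numeral_reduce algebra_simps)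
    then have 1: "poly (pderiv p) a = 0" using a by simp
    have a0: "a \<noteq> 0" "a \<noteq> -12" using a by auto
    have "poly (pderiv (pderiv p)) a = 20 * a * ((a ^ 2 + 4 * a + 24) - (a + 12))" by (simp add: pd power_numeral_reduce algebra_simps)
    also have "\<dots> = 20 * a * (- (a + 12))" using a by simp
    also have "\<dots> \<noteq> 0"
    proof -
      have "a + 12 \<noteq> 0" using a0(2) by (simp add: add_eq_0_iff2)
      then show ?thesis using a0(1) by (simp only: mult_eq_0_iff neg_equal_0_iff_equal) simp
    qed
    finally have "order a (pderiv (pderiv p)) = 0" by (rule order_0I)
    moreover have "pderiv p \<noteq> 0" by (simp add: pd)
    ultimately have "order a (pderiv p) = 1" using order_pderiv[OF _ 1] by simp
    then show ?thesis unfolding w_def poly_map_local_degree_Fin[OF deg(2)] by simp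
  qed
  define r where "r = Complex (-5/2) (sqrt 135 / 2)"
  define s where "s = Complex (-5/2) (- sqrt 135 / 2)"
  have rs: "a ^ 2 + 5 * a + 40 = (a - r) * (a - s)" for a
  proof -
    have "r + s = -5" "r * s = 40" by (auto simp: r_def s_def complex_eq_iff)
    moreover have "(a - r) * (a - s) = a * a - (r + s) * a + r * s" by (simp add: algebra_simps)
    ultimately show ?thesis by (simp add: power2_eq_square algebra_simps)
  qed
  have roots: "a ^ 2 + 5 * a + 40 = 0 \<longleftrightarrow> a = r \<or> a = s" for a by (simp add: rs)
  have dist: "r \<noteq> s" "r \<noteq> 3" "s \<noteq> 3" "r \<noteq> 0" "s \<noteq> 0" by (auto simp: r_def s_def complex_eq_iff)
  have v2: "?\<nu> (w (Fin a)) = 2" if "a ^ 2 + 4 * a + 24 = 0" for a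
    using sub[of a] that by (simp add: val three_points_def)
  have cop: "a ^ 2 + 4 * a + 24 \<noteq> 0" if "a = r \<or> a = s" for a
  proof
    assume "a ^ 2 + 4 * a + 24 = 0"
    moreover have "a ^ 2 + 5 * a + 40 = 0" using that roots by blast
    ultimately have "a + 16 = 0" by algebra
    then have "a = -16" by (simp add: add_eq_0_iff2)
    then show False using that by (auto simp: r_def s_def complex_eq_iff)
  qed
  have rat: "rational_function w" unfolding w_def by (rule poly_map_rational[OF deg(2)])
  have dvd: "local_degree w z dvd ?\<nu> (w z)" for z
  proof (cases z)
    case Infty then show ?thesis by (simp add: ldI val three_points_def)
  next
    case (Fin a)
    consider "a = 0" | "a ^ 2 + 4 * a + 24 = 0" | "a \<noteq> 0" "a ^ 2 + 4 * a + 24 \<noteq> 0" by blast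
    then show ?thesis
    proof cases
      case 1 then show ?thesis by (simp add: Fin ld0 val three_points_def)
    next
      case 2 then show ?thesis using v2 ld2 by (simp add: Fin)
    next
      case 3 then show ?thesis using ld1 by (simp add: Fin)
    qed
  qed
  then show "orbifold_covering ?\<nu>1 w ?\<nu>" using rat by (simp add: orbifold_covering_def)
  have "?\<nu>1 z = 1" if z: "z \<noteq> Fin 3" "z \<noteq> Fin r" "z \<noteq> Fin s" for z
  proof (cases z)
    case Infty then show ?thesis by (simp add: ldI val three_points_def)
  next
    case (Fin a)
    consider "a = 0" | "a ^ 2 + 4 * a + 24 = 0" | "a \<noteq> 0" "a ^ 2 + 4 * a + 24 \<noteq> 0" by blast
    then show ?thesis
    proof cases
      case 1 then show ?thesis by (simp add: Fin ld0 val three_points_def)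
    next
      case 2 then show ?thesis using v2 ld2 by (simp add: Fin)
    next
      case 3
      have "a ^ 3 * (a ^ 2 + 5 * a + 40) \<noteq> 0" using 3 roots z Fin by auto
      moreover have "a ^ 3 * (a ^ 2 + 5 * a + 40) \<noteq> 1728"
        using sub[of a] 3 z Fin by auto
      ultimately have "?\<nu> (w z) = 1" by (simp add: Fin val three_points_def)
      then show ?thesis using ld1[OF 3] by (simp add: Fin)
    qed
  qed
  then have "has_signature ?\<nu>1 (?\<nu>1 (Fin 3)) (?\<nu>1 (Fin r)) (?\<nu>1 (Fin s))"
    using dist by (intro has_signatureI) auto
  moreover have "?\<nu>1 (Fin 3) = 2"
    using ld1[of 3] sub[of 3] by (simp add: val three_points_def)
  moreover have "?\<nu>1 (Fin r) = 3" "?\<nu>1 (Fin s) = 3"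
    using ld1[of r] ld1[of s] cop roots[of r] roots[of s] dist by (auto simp: val three_points_def)
  ultimately show "has_signature ?\<nu>1 2 3 3" by simp
qed (use covering_tetrahedral in auto)

theorem universal_covering_exists:
  assumes "good_orbifold \<nu>" "orbifold_euler \<nu> > 0"
  shows "\<exists>\<theta>. universal_covering \<nu> \<theta>"
proof -
  obtain x y z where xyz: "has_signature \<nu> x y z" "spherical x y z"
    using spherical_classification[OF assms] by blast
  from xyz(2) consider "x = y" "z = 1" "x \<ge> 1" | "x = 2" "y = 2" "z \<ge> 1" | "x = 2" "y = 3" "z = 3" | "x = 2" "y = 3" "z = 4"
    | "x = 2" "y = 3" "z = 5" unfolding spherical_def by force
  then show ?thesis
  proof cases
    case 1 then show ?thesis using covering_cyclic[of \<nu> y] xyz(1) by simp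
  next
    case 2 then show ?thesis using covering_dihedral[of \<nu> z] xyz(1) by simp
  next
    case 3 then show ?thesis using covering_tetrahedral xyz(1) by simp
  next
    case 4 then show ?thesis using covering_octahedral xyz(1) by simp
  next
    case 5 then show ?thesis using covering_icosahedral xyz(1) by simp
  qed
qed

lemma pullback_dvd:
  assumes "orbifold \<nu>" "\<nu> (f z) dvd local_degree f z * k"
  shows "pullback_orbifold f \<nu> z dvd k"
proof -
  define g where "g = gcd (local_degree f z) (\<nu> (f z))"
  have \<nu>: "\<nu> (f z) \<ge> 1" using assms(1) by (rule orbifold_pos)
  then have g: "g \<noteq> 0" by (simp add: g_def)
  have "coprime (local_degree f z div g) (\<nu> (f z) div g)"
    unfolding g_def using \<nu> by (intro div_gcd_coprime) auto
  moreover have "\<nu> (f z) = \<nu> (f z) div g * g" "local_degree f z = local_degree f z div g * g" by (simp_all add: g_def)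
  then have "\<nu> (f z) div g * g dvd local_degree f z div g * k * g" using assms(2) by (metis mult.assoc mult.commute)
  then have "\<nu> (f z) div g dvd local_degree f z div g * k" using g by simp
  ultimately have "\<nu> (f z) div g dvd k" by (metis coprime_commute coprime_dvd_mult_right_iff)
  then show ?thesis by (simp add: pullback_orbifold_def g_def)
qed

lemma dvd_pullback: "\<nu> (f z) dvd local_degree f z * pullback_orbifold f \<nu> z"
  using pullback_times[of f \<nu> z] by (metis dvd_triv_left gcd_dvd1 mult.commute mult_dvd_mono dvd_refl)

text \<open>Pull back by \<open>z ^ m\<close>: over the plane the composite lifts to the universal covering, and the
  lift extends to infinity, which forces the ramification there to divide \<open>m\<close>.\<close>

lemma pullback_dvd_of_two_points:
  assumes \<theta>: "universal_covering \<nu> \<theta>" and \<nu>: "orbifold \<nu>" and f: "rational_function f"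
    and ab: "a \<noteq> b" "\<And>z. z \<noteq> a \<Longrightarrow> z \<noteq> b \<Longrightarrow> pullback_orbifold f \<nu> z = 1"
  shows "pullback_orbifold f \<nu> b dvd pullback_orbifold f \<nu> a"
proof -
  define m where "m = pullback_orbifold f \<nu> a"
  have m: "m \<ge> 1" using orbifold_pos pullback_is_orbifold[OF f \<nu>] by (simp add: m_def)
  obtain c where c: "c \<noteq> a" "c \<noteq> b" using distinct_sphere by blast
  obtain \<mu> where \<mu>: "mobius \<mu>" "\<mu> (Fin 0) = a" "\<mu> Infty = b"
    using mobius_transitive[of "Fin 0" Infty "Fin 1" a b c] ab c by auto
  have inj: "\<mu> v = \<mu> w \<longleftrightarrow> v = w" for v w using mobius_bij[OF \<mu>(1)] by (auto simp: bij_def inj_def)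
  note pm = power_map[OF m]
  define g where "g = f \<circ> (\<mu> \<circ> power_map m)"
  have rm: "rational_function (\<mu> \<circ> power_map m)" by (intro rational_compose mobius_rational \<mu> pm)
  have rg: "rational_function g" unfolding g_def by (intro rational_compose f rm)
  have ld: "local_degree g z = local_degree f (\<mu> (power_map m z)) * local_degree (power_map m) z" for z
    unfolding g_def using local_degree_compose[OF f rm] local_degree_compose[OF mobius_rational[OF \<mu>(1)] pm(1)]
    by (simp add: mobius_local_degree[OF \<mu>(1)])
  have "\<nu> (g Infty) dvd local_degree g Infty"
  proof (rule local_degree_dvd_of_lift[OF \<theta> rg])
    fix z
    have "pullback_orbifold f \<nu> (\<mu> (power_map m (Fin z))) = local_degree (power_map m) (Fin z)"
    proof (cases "z = 0")
      case True then show ?thesis using pm m \<mu> by (simp add: m_def[symmetric] power_0_left)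
    next
      case False
      then have "pullback_orbifold f \<nu> (\<mu> (power_map m (Fin z))) = 1"
        using inj[of "power_map m (Fin z)"] \<mu>(2,3) pm(2) by (intro ab(2)) (metis power_eq_0_iff riemann_sphere.inject, metis riemann_sphere.distinct(1))
      then show ?thesis using pm(4) False by simp
    qed
    then show "\<nu> (g (Fin z)) dvd local_degree g (Fin z)"
      unfolding ld using dvd_pullback[of \<nu> f "\<mu> (power_map m (Fin z))"] by (simp add: g_def)
  qed
  then have "\<nu> (f b) dvd local_degree f b * m" unfolding ld using pm \<mu>(3) by (simp add: g_def)
  then show ?thesis using pullback_dvd[OF \<nu>] by (simp add: m_def)
qed

theorem pullback_good:
  assumes \<theta>: "universal_covering \<nu> \<theta>" and \<nu>: "orbifold \<nu>" and f: "rational_function f"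
  shows "good_orbifold (pullback_orbifold f \<nu>)"
proof -
  define \<nu>' where "\<nu>' = pullback_orbifold f \<nu>"
  have o: "orbifold \<nu>'" unfolding \<nu>'_def by (rule pullback_is_orbifold[OF f \<nu>])
  have one: "\<nu>' z = 1" if "\<not> \<nu>' z > 1" for z using that orbifold_pos[OF o, of z] by simp
  have eq: "\<nu>' a = \<nu>' b" if "a \<noteq> b" "{z. \<nu>' z > 1} \<subseteq> {a, b}" for a b
  proof -
    have 1: "\<nu>' z = 1" if "z \<noteq> a" "z \<noteq> b" for z using that one \<open>{z. \<nu>' z > 1} \<subseteq> {a, b}\<close> by blast
    show ?thesis using pullback_dvd_of_two_points[OF \<theta> \<nu> f, of a b] pullback_dvd_of_two_points[OF \<theta> \<nu> f, of b a] 1 \<open>a \<noteq> b\<close>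
      unfolding \<nu>'_def[symmetric] by (metis dvd_antisym)
  qed
  have "\<not> bad_orbifold \<nu>'"
  proof
    assume "bad_orbifold \<nu>'"
    then consider a where "{x. \<nu>' x > 1} = {a}" | a b where "a \<noteq> b" "{x. \<nu>' x > 1} = {a, b}" "\<nu>' a \<noteq> \<nu>' b"
      unfolding bad_orbifold_def by blast
    then show False
    proof cases
      case 1
      obtain b where "b \<noteq> a" using distinct_sphere by blast
      then have "\<nu>' a = \<nu>' b" using eq[of a b] 1 by auto
      moreover have "\<nu>' a > 1" "\<not> \<nu>' b > 1" using 1 \<open>b \<noteq> a\<close> by blast+
      ultimately show False by simp
    next
      case 2 then show False using eq[of a b] by simp
    qed
  qed
  then show ?thesis using o by (simp add: good_orbifold_def \<nu>'_def)
qed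

lemma universal_covering_good:
  assumes "universal_covering \<nu> \<theta>" "orbifold \<nu>" shows "good_orbifold \<nu>"
proof -
  have "pullback_orbifold (\<lambda>x. x) \<nu> = \<nu>"
    by (rule ext) (simp add: pullback_orbifold_def mobius_local_degree[OF mobius_id])
  then show ?thesis using pullback_good[OF assms rational_id] by simp
qed

lemma spherical_max:
  assumes "spherical x y z" "n \<in> {x, y, z, 1}" shows "n \<le> max x z"
  using assms unfolding spherical_def by auto

lemma spherical_unique:
  assumes s: "spherical x y z" "spherical x' y' z'"
    and e: "1 / real x + 1 / real y + 1 / real z = 1 / real x' + 1 / real y' + 1 / real z'"
    and m: "max x z = max x' z'"
  shows "x = x' \<and> y = y' \<and> z = z'"
proof -
  have A: "max x z = x" "1 / real x + 1 / real y + 1 / real z = 1 + 2 / real (max x z)"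
    if "x = y" "z = 1" "x \<ge> 1" for x y z :: nat using that by (auto simp: max_def)
  have B: "max x z = z" "1 / real x + 1 / real y + 1 / real z = 1 + 1 / real (max x z)"
    if "x = 2" "y = 2" "z \<ge> 2" for x y z :: nat using that by (auto simp: max_def)
  define M where "M = max x z"
  have M: "M \<ge> 1" using s(1) by (auto simp: spherical_def M_def)
  from s(1) consider "x = y" "z = 1" "x \<ge> 1" | "x = 2" "y = 2" "z \<ge> 2" | "x = 2" "y = 3" "z \<in> {3, 4, 5}"
    unfolding spherical_def by blast
  note c = this
  from s(2) consider "x' = y'" "z' = 1" "x' \<ge> 1" | "x' = 2" "y' = 2" "z' \<ge> 2" | "x' = 2" "y' = 3" "z' \<in> {3, 4, 5}"
    unfolding spherical_def by blast
  note c' = this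
  show ?thesis
  proof (cases rule: c)
    case 1
    note c1 = 1
    note a = A[OF 1, folded M_def]
    show ?thesis
    proof (cases rule: c')
      case 1
      then show ?thesis using c1 m by (auto simp: max_def split: if_splits)
    next
      case 2
      then show ?thesis using a(2) B(2)[OF 2] e m[folded M_def] M by simp
    next
      case 3
      then show ?thesis using a(2) e m[folded M_def] by auto
    qed
  next
    case 2
    note c2 = 2
    note b = B[OF 2, folded M_def]
    show ?thesis
    proof (cases rule: c')
      case 1
      then show ?thesis using b(2) A(2)[OF 1] e m[folded M_def] M by simp
    next
      case 2
      then show ?thesis using c2 m by (auto simp: max_def split: if_splits)
    next
      case 3
      then show ?thesis using b(2) e m[folded M_def] by auto
    qed
  next
    case 3
    note c3 = 3
    show ?thesis
    proof (cases rule: c')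
      case 1
      then show ?thesis using A(2)[OF 1] e m c3 by auto
    next
      case 2
      then show ?thesis using B(2)[OF 2] e m c3 by auto
    next
      case 3
      then show ?thesis using c3 m by auto
    qed
  qed
qed

section \<open>Decomposition of a map of orbifolds\<close>

lemma eq_comp_surj:
  assumes "rational_function q" "f \<circ> q = g \<circ> q" shows "f = g"
  using assms rational_surj by (metis comp_apply ext)

lemma root_unity_coprime:
  fixes c :: complex
  assumes "c ^ a = 1" "c ^ b = 1" "coprime a b" shows "c = 1"
proof (cases "b = 1")
  case True then show ?thesis using assms by simp
next
  case False
  then obtain x y where xy: "a * x = b * y + 1" using coprime_bezout_strong[OF assms(3)] by blast
  have "1 = c ^ (a * x)" using assms(1) by (simp add: power_mult)
  also have "\<dots> = c" using assms(2) by (simp add: xy power_add power_mult)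
  finally show ?thesis by simp
qed

lemma comp_power:
  assumes "q \<circ> \<sigma> = \<tau> \<circ> q" shows "q \<circ> (\<sigma> ^^ m) = (\<tau> ^^ m) \<circ> q"
proof (induction m)
  case (Suc m)
  have "q \<circ> (\<sigma> ^^ Suc m) = (q \<circ> \<sigma>) \<circ> (\<sigma> ^^ m)" by (simp add: comp_assoc)
  also have "\<dots> = \<tau> \<circ> (q \<circ> (\<sigma> ^^ m))" by (simp add: assms comp_assoc)
  also have "\<dots> = (\<tau> ^^ Suc m) \<circ> q" by (simp only: Suc.IH funpow.simps comp_assoc)
  finally show ?case .
qed simp

locale lifted_map =
  fixes f \<theta> \<theta>' q :: "riemann_sphere \<Rightarrow> riemann_sphere" and \<nu> :: "riemann_sphere \<Rightarrow> nat"
  assumes f: "rational_function f" and \<nu>: "orbifold \<nu>"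
    and \<theta>: "universal_covering \<nu> \<theta>" and \<theta>': "universal_covering (pullback_orbifold f \<nu>) \<theta>'"
    and q: "rational_function q" and eq: "f \<circ> \<theta>' = \<theta> \<circ> q"
begin

abbreviation "\<nu>' \<equiv> pullback_orbifold f \<nu>"

lemma r\<theta>: "rational_function \<theta>" and r\<theta>': "rational_function \<theta>'"
  using \<theta> \<theta>' by (auto intro: universal_covering_rational)

lemma \<nu>': "orbifold \<nu>'"
  by (rule pullback_is_orbifold[OF f \<nu>])

lemma degree_coprime: "coprime (local_degree q z) (\<nu>' (\<theta>' z))"
proof -
  define l where "l = local_degree f (\<theta>' z)"
  define n where "n = \<nu> (f (\<theta>' z))"
  define g where "g = gcd l n"
  have pos: "n \<ge> 1" using orbifold_pos[OF \<nu>] by (simp add: n_def)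
  then have g: "g \<noteq> 0" by (simp add: g_def)
  have n': "\<nu>' (\<theta>' z) = n div g" by (simp add: pullback_orbifold_def n_def l_def g_def)
  have e: "f (\<theta>' z) = \<theta> (q z)" using eq by (auto simp: fun_eq_iff)
  have "local_degree (\<theta> \<circ> q) z = n * local_degree q z"
    using local_degree_compose[OF r\<theta> q] universal_covering_degree[OF \<theta>] by (simp add: n_def e)
  moreover have "local_degree (f \<circ> \<theta>') z = l * (n div g)"
    using local_degree_compose[OF f r\<theta>'] universal_covering_degree[OF \<theta>'] by (simp add: l_def n')
  ultimately have "n * local_degree q z = l * (n div g)" using eq by simp
  moreover have "n = n div g * g" "l = l div g * g" by (simp_all add: g_def)
  ultimately have "(n div g * g) * local_degree q z = (n div g * g) * (l div g)"
    by (metis mult.assoc mult.commute)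
  then have "local_degree q z = l div g" using pos \<open>n = n div g * g\<close> by auto
  moreover have "coprime (l div g) (n div g)" unfolding g_def using pos by (intro div_gcd_coprime) auto
  ultimately show ?thesis by (simp add: n')
qed

lemma deck_push: "\<exists>\<tau>\<in>deck \<theta>. q \<circ> \<sigma> = \<tau> \<circ> q" if \<sigma>: "\<sigma> \<in> deck \<theta>'"
proof -
  have r\<sigma>: "rational_function \<sigma>" and inv: "\<theta>' \<circ> \<sigma> = \<theta>'" using \<sigma> by (auto simp: deck_def)
  have e: "\<theta> (q (\<sigma> z)) = \<theta> (q z)" for z using eq inv by (metis comp_apply)
  obtain c where c: "\<And>z. \<theta> z = c \<Longrightarrow> local_degree \<theta> z = 1" using unramified_value[OF r\<theta>] by blast
  obtain z where z: "\<theta> (q z) = c" using rational_surj[OF rational_compose[OF r\<theta> q], of c] by auto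
  obtain \<tau> where \<tau>: "\<tau> \<in> deck \<theta>" "\<tau> (q z) = q (\<sigma> z)" using deck_transitive[OF \<theta>, of "q z" "q (\<sigma> z)"] e by metis
  have "q \<circ> \<sigma> = \<tau> \<circ> q"
  proof (rule lift_unique_sphere[OF r\<theta>])
    show "rational_function (q \<circ> \<sigma>)" "rational_function (\<tau> \<circ> q)"
      using q r\<sigma> \<tau> by (auto simp: deck_def intro: rational_compose)
    show "\<theta> \<circ> (q \<circ> \<sigma>) = \<theta> \<circ> (\<tau> \<circ> q)" using \<tau>(1) e by (auto simp: deck_def fun_eq_iff)
    show "(q \<circ> \<sigma>) z = (\<tau> \<circ> q) z" using \<tau>(2) by simp
    show "local_degree \<theta> ((q \<circ> \<sigma>) z) = 1" using c e z by simp
  qed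
  then show ?thesis using \<tau>(1) by blast
qed

definition push :: "(riemann_sphere \<Rightarrow> riemann_sphere) \<Rightarrow> riemann_sphere \<Rightarrow> riemann_sphere" where
  "push \<sigma> = (SOME \<tau>. \<tau> \<in> deck \<theta> \<and> q \<circ> \<sigma> = \<tau> \<circ> q)"

lemma push: "push \<sigma> \<in> deck \<theta>" "q \<circ> \<sigma> = push \<sigma> \<circ> q" if "\<sigma> \<in> deck \<theta>'"
proof -
  have "\<exists>\<tau>. \<tau> \<in> deck \<theta> \<and> q \<circ> \<sigma> = \<tau> \<circ> q" using deck_push[OF that] by blast
  from someI_ex[OF this] show "push \<sigma> \<in> deck \<theta>" "q \<circ> \<sigma> = push \<sigma> \<circ> q" by (simp_all add: push_def)
qed

lemma push_compose:
  assumes "\<sigma> \<in> deck \<theta>'" "\<tau> \<in> deck \<theta>'" shows "push \<sigma> \<circ> push \<tau> = push (\<sigma> \<circ> \<tau>)"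
proof (rule eq_comp_surj[OF q])
  have "push (\<sigma> \<circ> \<tau>) \<circ> q = (q \<circ> \<sigma>) \<circ> \<tau>" using push(2)[OF deck_compose[OF assms]] by (simp add: comp_assoc)
  also have "\<dots> = push \<sigma> \<circ> (q \<circ> \<tau>)" using push(2)[OF assms(1)] by (simp add: comp_assoc)
  also have "\<dots> = (push \<sigma> \<circ> push \<tau>) \<circ> q" using push(2)[OF assms(2)] by (simp add: comp_assoc)
  finally show "(push \<sigma> \<circ> push \<tau>) \<circ> q = push (\<sigma> \<circ> \<tau>) \<circ> q" by simp
qed

lemma push_id: "push (\<lambda>x. x) = (\<lambda>x. x)"
  by (rule eq_comp_surj[OF q]) (use push(2)[OF deck_id] in \<open>auto simp: fun_eq_iff\<close>)

text \<open>A deck transformation with trivial image fixes some \<open>z\<close>; its multiplier there is a root of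
  unity of the coprime orders \<open>local_degree \<theta>' z\<close> and \<open>local_degree q z\<close>.\<close>

lemma push_inj: "inj_on push (deck \<theta>')"
proof (rule inj_onI)
  fix \<sigma> \<tau> assume st: "\<sigma> \<in> deck \<theta>'" "\<tau> \<in> deck \<theta>'" "push \<sigma> = push \<tau>"
  note i\<tau> = deck_inv[OF r\<theta>' st(2)]
  note m\<tau> = mobius_inv[OF deck_mobius[OF r\<theta>' st(2)]]
  define \<rho> where "\<rho> = \<sigma> \<circ> inv \<tau>"
  have \<rho>: "\<rho> \<in> deck \<theta>'" unfolding \<rho>_def by (rule deck_compose[OF st(1) i\<tau>])
  have "push \<rho> = push \<tau> \<circ> push (inv \<tau>)" unfolding \<rho>_def using push_compose[OF st(1) i\<tau>] st(3) by simp
  also have "\<dots> = push (\<lambda>x. x)" using push_compose[OF st(2) i\<tau>] m\<tau>(2) by simp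
  finally have q\<rho>: "q \<circ> \<rho> = q" using push(2)[OF \<rho>] push_id by (simp add: o_def)
  have r: "rational_function \<rho>" "\<theta>' \<circ> \<rho> = \<theta>'" using \<rho> by (auto simp: deck_def)
  obtain z where z: "\<rho> z = z" using rational_fixed_point[OF r(1)] by blast
  obtain c where c: "multiplier \<rho> z c" using multiplier_exists[OF deck_mobius[OF r\<theta>' \<rho>] z] by blast
  have "c ^ local_degree q z = 1" by (rule multiplier_invariant(1)[OF c q q\<rho> r(1)])
  moreover have "c ^ \<nu>' (\<theta>' z) = 1"
    using multiplier_invariant(1)[OF c r\<theta>' r(2,1)] universal_covering_degree[OF \<theta>'] by simp
  ultimately have "c = 1" using root_unity_coprime degree_coprime by blast
  then have "\<rho> = (\<lambda>x. x)" using multiplier_invariant(2)[OF c q q\<rho> r(1)] by blast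
  then have "\<sigma> (inv \<tau> y) = y" for y by (metis \<rho>_def comp_apply)
  then show "\<sigma> = \<tau>" using m\<tau>(3) by (metis comp_apply ext)
qed

definition \<Gamma> where "\<Gamma> = push ` deck \<theta>'"

lemma \<Gamma>_deck: "\<Gamma> \<subseteq> deck \<theta>"
  using push(1) by (auto simp: \<Gamma>_def)

lemma \<Gamma>_group: "mobius_group \<Gamma>"
proof
  show "finite \<Gamma>" using deck_card(1)[OF \<theta>'] by (simp add: \<Gamma>_def)
  show "mobius \<sigma>" if "\<sigma> \<in> \<Gamma>" for \<sigma> using that \<Gamma>_deck deck_mobius[OF r\<theta>] by blast
  show "(\<lambda>x. x) \<in> \<Gamma>" using push_id deck_id[of \<theta>'] unfolding \<Gamma>_def by (metis imageI)
  show "\<sigma> \<circ> \<tau> \<in> \<Gamma>" if "\<sigma> \<in> \<Gamma>" "\<tau> \<in> \<Gamma>" for \<sigma> \<tau>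
    using that push_compose deck_compose unfolding \<Gamma>_def by (auto intro!: image_eqI)
  show "inv \<sigma> \<in> \<Gamma>" if \<sigma>: "\<sigma> \<in> \<Gamma>" for \<sigma>
  proof -
    obtain \<tau> where \<tau>: "\<tau> \<in> deck \<theta>'" "\<sigma> = push \<tau>" using \<sigma> by (auto simp: \<Gamma>_def)
    note i\<tau> = deck_inv[OF r\<theta>' \<tau>(1)]
    note m\<tau> = mobius_inv[OF deck_mobius[OF r\<theta>' \<tau>(1)]]
    have 1: "push (inv \<tau>) \<circ> push \<tau> = (\<lambda>x. x)" "push \<tau> \<circ> push (inv \<tau>) = (\<lambda>x. x)"
      using push_compose[OF i\<tau> \<tau>(1)] push_compose[OF \<tau>(1) i\<tau>] m\<tau> push_id by simp_all
    have "inv \<sigma> = push (inv \<tau>)"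
      unfolding \<tau>(2) by (rule inv_unique_comp) (use 1 in \<open>simp_all add: id_def\<close>)
    then show ?thesis using i\<tau> by (simp add: \<Gamma>_def)
  qed
qed

lemma card_\<Gamma>: "card \<Gamma> = rat_degree \<theta>'"
  unfolding \<Gamma>_def using card_image[OF push_inj] deck_card(2)[OF \<theta>'] by simp

text \<open>The intermediate orbifold is the quotient of the sphere by \<open>\<Gamma>\<close>. It has the same Euler
  characteristic as the pullback, and the ramification indices of either are bounded by those of
  the other, so both have the same signature.\<close>

theorem decomposition:
  assumes \<chi>: "orbifold_euler \<nu>' > 0"
  shows "\<exists>w t. rational_function w \<and> rational_function t \<and> f = w \<circ> t \<and>
           (\<exists>\<theta>' \<theta>. universal_covering \<nu>' \<theta>' \<and> universal_covering \<nu> \<theta> \<and> \<theta> = w \<circ> \<theta>') \<and>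
           orbifold_covering \<nu>' w \<nu>"
proof -
  interpret \<Gamma>: mobius_group \<Gamma> by (rule \<Gamma>_group)
  obtain \<psi> where \<psi>: "rational_function \<psi>" "rat_degree \<psi> = card \<Gamma>" "\<And>x y. \<psi> x = \<psi> y \<longleftrightarrow> (\<exists>\<sigma>\<in>\<Gamma>. \<sigma> x = y)"
    using \<Gamma>.quotient by blast
  have \<psi>\<sigma>: "\<psi> \<circ> \<sigma> = \<psi>" if "\<sigma> \<in> \<Gamma>" for \<sigma> using \<psi>(3) that by (metis comp_apply ext)
  have ldc: "local_degree \<psi> x = local_degree \<psi> y" if xy: "\<psi> x = \<psi> y" for x y
  proof -
    obtain \<sigma> where \<sigma>: "\<sigma> \<in> \<Gamma>" "\<sigma> x = y" using \<psi>(3) xy by blast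
    then show ?thesis using compose_mobius_local_degree[OF \<psi>(1) \<Gamma>.mob[OF \<sigma>(1)], of x] \<psi>\<sigma> by simp
  qed
  define \<nu>'' where "\<nu>'' c = local_degree \<psi> (SOME x. \<psi> x = c)" for c
  have \<nu>''_\<psi>: "\<nu>'' (\<psi> x) = local_degree \<psi> x" for x
    unfolding \<nu>''_def by (rule ldc) (rule someI[of "\<lambda>y. \<psi> y = \<psi> x" x], simp)
  have uc'': "universal_covering \<nu>'' \<psi>"
    using \<psi>(1) \<nu>''_\<psi> by (simp add: universal_covering_def orbifold_covering_def)
  have o'': "orbifold \<nu>''"
  proof -
    have "\<nu>'' c \<ge> 1" for c unfolding \<nu>''_def by (rule local_degree_pos[OF \<psi>(1)])
    moreover have "{c. \<nu>'' c > 1} \<subseteq> \<psi> ` {x. local_degree \<psi> x > 1}"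
    proof
      fix c assume "c \<in> {c. \<nu>'' c > 1}"
      then show "c \<in> \<psi> ` {x. local_degree \<psi> x > 1}" using rational_surj[OF \<psi>(1), of c] \<nu>''_\<psi> by auto
    qed
    ultimately show ?thesis
      unfolding orbifold_def using rational_riemann_hurwitz(1)[OF \<psi>(1)] by (meson finite_imageI finite_subset)
  qed
  have \<chi>'': "orbifold_euler \<nu>'' = orbifold_euler \<nu>'"
  proof -
    have "rat_degree \<theta>' * orbifold_euler \<nu>'' = rat_degree \<theta>' * orbifold_euler \<nu>'"
      using euler_universal[OF uc'' o''] euler_universal[OF \<theta>' \<nu>'] \<psi>(2) card_\<Gamma> by simp
    then show ?thesis using rational_degree_pos[OF r\<theta>'] by simp
  qed

  have "\<exists>t. rational_function t \<and> \<psi> \<circ> q = t \<circ> \<theta>'"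
  proof (rule rational_factor[OF r\<theta>' rational_compose[OF \<psi>(1) q]])
    fix a b assume "\<theta>' a = \<theta>' b"
    then obtain \<sigma> where \<sigma>: "\<sigma> \<in> deck \<theta>'" "\<sigma> a = b" using deck_transitive[OF \<theta>'] by blast
    have "q b = push \<sigma> (q a)" using push(2)[OF \<sigma>(1)] \<sigma>(2) by (metis comp_apply)
    moreover have "push \<sigma> \<in> \<Gamma>" using \<sigma>(1) by (simp add: \<Gamma>_def)
    ultimately show "(\<psi> \<circ> q) a = (\<psi> \<circ> q) b" using \<psi>(3) by auto
  qed
  then obtain t where t: "rational_function t" "\<psi> \<circ> q = t \<circ> \<theta>'" by blast
  have "\<exists>w. rational_function w \<and> \<theta> = w \<circ> \<psi>"
  proof (rule rational_factor[OF \<psi>(1) r\<theta>])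
    fix x y assume "\<psi> x = \<psi> y"
    then obtain \<tau> where "\<tau> \<in> \<Gamma>" "\<tau> x = y" using \<psi>(3) by blast
    moreover from this have "\<theta> \<circ> \<tau> = \<theta>" using \<Gamma>_deck by (auto simp: deck_def)
    ultimately show "\<theta> x = \<theta> y" by (metis comp_apply)
  qed
  then obtain w where w: "rational_function w" "\<theta> = w \<circ> \<psi>" by blast
  have fwt: "f = w \<circ> t"
  proof (rule eq_comp_surj[OF r\<theta>'])
    show "f \<circ> \<theta>' = (w \<circ> t) \<circ> \<theta>'" using eq w(2) t(2) by (simp add: comp_assoc)
  qed

  have le1: "\<exists>y. \<nu>'' c \<le> \<nu>' y" for c
  proof -
    obtain x where x: "\<psi> x = c" using rational_surj[OF \<psi>(1)] by blast
    define n where "n = local_degree \<psi> x"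
    have n: "n \<ge> 1" using local_degree_pos[OF \<psi>(1)] by (simp add: n_def)
    define \<zeta> where "\<zeta> = exp (2 * of_real pi * \<i> * of_nat 1 / of_nat n)"
    have \<zeta>: "\<zeta> ^ n = 1" unfolding \<zeta>_def using n by (intro complex_root_unity) auto
    have "\<exists>\<tau>\<in>\<Gamma>. multiplier \<tau> x \<zeta>"
      by (rule rotation_exists[OF \<psi>(1) \<Gamma>.fin])
        (use \<Gamma>.mob mobius_rational \<psi>(3) \<zeta> n_def in auto)
    then obtain \<sigma> where \<sigma>: "\<sigma> \<in> deck \<theta>'" "multiplier (push \<sigma>) x \<zeta>" by (auto simp: \<Gamma>_def)
    obtain z where z: "\<sigma> z = z" using rational_fixed_point \<sigma>(1) by (auto simp: deck_def)
    obtain c0 where c0: "multiplier \<sigma> z c0" using multiplier_exists[OF deck_mobius[OF r\<theta>' \<sigma>(1)] z] by blast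
    define m where "m = local_degree \<theta>' z"
    have d\<sigma>: "\<sigma> ^^ j \<in> deck \<theta>'" for j
    proof (induction j)
      case 0 then show ?case using deck_id by (simp add: id_def)
    next
      case (Suc j) then show ?case using deck_compose[OF \<sigma>(1)] by (simp only: funpow.simps)
    qed
    have rs: "rational_function \<sigma>" "\<theta>' \<circ> \<sigma> = \<theta>'" using \<sigma>(1) by (auto simp: deck_def)
    have "c0 ^ m = 1" unfolding m_def by (rule multiplier_invariant(1)[OF c0 r\<theta>' rs(2,1)])
    then have "multiplier (\<sigma> ^^ m) z 1" using multiplier_funpow[OF c0, of m] by simp
    moreover have "rational_function (\<sigma> ^^ m)" "\<theta>' \<circ> (\<sigma> ^^ m) = \<theta>'" using d\<sigma>[of m] by (auto simp: deck_def)
    ultimately have id: "\<sigma> ^^ m = (\<lambda>x. x)" using multiplier_invariant(2)[OF _ r\<theta>'] by blast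
    have "(push \<sigma> ^^ m) \<circ> q = q \<circ> (\<sigma> ^^ m)" by (rule comp_power[OF push(2)[OF \<sigma>(1)], symmetric])
    also have "\<dots> = (\<lambda>x. x) \<circ> q" unfolding id by (simp add: o_def)
    finally have "(push \<sigma> ^^ m) \<circ> q = (\<lambda>x. x) \<circ> q" .
    then have "push \<sigma> ^^ m = (\<lambda>x. x)" by (rule eq_comp_surj[OF q])
    then have "multiplier (\<lambda>x. x) x (\<zeta> ^ m)" using multiplier_funpow[OF \<sigma>(2), of m] by simp
    then have "\<zeta> ^ m = 1" using multiplier_unique multiplier_id by blast
    then have "exp (2 * of_real pi * \<i> * of_nat m / of_nat n) = 1"
      unfolding \<zeta>_def by (simp flip: exp_of_nat_mult add: mult_ac)
    then have "n dvd m" using complex_root_unity_eq_1[of n m] n by simp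
    moreover have "m \<ge> 1" unfolding m_def by (rule local_degree_pos[OF r\<theta>'])
    ultimately have "n \<le> m" by (auto dest: dvd_imp_le)
    then show ?thesis using \<nu>''_\<psi>[of x] x universal_covering_degree[OF \<theta>', of z] by (auto simp: n_def m_def)
  qed
  have le2: "\<exists>c. \<nu>' y \<le> \<nu>'' c" for y
  proof -
    obtain z where z: "\<theta>' z = y" using rational_surj[OF r\<theta>'] by blast
    have "local_degree \<psi> (q z) * local_degree q z = local_degree t y * \<nu>' y"
      using local_degree_compose[OF \<psi>(1) q, of z] local_degree_compose[OF t(1) r\<theta>', of z] t(2) z
        universal_covering_degree[OF \<theta>', of z] by simp
    then have "\<nu>' y dvd local_degree \<psi> (q z) * local_degree q z" by simp
    then have "\<nu>' y dvd local_degree \<psi> (q z)"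
      using degree_coprime[of z] z by (metis coprime_commute coprime_dvd_mult_left_iff)
    then have "\<nu>' y \<le> local_degree \<psi> (q z)" using local_degree_pos[OF \<psi>(1), of "q z"] by (auto dest: dvd_imp_le)
    then show ?thesis using \<nu>''_\<psi> by metis
  qed
  obtain x y z where s: "has_signature \<nu>' x y z" "spherical x y z"
    using spherical_classification[OF pullback_good[OF \<theta> \<nu> f] \<chi>] by blast
  obtain x' y' z' where s'': "has_signature \<nu>'' x' y' z'" "spherical x' y' z'"
    using spherical_classification[OF universal_covering_good[OF uc'' o'']] \<chi> \<chi>'' by auto
  have bound: "max x z \<le> max x' z'"
    if \<alpha>: "has_signature \<alpha> x y z" and \<beta>: "has_signature \<beta> x' y' z'" "spherical x' y' z'"
      and le: "\<And>v. \<exists>c. \<alpha> v \<le> \<beta> c"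
    for \<alpha> \<beta> :: "riemann_sphere \<Rightarrow> nat" and x y z x' y' z'
  proof -
    obtain a b where "\<alpha> a = x" "\<alpha> b = z" using \<alpha> unfolding has_signature_def by blast
    moreover have "\<alpha> v \<le> max x' z'" for v
      using le[of v] has_signature_value[OF \<beta>(1)] spherical_max[OF \<beta>(2)] order_trans by blast
    ultimately show ?thesis by (metis max.bounded_iff)
  qed
  have "max x z = max x' z'"
    using bound[OF s(1) s''(1,2) le2] bound[OF s''(1) s le1] by (rule order_antisym)
  moreover have "1 / real x + 1 / real y + 1 / real z = 1 / real x' + 1 / real y' + 1 / real z'"
    using signature_euler[OF s(1) \<nu>'] signature_euler[OF s''(1) o''] \<chi>'' by simp
  ultimately have "x = x'" "y = y'" "z = z'" using spherical_unique[OF s(2) s''(2)] by blast+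
  then obtain \<mu> where \<mu>: "mobius \<mu>" "\<And>v. \<nu>'' (\<mu> v) = \<nu>' v"
    using has_signature_mobius[OF s''(1)] s(1) by blast
  note inv = mobius_inv[OF \<mu>(1)]
  have inv': "\<mu> (inv \<mu> v) = v" "inv \<mu> (\<mu> v) = v" for v using inv by (auto simp: fun_eq_iff)
  have cov: "orbifold_covering \<nu>'' w \<nu>"
    unfolding orbifold_covering_def
  proof (intro conjI allI w(1))
    fix c
    obtain x where x: "\<psi> x = c" using rational_surj[OF \<psi>(1)] by blast
    have "\<nu> (w c) = local_degree \<theta> x" using universal_covering_degree[OF \<theta>, of x] w(2) x by auto
    also have "\<dots> = local_degree w c * \<nu>'' c" using local_degree_compose[OF w(1) \<psi>(1), of x] w(2) x \<nu>''_\<psi> by auto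
    finally show "\<nu> (w c) = \<nu>'' c * local_degree w c" by simp
  qed
  show ?thesis
  proof (intro exI conjI)
    show "rational_function (w \<circ> \<mu>)" "rational_function (inv \<mu> \<circ> t)"
      by (intro rational_compose w t mobius_rational \<mu> inv)+
    show "f = (w \<circ> \<mu>) \<circ> (inv \<mu> \<circ> t)" unfolding fwt by (simp add: fun_eq_iff inv')
    show "universal_covering \<nu>' (inv \<mu> \<circ> \<psi>)"
      by (rule universal_covering_compose[OF mobius_covering[OF inv(1)] uc'']) (simp add: \<mu>(2)[symmetric] inv')
    show "universal_covering \<nu> \<theta>" by (rule \<theta>)
    show "\<theta> = (w \<circ> \<mu>) \<circ> (inv \<mu> \<circ> \<psi>)" unfolding w(2) by (simp add: fun_eq_iff inv')
    show "orbifold_covering \<nu>' (w \<circ> \<mu>) \<nu>"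
      using cov w(1) \<mu> by (auto simp: orbifold_covering_def compose_mobius_local_degree intro: rational_compose mobius_rational)
  qed
qed

end

theorem theorem1p5:
  fixes f :: "riemann_sphere \<Rightarrow> riemann_sphere" and \<nu> :: "riemann_sphere \<Rightarrow> nat"
  assumes "rational_function f"
    and "good_orbifold \<nu>"
    and "orbifold_euler (pullback_orbifold f \<nu>) > 0"
  shows "orbifold_euler \<nu> > 0 \<and>
         (\<forall>\<theta>' \<theta>. universal_covering (pullback_orbifold f \<nu>) \<theta>' \<and> universal_covering \<nu> \<theta> \<longrightarrow>
           (\<exists>q. rational_function q \<and> f \<circ> \<theta>' = \<theta> \<circ> q) \<and>
           rat_degree \<theta> dvd rat_degree \<theta>' * rat_degree f) \<and>
         (\<exists>w t. rational_function w \<and> rational_function t \<and> f = w \<circ> t \<and>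
           (\<exists>\<theta>' \<theta>. universal_covering (pullback_orbifold f \<nu>) \<theta>' \<and> universal_covering \<nu> \<theta> \<and>
              \<theta> = w \<circ> \<theta>') \<and>
           orbifold_covering (pullback_orbifold f \<nu>) w \<nu> \<and>
           real (rat_degree w) = orbifold_euler (pullback_orbifold f \<nu>) / orbifold_euler \<nu>)"
proof -
  let ?\<nu>' = "pullback_orbifold f \<nu>"
  note f = assms(1)
  have \<nu>: "orbifold \<nu>" using assms(2) by (simp add: good_orbifold_def)
  have pos: "orbifold_euler \<nu> > 0"
  proof -
    have "0 < rat_degree f * orbifold_euler \<nu>" using euler_pullback_le[OF f \<nu>] assms(3) by linarith
    then show ?thesis by (simp add: zero_less_mult_iff)
  qed
  have lift: "\<exists>q. rational_function q \<and> f \<circ> \<theta>' = \<theta> \<circ> q"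
    if uc: "universal_covering ?\<nu>' \<theta>'" "universal_covering \<nu> \<theta>" for \<theta>' \<theta>
  proof -
    note r\<theta>' = universal_covering_rational[OF uc(1)]
    have r: "rational_function (f \<circ> \<theta>')" by (rule rational_compose[OF f r\<theta>'])
    obtain w where w: "\<theta> w = (f \<circ> \<theta>') Infty" using rational_surj[OF universal_covering_rational[OF uc(2)]] by blast
    have dvd: "\<nu> ((f \<circ> \<theta>') z) dvd local_degree (f \<circ> \<theta>') z" for z
      using dvd_pullback[of \<nu> f "\<theta>' z"] local_degree_compose[OF f r\<theta>', of z] universal_covering_degree[OF uc(1), of z] by simp
    obtain q where "rational_function q" "\<theta> \<circ> q = f \<circ> \<theta>'" using rational_lift[OF uc(2) r dvd w] by blast
    then show ?thesis by (intro exI[of _ q]) simp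
  qed
  have part1: "rat_degree \<theta> dvd rat_degree \<theta>' * rat_degree f"
    if uc: "universal_covering ?\<nu>' \<theta>'" "universal_covering \<nu> \<theta>" for \<theta>' \<theta>
  proof -
    obtain q where q: "rational_function q" "f \<circ> \<theta>' = \<theta> \<circ> q" using lift[OF uc] by blast
    have "rat_degree f * rat_degree \<theta>' = rat_degree \<theta> * rat_degree q"
      using rat_degree_compose[OF f universal_covering_rational[OF uc(1)]]
        rat_degree_compose[OF universal_covering_rational[OF uc(2)] q(1)] q(2) by simp
    then show ?thesis by (metis dvd_triv_left mult.commute)
  qed
  obtain \<theta> where \<theta>: "universal_covering \<nu> \<theta>" using universal_covering_exists[OF assms(2) pos] by blast
  obtain \<theta>' where \<theta>': "universal_covering ?\<nu>' \<theta>'"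
    using universal_covering_exists[OF pullback_good[OF \<theta> \<nu> f] assms(3)] by blast
  obtain q where q: "rational_function q" "f \<circ> \<theta>' = \<theta> \<circ> q" using lift[OF \<theta>' \<theta>] by blast
  interpret lifted_map f \<theta> \<theta>' q \<nu> by unfold_locales (use f \<nu> \<theta> \<theta>' q in auto)
  obtain w t where wt: "rational_function w" "rational_function t" "f = w \<circ> t"
      "\<exists>\<theta>' \<theta>. universal_covering ?\<nu>' \<theta>' \<and> universal_covering \<nu> \<theta> \<and> \<theta> = w \<circ> \<theta>'" "orbifold_covering ?\<nu>' w \<nu>"
    using decomposition[OF assms(3)] by blast
  have "real (rat_degree w) = orbifold_euler ?\<nu>' / orbifold_euler \<nu>"
    using euler_covering[OF wt(5) \<nu>] pos by simp
  then show ?thesis using pos lift part1 wt by blast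
qed

end
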